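(* Let $F=\mathbb{R}$ and let $r,s$ be nonnegative integers with $r+s>0$. Then, with $k\ge 0$ an integer, the complex Lie algebra $\mathfrak{H}_{r,s}\otimes\mathbb{C}$ is given up to isomorphism as follows: - $r+s=8k$: $\mathfrak{so}(2^{4k},\mathbb{R})\otimes\mathbb{C}$; - $r+s=8k+1$: $\mathfrak{su}(2^{4k})\otimes\mathbb{C}$; - $r+s=8k+2$: $\mathfrak{sp}(2^{4k})\otimes\mathbb{C}$; - $r+s=8k+3$: $(\mathfrak{sp}(2^{4k})\times\mathfrak{sp}(2^{4k}))\otimes\mathbb{C}$; - $r+s=8k+4$: $\mathfrak{sp}(2^{4k+1})\otimes\mathbb{C}$; - $r+s=8k+5$: $\mathfrak{su}(2^{4k+2})\otimes\mathbb{C}$; - $r+s=8k+6$: $\mathfrak{so}(2^{4k+3},\mathbb{R})\otimes\mathbb{C}$; - $r+s=8k+7$: $(\mathfrak{so}(2^{4k+3},\mathbb{R})\times\mathfrak{so}(2^{4k+3},\mathbb{R}))\otimes\mathbb{C}$.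
   Context: Let $n=r+s$ and let $C\ell(r,s)$ be the Clifford algebra over $\mathbb{R}$ of $\mathbb{R}^n$ with canonical basis $e_1,\dots,e_n$ and symmetric bilinear form $Q$ with $Q(e_i,e_j)=0$ for $i\ne j$, $Q(e_i,e_i)=1$ for $1\le i\le r$, $Q(e_i,e_i)=-1$ for $r+1\le i\le r+s$; the sign convention is $v\cdot v=-Q(v,v)1$. Let $c$ be the unique algebra anti-automorphism of $C\ell(r,s)$ with $c(v)=-v$ for $v\in\mathbb{R}^n$, and let $\mathfrak{G}_{r,s}=\{\varphi\in C\ell(r,s): c(\varphi)=-\varphi\}$ with bracket $[x,y]=xy-yx$. For $I=(i_1<\dots<i_m)$, $m\ge 1$, with entries in $\{1,\dots,n\}$ put $e_I=e_{i_1}\cdots e_{i_m}$, $|I|=m$; $\mathfrak{G}_{r,s}$ is the span of the $e_I$ with $|I|\equiv 1$ or $2\pmod 4$. One has $\mathfrak{G}_{r,s}=\mathfrak{Z}(\mathfrak{G}_{r,s})\oplus\mathfrak{H}_{r,s}$, where the center $\mathfrak{Z}(\mathfrak{G}_{r,s})$ is $\mathbb{R}\,e_1e_2\cdots e_n$ if $n\equiv 1\pmod 4$ and $\{0\}$ otherwise, and $\mathfrak{H}_{r,s}$ is the semisimple ideal spanned by all $e_I\in\mathfrak{G}_{r,s}$, with $I=(1,\dots,n)$ excluded when $n\equiv1\pmod 4$. Here $\mathfrak{sp}(m)$ is the compact symplectic Lie algebra of rank $m$ (skew-Hermitian quaternionic $m\times m$ matrices). *)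

theory Defs
  imports
    "HOL-Algebra.QuotRing"
    "HOL-Library.Poly_Mapping"
    "Jordan_Normal_Form.Schur_Decomposition"
begin

section \<open>Lie algebras with explicit carrier\<close>

record ('k, 'v) lie_algebra = "'v partial_object" +
  lie_add :: "'v \<Rightarrow> 'v \<Rightarrow> 'v"
  lie_scale :: "'k \<Rightarrow> 'v \<Rightarrow> 'v"
  lie_bracket :: "'v \<Rightarrow> 'v \<Rightarrow> 'v"

definition lie_iso :: "('k, 'v) lie_algebra \<Rightarrow> ('k, 'w) lie_algebra \<Rightarrow> ('v \<Rightarrow> 'w) set" where
  "lie_iso L M = {f. bij_betw f (carrier L) (carrier M) \<and>
     (\<forall>x\<in>carrier L. \<forall>y\<in>carrier L. f (lie_add L x y) = lie_add M (f x) (f y)) \<and>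
     (\<forall>a. \<forall>x\<in>carrier L. f (lie_scale L a x) = lie_scale M a (f x)) \<and>
     (\<forall>x\<in>carrier L. \<forall>y\<in>carrier L. f (lie_bracket L x y) = lie_bracket M (f x) (f y))}"

definition lie_isomorphic :: "('k, 'v) lie_algebra \<Rightarrow> ('k, 'w) lie_algebra \<Rightarrow> bool"
    (infix \<open>\<cong>\<^sub>L\<close> 50) where
  "L \<cong>\<^sub>L M \<longleftrightarrow> lie_iso L M \<noteq> {}"

definition lie_product ::
    "('k, 'v) lie_algebra \<Rightarrow> ('k, 'w) lie_algebra \<Rightarrow> ('k, 'v \<times> 'w) lie_algebra"
    (infixr \<open>\<times>\<^sub>L\<close> 70) where
  "L \<times>\<^sub>L M =
    \<lparr> carrier = carrier L \<times> carrier M,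
      lie_add = (\<lambda>(x, y) (x', y'). (lie_add L x x', lie_add M y y')),
      lie_scale = (\<lambda>a (x, y). (lie_scale L a x, lie_scale M a y)),
      lie_bracket = (\<lambda>(x, y) (x', y'). (lie_bracket L x x', lie_bracket M y y')) \<rparr>"

text \<open>The complexification of \<open>L\<close> is \<open>L \<otimes> \<complex>\<close> over the reals; the pair \<open>(x, y)\<close>
  stands for \<open>x \<otimes> 1 + y \<otimes> \<i>\<close>.\<close>

definition complexification :: "(real, 'v) lie_algebra \<Rightarrow> (complex, 'v \<times> 'v) lie_algebra" where
  "complexification L =
    \<lparr> carrier = carrier L \<times> carrier L,
      lie_add = (\<lambda>(x, y) (x', y'). (lie_add L x x', lie_add L y y')),
      lie_scale = (\<lambda>z (x, y).
        (lie_add L (lie_scale L (Re z) x) (lie_scale L (- Im z) y),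
         lie_add L (lie_scale L (Re z) y) (lie_scale L (Im z) x))),
      lie_bracket = (\<lambda>(x, y) (x', y').
        (lie_add L (lie_bracket L x x') (lie_scale L (- 1) (lie_bracket L y y')),
         lie_add L (lie_bracket L x y') (lie_bracket L y x'))) \<rparr>"


section \<open>Quaternions\<close>

datatype quat = Quat (qRe: real) (qI: real) (qJ: real) (qK: real)

lemma quat_eq_iff: "p = q \<longleftrightarrow> qRe p = qRe q \<and> qI p = qI q \<and> qJ p = qJ q \<and> qK p = qK q"
  by (cases p; cases q) simp

instantiation quat :: real_algebra_1
begin

definition "0 = Quat 0 0 0 0"
definition "1 = Quat 1 0 0 0"
definition "p + q = Quat (qRe p + qRe q) (qI p + qI q) (qJ p + qJ q) (qK p + qK q)"
definition "- p = Quat (- qRe p) (- qI p) (- qJ p) (- qK p)"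
definition "p - q = Quat (qRe p - qRe q) (qI p - qI q) (qJ p - qJ q) (qK p - qK q)"
definition "a *\<^sub>R p = Quat (a * qRe p) (a * qI p) (a * qJ p) (a * qK p)"
definition "p * q = Quat
  (qRe p * qRe q - qI p * qI q - qJ p * qJ q - qK p * qK q)
  (qRe p * qI q + qI p * qRe q + qJ p * qK q - qK p * qJ q)
  (qRe p * qJ q - qI p * qK q + qJ p * qRe q + qK p * qI q)
  (qRe p * qK q + qI p * qJ q - qJ p * qI q + qK p * qRe q)"

lemmas quat_defs = zero_quat_def one_quat_def plus_quat_def uminus_quat_def minus_quat_def
  scaleR_quat_def times_quat_def

instance
  by standard (simp_all add: quat_defs quat_eq_iff algebra_simps)

end

definition qcnj :: "quat \<Rightarrow> quat" where
  "qcnj p = Quat (qRe p) (- qI p) (- qJ p) (- qK p)"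


section \<open>The compact classical Lie algebras\<close>

definition matrix_lie_algebra :: "'a::real_algebra_1 mat set \<Rightarrow> (real, 'a mat) lie_algebra" where
  "matrix_lie_algebra S =
    \<lparr> carrier = S,
      lie_add = (+),
      lie_scale = (\<lambda>a A. of_real a \<cdot>\<^sub>m A),
      lie_bracket = (\<lambda>A B. A * B - B * A) \<rparr>"

definition so :: "nat \<Rightarrow> (real, real mat) lie_algebra" where
  "so m = matrix_lie_algebra {A \<in> carrier_mat m m. transpose_mat A = - A}"

definition su :: "nat \<Rightarrow> (real, complex mat) lie_algebra" where
  "su m = matrix_lie_algebra
    {A \<in> carrier_mat m m. mat_adjoint A = - A \<and> (\<Sum>i<m. A $$ (i, i)) = 0}"

text \<open>The conjugate transpose is written out because \<^const>\<open>mat_adjoint\<close> requires a field.\<close>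

definition sp :: "nat \<Rightarrow> (real, quat mat) lie_algebra" where
  "sp m = matrix_lie_algebra {A \<in> carrier_mat m m. map_mat qcnj (transpose_mat A) = - A}"


section \<open>The tensor algebra\<close>

datatype 'a word = Word (letters: "'a list")

instantiation word :: (type) monoid_add
begin

definition "0 = Word []"
definition "u + v = Word (letters u @ letters v)"

instance
  by standard (simp_all add: zero_word_def plus_word_def)

end

text \<open>The product of \<^typ>\<open>nat word \<Rightarrow>\<^sub>0 real\<close> is the convolution along concatenation of words.
  With respect to the basis \<open>x\<^sub>1, \<dots>, x\<^sub>n\<close>, the tensor algebra of \<open>\<real>\<^sup>n\<close> is the algebra of
  noncommutative polynomials in \<open>x\<^sub>1, \<dots>, x\<^sub>n\<close>, where the word \<open>i\<^sub>1 \<dots> i\<^sub>m\<close> stands for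
  the pure tensor of \<open>x\<close> with these indices.\<close>

definition tensor_algebra :: "nat \<Rightarrow> (nat word \<Rightarrow>\<^sub>0 real) ring" where
  "tensor_algebra n =
    \<lparr> carrier = {p. \<forall>w \<in> Poly_Mapping.keys p. set (letters w) \<subseteq> {1..n}},
      monoid.mult = (*), one = 1, zero = 0, add = (+) \<rparr>"

definition tensor_scalar :: "real \<Rightarrow> nat word \<Rightarrow>\<^sub>0 real" where
  "tensor_scalar a = Poly_Mapping.single (Word []) a"

text \<open>Vectors of \<open>\<real>\<^sup>n\<close> are represented by functions \<open>v :: nat \<Rightarrow> real\<close>, of which only the values
  \<open>v 1, \<dots>, v n\<close> are ever used.\<close>

definition tensor_vec :: "nat \<Rightarrow> (nat \<Rightarrow> real) \<Rightarrow> nat word \<Rightarrow>\<^sub>0 real" where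
  "tensor_vec n v = (\<Sum>i=1..n. Poly_Mapping.single (Word [i]) (v i))"

lemma tensor_algebra_ring: "ring (tensor_algebra n)"
proof (rule ringI)
  let ?T = "{p :: nat word \<Rightarrow>\<^sub>0 real. \<forall>w \<in> Poly_Mapping.keys p. set (letters w) \<subseteq> {1..n}}"
  have add: "p + q \<in> ?T" if "p \<in> ?T" "q \<in> ?T" for p q
  proof -
    have "set (letters w) \<subseteq> {1..n}" if w: "w \<in> Poly_Mapping.keys (p + q)" for w
    proof -
      have "w \<in> Poly_Mapping.keys p \<or> w \<in> Poly_Mapping.keys q"
        using subsetD[OF Poly_Mapping.keys_add w] by simp
      with \<open>p \<in> ?T\<close> \<open>q \<in> ?T\<close> show ?thesis
        by (auto simp del: atLeastAtMost_iff)
    qed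
    then show ?thesis by simp
  qed
  have mult: "p * q \<in> ?T" if "p \<in> ?T" "q \<in> ?T" for p q
  proof -
    have "set (letters w) \<subseteq> {1..n}" if w: "w \<in> Poly_Mapping.keys (p * q)" for w
    proof -
      obtain u v
        where "w = u + v" "u \<in> Poly_Mapping.keys p" "v \<in> Poly_Mapping.keys q"
        using subsetD[OF keys_mult w] by auto
      with \<open>p \<in> ?T\<close> \<open>q \<in> ?T\<close> show ?thesis
        by (simp add: plus_word_def)
    qed
    then show ?thesis by simp
  qed
  show "abelian_group (tensor_algebra n)"
  proof (rule abelian_groupI)
    fix p assume "p \<in> carrier (tensor_algebra n)"
    then have "- p \<in> carrier (tensor_algebra n)"
      by (simp add: tensor_algebra_def)
    then show "\<exists>q\<in>carrier (tensor_algebra n).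
        q \<oplus>\<^bsub>tensor_algebra n\<^esub> p = \<zero>\<^bsub>tensor_algebra n\<^esub>"
      by (rule bexI[rotated]) (simp add: tensor_algebra_def)
  next
    fix p q
    assume "p \<in> carrier (tensor_algebra n)" "q \<in> carrier (tensor_algebra n)"
    then have "p \<in> ?T" "q \<in> ?T" by (simp_all add: tensor_algebra_def)
    from add[OF this] show "p \<oplus>\<^bsub>tensor_algebra n\<^esub> q \<in> carrier (tensor_algebra n)"
      by (simp add: tensor_algebra_def)
  qed (simp_all add: tensor_algebra_def ac_simps)
  show "Group.monoid (tensor_algebra n)"
  proof (rule monoidI)
    fix p q
    assume "p \<in> carrier (tensor_algebra n)" "q \<in> carrier (tensor_algebra n)"
    then have "p \<in> ?T" "q \<in> ?T" by (simp_all add: tensor_algebra_def)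
    from mult[OF this] show "p \<otimes>\<^bsub>tensor_algebra n\<^esub> q \<in> carrier (tensor_algebra n)"
      by (simp add: tensor_algebra_def)
  qed (simp_all add: tensor_algebra_def mult.assoc zero_word_def)
qed (simp_all add: tensor_algebra_def distrib_left distrib_right)


section \<open>Clifford algebras\<close>

definition Q_form :: "nat \<Rightarrow> nat \<Rightarrow> (nat \<Rightarrow> real) \<Rightarrow> (nat \<Rightarrow> real) \<Rightarrow> real" where
  "Q_form r s v w = (\<Sum>i=1..r. v i * w i) - (\<Sum>i=r+1..r+s. v i * w i)"

definition clifford_ideal :: "nat \<Rightarrow> nat \<Rightarrow> (nat word \<Rightarrow>\<^sub>0 real) set" where
  "clifford_ideal r s = genideal (tensor_algebra (r + s))
    {tensor_vec (r + s) v * tensor_vec (r + s) v + tensor_scalar (Q_form r s v v) | v. True}"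

definition Cl :: "nat \<Rightarrow> nat \<Rightarrow> (nat word \<Rightarrow>\<^sub>0 real) set ring" where
  "Cl r s = tensor_algebra (r + s) Quot clifford_ideal r s"

definition Cl_class :: "nat \<Rightarrow> nat \<Rightarrow> (nat word \<Rightarrow>\<^sub>0 real) \<Rightarrow> (nat word \<Rightarrow>\<^sub>0 real) set" where
  "Cl_class r s p = clifford_ideal r s +>\<^bsub>tensor_algebra (r + s)\<^esub> p"

definition Cl_vec :: "nat \<Rightarrow> nat \<Rightarrow> (nat \<Rightarrow> real) \<Rightarrow> (nat word \<Rightarrow>\<^sub>0 real) set" where
  "Cl_vec r s v = Cl_class r s (tensor_vec (r + s) v)"

definition Cl_scale ::
    "nat \<Rightarrow> nat \<Rightarrow> real \<Rightarrow> (nat word \<Rightarrow>\<^sub>0 real) set \<Rightarrow> (nat word \<Rightarrow>\<^sub>0 real) set" where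
  "Cl_scale r s a X = Cl_class r s (tensor_scalar a) \<otimes>\<^bsub>Cl r s\<^esub> X"

lemma Cl_ring: "ring (Cl r s)"
proof -
  interpret T: ring "tensor_algebra (r + s)"
    by (rule tensor_algebra_ring)
  have keys_vec: "Poly_Mapping.keys (tensor_vec (r + s) v) \<subseteq> (\<lambda>i. Word [i]) ` {1..r + s}" for v
  proof -
    have "Poly_Mapping.keys (tensor_vec (r + s) v)
        \<subseteq> (\<Union>i\<in>{1..r + s}. Poly_Mapping.keys (Poly_Mapping.single (Word [i]) (v i)))"
      unfolding tensor_vec_def by (rule keys_sum)
    then show ?thesis by (auto split: if_splits)
  qed
  have vec: "tensor_vec (r + s) v \<in> carrier (tensor_algebra (r + s))" for v
    using keys_vec[of v] by (auto simp: tensor_algebra_def)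
  have scalar: "tensor_scalar a \<in> carrier (tensor_algebra (r + s))" for a
    by (simp add: tensor_algebra_def tensor_scalar_def)
  have "tensor_vec (r + s) v * tensor_vec (r + s) v + tensor_scalar a
      \<in> carrier (tensor_algebra (r + s))" for v a
    using T.a_closed[OF T.m_closed[OF vec[of v] vec[of v]] scalar[of a]]
    by (simp add: tensor_algebra_def)
  then have "ideal (clifford_ideal r s) (tensor_algebra (r + s))"
    unfolding clifford_ideal_def by (intro T.genideal_ideal) blast
  then show ?thesis
    unfolding Cl_def by (rule ideal.quotient_is_ring)
qed

definition Cl_anti_automorphism ::
    "nat \<Rightarrow> nat \<Rightarrow> ((nat word \<Rightarrow>\<^sub>0 real) set \<Rightarrow> (nat word \<Rightarrow>\<^sub>0 real) set) \<Rightarrow> bool" where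
  "Cl_anti_automorphism r s f \<longleftrightarrow>
     bij_betw f (carrier (Cl r s)) (carrier (Cl r s)) \<and>
     (\<forall>x\<in>carrier (Cl r s). \<forall>y\<in>carrier (Cl r s).
        f (x \<oplus>\<^bsub>Cl r s\<^esub> y) = f x \<oplus>\<^bsub>Cl r s\<^esub> f y \<and>
        f (x \<otimes>\<^bsub>Cl r s\<^esub> y) = f y \<otimes>\<^bsub>Cl r s\<^esub> f x) \<and>
     (\<forall>a. \<forall>x\<in>carrier (Cl r s). f (Cl_scale r s a x) = Cl_scale r s a (f x)) \<and>
     f \<one>\<^bsub>Cl r s\<^esub> = \<one>\<^bsub>Cl r s\<^esub>"

text \<open>Extensionality fixes the values outside the carrier; without it \<open>THE\<close> would not denote.\<close>

definition Cl_c :: "nat \<Rightarrow> nat \<Rightarrow> (nat word \<Rightarrow>\<^sub>0 real) set \<Rightarrow> (nat word \<Rightarrow>\<^sub>0 real) set" where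
  "Cl_c r s = (THE f. f \<in> extensional (carrier (Cl r s)) \<and> Cl_anti_automorphism r s f \<and>
     (\<forall>v. f (Cl_vec r s v) = \<ominus>\<^bsub>Cl r s\<^esub> Cl_vec r s v))"

definition Cl_gen :: "nat \<Rightarrow> nat \<Rightarrow> nat \<Rightarrow> (nat word \<Rightarrow>\<^sub>0 real) set" where
  "Cl_gen r s i = Cl_vec r s (\<lambda>j. if j = i then 1 else 0)"

text \<open>The product of the \<open>e\<^sub>i\<close>, \<open>i \<in> I\<close>, in increasing order of the indices.\<close>

definition Cl_basis :: "nat \<Rightarrow> nat \<Rightarrow> nat set \<Rightarrow> (nat word \<Rightarrow>\<^sub>0 real) set" where
  "Cl_basis r s I =
    foldr (\<lambda>i x. Cl_gen r s i \<otimes>\<^bsub>Cl r s\<^esub> x) (sorted_list_of_set I) \<one>\<^bsub>Cl r s\<^esub>"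


section \<open>The Lie algebras \<open>\<GG>\<^sub>r\<^sub>,\<^sub>s\<close> and \<open>\<HH>\<^sub>r\<^sub>,\<^sub>s\<close>\<close>

definition Cl_lie_subalgebra ::
    "nat \<Rightarrow> nat \<Rightarrow> (nat word \<Rightarrow>\<^sub>0 real) set set \<Rightarrow> (real, (nat word \<Rightarrow>\<^sub>0 real) set) lie_algebra" where
  "Cl_lie_subalgebra r s S =
    \<lparr> carrier = S,
      lie_add = (\<lambda>x y. x \<oplus>\<^bsub>Cl r s\<^esub> y),
      lie_scale = Cl_scale r s,
      lie_bracket = (\<lambda>x y. (x \<otimes>\<^bsub>Cl r s\<^esub> y) \<ominus>\<^bsub>Cl r s\<^esub> (y \<otimes>\<^bsub>Cl r s\<^esub> x)) \<rparr>"

definition G_lie :: "nat \<Rightarrow> nat \<Rightarrow> (real, (nat word \<Rightarrow>\<^sub>0 real) set) lie_algebra" where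
  "G_lie r s = Cl_lie_subalgebra r s
    {x \<in> carrier (Cl r s). Cl_c r s x = \<ominus>\<^bsub>Cl r s\<^esub> x}"

definition H_index :: "nat \<Rightarrow> nat \<Rightarrow> nat set set" where
  "H_index r s = {I. I \<noteq> {} \<and> I \<subseteq> {1..r + s} \<and> Cl_basis r s I \<in> carrier (G_lie r s) \<and>
     \<not> ((r + s) mod 4 = 1 \<and> I = {1..r + s})}"

definition H_lie :: "nat \<Rightarrow> nat \<Rightarrow> (real, (nat word \<Rightarrow>\<^sub>0 real) set) lie_algebra" where
  "H_lie r s = Cl_lie_subalgebra r s
    {(\<Oplus>\<^bsub>Cl r s\<^esub> I \<in> H_index r s. Cl_scale r s (a I) (Cl_basis r s I)) | a. True}"

end

theory Submission
  imports
    Defs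
    "HOL-Algebra.Chinese_Remainder"
begin

text \<open>Let \<open>F\<^sub>1, \<dots>, F\<^sub>n\<close> be anticommuting \<open>N \<times> N\<close> matrices over \<open>K = \<real>, \<complex>, \<H>\<close> with
  \<open>F\<^sub>i\<^sup>* = -F\<^sub>i\<close>, \<open>F\<^sub>i\<^sup>2 = -1\<close> and \<open>N\<^sup>2 dim K = 2\<^sup>n\<close>. Conjugation by the \<open>F\<^sub>i\<close> shows that the
  ordered products \<open>F\<^sub>I\<close> are orthogonal for the trace form, hence they are a real basis of the matrix
  algebra. As \<open>F\<^sub>I\<^sup>* = (-1)\<^bsup>m(m+1)/2\<^esup> F\<^sub>I\<close> for \<open>m = |I|\<close>, those with \<open>|I| \<equiv> 1, 2\<close> modulo 4 form a
  basis of the skew-Hermitian matrices; for \<open>n \<equiv> 1\<close> omitting \<open>I = {1, \<dots>, n}\<close> amounts to vanishing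
  trace. After complexification the signature is immaterial: \<open>e\<^sub>i \<mapsto> F\<^sub>i\<close> for \<open>i \<le> r\<close> and
  \<open>e\<^sub>i \<mapsto> \<i> F\<^sub>i\<close> for \<open>i > r\<close> extends to the Clifford algebra by its universal property. The
  \<open>F\<^sub>i\<close> come from tensor products of \<open>2 \<times> 2\<close> matrices for small \<open>n\<close> and from tensoring with eight
  real \<open>16 \<times> 16\<close> generators in general; for \<open>n \<equiv> 3\<close> one uses pairs of matrices and the two
  irreducible representations.\<close>

text \<open>The list of K and N is the table of the definite Clifford algebras, where every
  generator has square -1: R, C, H, H + H, M_2(H), M_4(C), M_8(R), M_8(R) + M_8(R), and tensoring
  with M_16(R) from then on. The quotient \<open>Cl r s\<close> comes without a basis, and none is
  established beforehand. The representation does this work: it sends e_I to zeta_I F_I, where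
  zeta_I is a power of i, so each e_I is nonzero and the sign by which \<open>Cl_c\<close> acts on
  it can be read off; this settles which index sets belong to \<open>H_index\<close>. Elements of
  \<open>H_lie\<close> are then handled through coefficient functions. On the complexification the
  map multiplies the I-th complex coefficient by zeta_I, which is invertible, and it respects
  brackets because it extends a ring homomorphism complex linearly. Completeness of the F_I is a
  count rather than an irreducibility argument: there are as many orthogonal vectors as real
  coordinates.\<close>

lemma poly_mapping_add_induct [case_names zero single_add]:
  fixes p :: "'b \<Rightarrow>\<^sub>0 real"
  assumes zero: "P 0" and single_add: "\<And>w a p. P p \<Longrightarrow> P (Poly_Mapping.single w a + p)"
  shows "P p"
proof (induction p rule: Poly_Mapping.update_induct)
  case const
  show ?case by (fact zero)
next
  case (update f a b)
  have "Poly_Mapping.update a b f = Poly_Mapping.single a b + f"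
    using update(1) by (intro poly_mapping_eqI)
      (auto simp: lookup_update lookup_add lookup_single when_def in_keys_iff)
  then show ?case using single_add[OF update(3)] by simp
qed

text \<open>Needed beside the unrestricted induction because \<open>Cl_gen r s i\<close> is the
  class of the letter i only for i in \<open>{1..r + s}\<close>.\<close>

lemma tensor_algebra_induct [consumes 1, case_names zero single_add]:
  assumes "p \<in> carrier (tensor_algebra n)"
    and zero: "P 0"
    and single_add: "\<And>w a p. set (letters w) \<subseteq> {1..n} \<Longrightarrow> p \<in> carrier (tensor_algebra n) \<Longrightarrow> P p \<Longrightarrow>
      P (Poly_Mapping.single w a + p)"
  shows "P p"
  using assms(1)
proof (induction p rule: Poly_Mapping.update_induct)
  case const
  show ?case by (fact zero)
next
  case (update f a b)
  have "Poly_Mapping.update a b f = Poly_Mapping.single a b + f"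
    using update(1) by (intro poly_mapping_eqI)
      (auto simp: lookup_update lookup_add lookup_single when_def in_keys_iff)
  moreover have "set (letters a) \<subseteq> {1..n} \<and> f \<in> carrier (tensor_algebra n)"
    using update(1,2,4) by (auto simp: tensor_algebra_def keys_update split: if_splits)
  ultimately show ?case using single_add update(3) by simp
qed

section \<open>Real algebras and evaluation of tensors\<close>

text \<open>Kept weak so that the Clifford algebra, its opposite, the complex pairs, the matrix
  algebras and pairs of matrices are all instances.\<close>

locale real_alg = ring R for R (structure) +
  fixes sc :: "real \<Rightarrow> 'a \<Rightarrow> 'a"
  assumes sc_closed [simp, intro]: "x \<in> carrier R \<Longrightarrow> sc a x \<in> carrier R"
    and sc_add_right: "x \<in> carrier R \<Longrightarrow> y \<in> carrier R \<Longrightarrow> sc a (x \<oplus> y) = sc a x \<oplus> sc a y"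
    and sc_add_left: "x \<in> carrier R \<Longrightarrow> sc (a + b) x = sc a x \<oplus> sc b x"
    and sc_mult: "x \<in> carrier R \<Longrightarrow> sc a (sc b x) = sc (a * b) x"
    and sc_one [simp]: "x \<in> carrier R \<Longrightarrow> sc 1 x = x"
    and sc_left: "x \<in> carrier R \<Longrightarrow> y \<in> carrier R \<Longrightarrow> sc a x \<otimes> y = sc a (x \<otimes> y)"
    and sc_right: "x \<in> carrier R \<Longrightarrow> y \<in> carrier R \<Longrightarrow> x \<otimes> sc a y = sc a (x \<otimes> y)"
begin

lemma sc_0 [simp]:
  assumes "x \<in> carrier R" shows "sc 0 x = \<zero>"
  using sc_add_left[of x 0 0] assms by (metis add.l_cancel_one' add_0 sc_closed)

lemma sc_zero [simp]: "sc a \<zero> = \<zero>"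
proof -
  have "sc a (\<zero> \<otimes> \<zero>) = \<zero> \<otimes> sc a \<zero>" by (subst sc_right) auto
  then show ?thesis by simp
qed

lemma sc_minus_left: "x \<in> carrier R \<Longrightarrow> sc (- a) x = \<ominus> sc a x"
  using sc_add_left[of x "- a" a] by (simp add: minus_equality)

lemma sc_minus_right: "x \<in> carrier R \<Longrightarrow> sc a (\<ominus> x) = \<ominus> sc a x"
  using sc_add_right[of "\<ominus> x" x a] by (simp add: l_neg minus_equality)

lemma sc_m1: "x \<in> carrier R \<Longrightarrow> sc (- 1) x = \<ominus> x"
  by (simp add: sc_minus_left)

lemma sc_finsum:
  "finite A \<Longrightarrow> f \<in> A \<rightarrow> carrier R \<Longrightarrow> sc a (\<Oplus>i\<in>A. f i) = (\<Oplus>i\<in>A. sc a (f i))"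
  by (induction A rule: finite_induct) (auto simp: sc_add_right Pi_iff)

definition lprod :: "(nat \<Rightarrow> 'a) \<Rightarrow> nat list \<Rightarrow> 'a" where
  "lprod E is = foldr (\<lambda>i x. E i \<otimes> x) is \<one>"

lemma lprod_Nil [simp]: "lprod E [] = \<one>"
  and lprod_Cons [simp]: "lprod E (i # is) = E i \<otimes> lprod E is"
  by (simp_all add: lprod_def)

lemma lprod_closed [simp, intro]: "(\<And>i. E i \<in> carrier R) \<Longrightarrow> lprod E is \<in> carrier R"
  by (induction "is") auto

lemma lprod_append:
  "(\<And>i. E i \<in> carrier R) \<Longrightarrow> lprod E (is @ js) = lprod E is \<otimes> lprod E js"
  by (induction "is") (auto simp: m_assoc)

text \<open>Substitution of \<open>E i\<close> for the letter i, the universal map out of the free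
  algebra. It is defined on words over all indices, which is why \<open>E i\<close> is required to
  lie in the carrier for every i, not only for i in \<open>{1..n}\<close>.\<close>

definition eval :: "(nat \<Rightarrow> 'a) \<Rightarrow> (nat word \<Rightarrow>\<^sub>0 real) \<Rightarrow> 'a" where
  "eval E p = (\<Oplus>w\<in>Poly_Mapping.keys p. sc (Poly_Mapping.lookup p w) (lprod E (letters w)))"

context
  fixes E :: "nat \<Rightarrow> 'a"
  assumes E: "\<And>i. E i \<in> carrier R"
begin

lemma eval_superset:
  assumes "finite A" "Poly_Mapping.keys p \<subseteq> A"
  shows "eval E p = (\<Oplus>w\<in>A. sc (Poly_Mapping.lookup p w) (lprod E (letters w)))"
  unfolding eval_def using assms E
  by (intro add.finprod_mono_neutral_cong_left) (auto simp: in_keys_iff)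

lemma eval_closed [simp, intro]: "eval E p \<in> carrier R"
  unfolding eval_def using E by (intro finsum_closed) auto

lemma eval_zero [simp]: "eval E 0 = \<zero>"
  by (simp add: eval_def)

lemma eval_add: "eval E (p + q) = eval E p \<oplus> eval E q"
proof -
  let ?A = "Poly_Mapping.keys p \<union> Poly_Mapping.keys q"
  have "eval E (p + q) = (\<Oplus>w\<in>?A. sc (Poly_Mapping.lookup (p + q) w) (lprod E (letters w)))"
    using Poly_Mapping.keys_add[of p q] by (intro eval_superset) auto
  also have "\<dots> = (\<Oplus>w\<in>?A. sc (Poly_Mapping.lookup p w) (lprod E (letters w)) \<oplus>
      sc (Poly_Mapping.lookup q w) (lprod E (letters w)))"
    using E by (intro finsum_cong') (auto simp: lookup_add sc_add_left)
  also have "\<dots> = eval E p \<oplus> eval E q"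
    using E by (subst finsum_addf) (auto simp: eval_superset[of ?A])
  finally show ?thesis .
qed

lemma eval_single: "eval E (Poly_Mapping.single w a) = sc a (lprod E (letters w))"
  using E by (subst eval_superset[of "{w}"]) auto

lemma eval_one [simp]: "eval E 1 = \<one>"
  using eval_single[of 0 1] by (simp add: zero_word_def flip: single_one)

lemma eval_mult: "eval E (p * q) = eval E p \<otimes> eval E q"
proof -
  have single: "eval E (Poly_Mapping.single w a * q) = eval E (Poly_Mapping.single w a) \<otimes> eval E q"
    for w a
  proof (induction q rule: poly_mapping_add_induct)
    case zero
    then show ?case using E by (simp add: eval_single)
  next
    case (single_add v b q)
    then show ?case using E
      by (simp add: distrib_left eval_add mult_single eval_single plus_word_def lprod_append
          sc_left sc_right sc_mult r_distr mult.commute)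
  qed
  show ?thesis
    by (induction p rule: poly_mapping_add_induct)
      (simp_all add: distrib_right eval_add l_distr single)
qed

lemma eval_ring_hom: "eval E \<in> Ring.ring_hom (tensor_algebra n) R"
  by (rule ring_hom_memI) (auto simp: tensor_algebra_def eval_mult eval_add)

lemma eval_tensor_scalar [simp]: "eval E (tensor_scalar a) = sc a \<one>"
  by (simp add: tensor_scalar_def eval_single)

lemma eval_sum: "finite A \<Longrightarrow> eval E (\<Sum>i\<in>A. f i) = (\<Oplus>i\<in>A. eval E (f i))"
  by (induction A rule: finite_induct) (auto simp: eval_add)

lemma eval_tensor_vec: "eval E (tensor_vec n v) = (\<Oplus>i\<in>{1..n}. sc (v i) (E i))"
  using E by (simp add: tensor_vec_def eval_sum eval_single)

end

end

section \<open>The universal property of the Clifford algebra\<close>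

text \<open>A coset is evaluated at an arbitrary representative; the choice is harmless once
  \<open>eval\<close> kills the Clifford ideal.\<close>

definition Cl_lift :: "nat \<Rightarrow> nat \<Rightarrow> ('a, 'm) ring_scheme \<Rightarrow> (real \<Rightarrow> 'a \<Rightarrow> 'a) \<Rightarrow> (nat \<Rightarrow> 'a) \<Rightarrow>
    (nat word \<Rightarrow>\<^sub>0 real) set \<Rightarrow> 'a" where
  "Cl_lift r s R sc E X = real_alg.eval R sc E (SOME p. p \<in> X)"

section \<open>Arithmetic of cosets in the Clifford algebra\<close>

abbreviation (input) tensor_carrier :: "nat \<Rightarrow> (nat word \<Rightarrow>\<^sub>0 real) set" where
  "tensor_carrier n \<equiv> carrier (tensor_algebra n)"

lemma tensor_scalar_carrier [simp]: "tensor_scalar a \<in> tensor_carrier n"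
  by (simp add: tensor_algebra_def tensor_scalar_def)

lemma single_carrier:
  "Poly_Mapping.single w a \<in> tensor_carrier n \<longleftrightarrow> a = 0 \<or> set (letters w) \<subseteq> {1..n}"
  by (simp add: tensor_algebra_def)

lemma tensor_algebra_simps [simp]:
  "p \<oplus>\<^bsub>tensor_algebra n\<^esub> q = p + q" "p \<otimes>\<^bsub>tensor_algebra n\<^esub> q = p * q"
  "\<one>\<^bsub>tensor_algebra n\<^esub> = 1" "\<zero>\<^bsub>tensor_algebra n\<^esub> = 0"
  by (simp_all add: tensor_algebra_def)

lemma tensor_vec_carrier [simp]: "tensor_vec n v \<in> tensor_carrier n"
proof -
  interpret T: ring "tensor_algebra n" by (rule tensor_algebra_ring)
  have "(\<Sum>i\<in>A. Poly_Mapping.single (Word [i]) (v i)) \<in> tensor_carrier n" if "finite A" "A \<subseteq> {1..n}" for A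
    using that
  proof (induction A rule: finite_induct)
    case empty
    then show ?case using T.zero_closed by simp
  next
    case (insert x F)
    then show ?case
      using T.a_closed[of "Poly_Mapping.single (Word [x]) (v x)"] by (simp add: single_carrier)
  qed
  then show ?thesis by (simp add: tensor_vec_def)
qed

lemma clifford_ideal_ideal: "ideal (clifford_ideal r s) (tensor_algebra (r + s))"
proof -
  interpret T: ring "tensor_algebra (r + s)" by (rule tensor_algebra_ring)
  show ?thesis
    unfolding clifford_ideal_def
    using T.a_closed[OF T.m_closed[OF tensor_vec_carrier tensor_vec_carrier] tensor_scalar_carrier]
    by (intro T.genideal_ideal) auto
qed

lemma carrier_Cl: "carrier (Cl r s) = Cl_class r s ` tensor_carrier (r + s)"
  by (auto simp: Cl_def FactRing_def A_RCOSETS_def' Cl_class_def)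

lemma Cl_class_hom: "Cl_class r s \<in> Ring.ring_hom (tensor_algebra (r + s)) (Cl r s)"
  using ideal.rcos_ring_hom[OF clifford_ideal_ideal]
  by (simp add: Cl_def Cl_class_def[abs_def])

lemma Cl_class_closed [simp, intro]: "p \<in> tensor_carrier (r + s) \<Longrightarrow> Cl_class r s p \<in> carrier (Cl r s)"
  by (simp add: carrier_Cl)

lemma Cl_class_add:
  "p \<in> tensor_carrier (r + s) \<Longrightarrow> q \<in> tensor_carrier (r + s) \<Longrightarrow>
    Cl_class r s (p + q) = Cl_class r s p \<oplus>\<^bsub>Cl r s\<^esub> Cl_class r s q"
  using ring_hom_add[OF Cl_class_hom] by fastforce

lemma Cl_class_mult:
  "p \<in> tensor_carrier (r + s) \<Longrightarrow> q \<in> tensor_carrier (r + s) \<Longrightarrow>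
    Cl_class r s (p * q) = Cl_class r s p \<otimes>\<^bsub>Cl r s\<^esub> Cl_class r s q"
  using ring_hom_mult[OF Cl_class_hom] by fastforce

lemma Cl_class_one [simp]: "Cl_class r s 1 = \<one>\<^bsub>Cl r s\<^esub>"
  using ring_hom_one[OF Cl_class_hom] by fastforce

lemma Cl_class_zero [simp]: "Cl_class r s 0 = \<zero>\<^bsub>Cl r s\<^esub>"
  using ring_hom_zero[OF Cl_class_hom tensor_algebra_ring Cl_ring] by fastforce

lemma Cl_class_scale:
  "p \<in> tensor_carrier (r + s) \<Longrightarrow> Cl_class r s (tensor_scalar a * p) = Cl_scale r s a (Cl_class r s p)"
  by (simp add: Cl_scale_def Cl_class_mult)

lemma tensor_scalar_commute: "tensor_scalar a * p = p * tensor_scalar a"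
  by (induction p rule: poly_mapping_add_induct)
    (simp_all add: distrib_left distrib_right tensor_scalar_def mult_single plus_word_def ac_simps)

interpretation Cl: real_alg "Cl r s" "Cl_scale r s" for r s
proof (intro real_alg.intro Cl_ring real_alg_axioms.intro)
  interpret C: ring "Cl r s" by (rule Cl_ring)
  interpret T: ring "tensor_algebra (r + s)" by (rule tensor_algebra_ring)
  fix a b x y
  assume x: "x \<in> carrier (Cl r s)"
  show "Cl_scale r s a x \<in> carrier (Cl r s)"
    using x by (auto simp: Cl_scale_def)
  show "Cl_scale r s (a + b) x = Cl_scale r s a x \<oplus>\<^bsub>Cl r s\<^esub> Cl_scale r s b x"
    using x by (simp add: Cl_scale_def C.l_distr[symmetric] Cl_class_add[symmetric]
        tensor_scalar_def single_add single_carrier)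
  show "Cl_scale r s a (Cl_scale r s b x) = Cl_scale r s (a * b) x"
    using x by (simp add: Cl_scale_def C.m_assoc[symmetric] Cl_class_mult[symmetric]
        tensor_scalar_def mult_single plus_word_def single_carrier)
  show "Cl_scale r s 1 x = x"
    using x by (simp add: Cl_scale_def tensor_scalar_def flip: zero_word_def)
  assume y: "y \<in> carrier (Cl r s)"
  show "Cl_scale r s a (x \<oplus>\<^bsub>Cl r s\<^esub> y) = Cl_scale r s a x \<oplus>\<^bsub>Cl r s\<^esub> Cl_scale r s a y"
    using x y by (simp add: Cl_scale_def C.r_distr)
  show l: "Cl_scale r s a x \<otimes>\<^bsub>Cl r s\<^esub> y = Cl_scale r s a (x \<otimes>\<^bsub>Cl r s\<^esub> y)"
    using x y by (simp add: Cl_scale_def C.m_assoc)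
  have "x \<otimes>\<^bsub>Cl r s\<^esub> Cl_class r s (tensor_scalar a) = Cl_class r s (tensor_scalar a) \<otimes>\<^bsub>Cl r s\<^esub> x"
    using x by (auto simp: carrier_Cl tensor_scalar_commute simp flip: Cl_class_mult)
  then show "x \<otimes>\<^bsub>Cl r s\<^esub> Cl_scale r s a y = Cl_scale r s a (x \<otimes>\<^bsub>Cl r s\<^esub> y)"
    using x y by (simp add: Cl_scale_def C.m_assoc[symmetric])
qed

context real_alg
begin

context
  fixes E :: "nat \<Rightarrow> 'a" and r s :: nat
  assumes E: "\<And>i. E i \<in> carrier R"
    and E_vec: "\<And>v. (\<Oplus>i\<in>{1..r + s}. sc (v i) (E i)) \<otimes> (\<Oplus>i\<in>{1..r + s}. sc (v i) (E i)) \<oplus>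
      sc (Q_form r s v v) \<one> = \<zero>"
begin

text \<open>The kernel of \<open>eval E\<close> is an ideal containing every v v + Q(v,v) 1, and the
  Clifford ideal is the smallest such ideal.\<close>

lemma eval_clifford_ideal: "p \<in> clifford_ideal r s \<Longrightarrow> eval E p = \<zero>"
proof -
  interpret T: ring "tensor_algebra (r + s)" by (rule tensor_algebra_ring)
  interpret h: ring_hom_ring "tensor_algebra (r + s)" R "eval E"
    using eval_ring_hom[OF E] by (intro ring_hom_ringI2) (auto simp: tensor_algebra_ring ring_axioms)
  have "clifford_ideal r s \<subseteq> a_kernel (tensor_algebra (r + s)) R (eval E)"
    unfolding clifford_ideal_def
  proof (rule T.genideal_minimal[OF h.kernel_is_ideal], safe)
    fix v
    have "tensor_vec (r + s) v * tensor_vec (r + s) v + tensor_scalar (Q_form r s v v) \<in> tensor_carrier (r + s)"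
      using T.a_closed[OF T.m_closed[OF tensor_vec_carrier tensor_vec_carrier] tensor_scalar_carrier]
      by auto
    moreover have "eval E (tensor_vec (r + s) v * tensor_vec (r + s) v +
        tensor_scalar (Q_form r s v v)) = \<zero>"
      using E_vec[of v]
      by (simp only: eval_add[OF E] eval_mult[OF E] eval_tensor_vec[OF E] eval_tensor_scalar[OF E])
    ultimately show "tensor_vec (r + s) v * tensor_vec (r + s) v + tensor_scalar (Q_form r s v v)
        \<in> a_kernel (tensor_algebra (r + s)) R (eval E)"
      by (simp only: a_kernel_def' mem_Collect_eq simp_thms)
  qed
  then show "p \<in> clifford_ideal r s \<Longrightarrow> eval E p = \<zero>"
    unfolding a_kernel_def' by blast
qed

lemma Cl_lift_class:
  assumes "p \<in> tensor_carrier (r + s)"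
  shows "Cl_lift r s R sc E (Cl_class r s p) = eval E p"
proof -
  interpret T: ring "tensor_algebra (r + s)" by (rule tensor_algebra_ring)
  interpret I: ideal "clifford_ideal r s" "tensor_algebra (r + s)" by (rule clifford_ideal_ideal)
  have "p \<in> Cl_class r s p"
    using assms I.a_rcos_self unfolding Cl_class_def by blast
  moreover have "eval E q = eval E p" if "q \<in> Cl_class r s p" for q
    using that eval_clifford_ideal E by (auto simp: Cl_class_def a_r_coset_def' eval_add)
  ultimately show ?thesis
    unfolding Cl_lift_def by (metis someI_ex)
qed

lemma Cl_lift_ring_hom: "Cl_lift r s R sc E \<in> Ring.ring_hom (Cl r s) R"
proof (rule ring_hom_memI)
  interpret T: ring "tensor_algebra (r + s)" by (rule tensor_algebra_ring)
  show "Cl_lift r s R sc E \<one>\<^bsub>Cl r s\<^esub> = \<one>"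
    using T.one_closed E by (simp add: Cl_lift_class flip: Cl_class_one)
  fix x assume "x \<in> carrier (Cl r s)"
  then obtain p where p: "p \<in> tensor_carrier (r + s)" "x = Cl_class r s p" by (auto simp: carrier_Cl)
  then show "Cl_lift r s R sc E x \<in> carrier R" using E by (simp add: Cl_lift_class)
  fix y assume "y \<in> carrier (Cl r s)"
  then obtain q where q: "q \<in> tensor_carrier (r + s)" "y = Cl_class r s q" by (auto simp: carrier_Cl)
  from p q E show "Cl_lift r s R sc E (x \<otimes>\<^bsub>Cl r s\<^esub> y) = Cl_lift r s R sc E x \<otimes> Cl_lift r s R sc E y"
    using T.m_closed[of p q] by (simp add: Cl_lift_class eval_mult flip: Cl_class_mult)
  from p q E show "Cl_lift r s R sc E (x \<oplus>\<^bsub>Cl r s\<^esub> y) = Cl_lift r s R sc E x \<oplus> Cl_lift r s R sc E y"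
    using T.a_closed[of p q] by (simp add: Cl_lift_class eval_add flip: Cl_class_add)
qed

lemma Cl_lift_scale:
  assumes "x \<in> carrier (Cl r s)"
  shows "Cl_lift r s R sc E (Cl_scale r s a x) = sc a (Cl_lift r s R sc E x)"
proof -
  interpret T: ring "tensor_algebra (r + s)" by (rule tensor_algebra_ring)
  from assms obtain p where p: "p \<in> tensor_carrier (r + s)" "x = Cl_class r s p" by (auto simp: carrier_Cl)
  then show ?thesis
    using E T.m_closed[of "tensor_scalar a" p]
    by (simp add: Cl_lift_class eval_mult sc_left flip: Cl_class_scale)
qed

lemma Cl_lift_vec:
  "Cl_lift r s R sc E (Cl_vec r s v) = (\<Oplus>i\<in>{1..r + s}. sc (v i) (E i))"
  using E by (simp add: Cl_vec_def Cl_lift_class eval_tensor_vec)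

end

end

section \<open>Products of anticommuting elements and their signs\<close>

context real_alg begin

context
  fixes E :: "nat \<Rightarrow> 'a" and A :: "nat set"
  assumes E: "\<And>i. E i \<in> carrier R"
    and anti: "\<And>i j. i \<in> A \<Longrightarrow> j \<in> A \<Longrightarrow> i \<noteq> j \<Longrightarrow> E i \<otimes> E j = \<ominus> (E j \<otimes> E i)"
begin

text \<open>Passing a letter different from i costs a sign, passing a copy of i costs none.\<close>

lemma lprod_commute:
  assumes "i \<in> A" "set is \<subseteq> A"
  shows "E i \<otimes> lprod E is = sc ((- 1) ^ length (filter (\<lambda>j. j \<noteq> i) is)) (lprod E is \<otimes> E i)"
  using assms(2)
proof (induction "is")
  case Nil
  show ?case using E by simp
next
  case (Cons j js)
  have L: "lprod E js \<in> carrier R" using E by blast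
  have "E i \<otimes> E j = sc (if j = i then 1 else - 1) (E j \<otimes> E i)"
    using anti[of i j] assms(1) Cons.prems E by (auto simp: sc_m1)
  then have "E i \<otimes> lprod E (j # js) = sc (if j = i then 1 else - 1) (E j \<otimes> (E i \<otimes> lprod E js))"
    using E L by (simp add: m_assoc[symmetric] sc_left)
  also have "\<dots> = sc (if j = i then 1 else - 1) (E j \<otimes>
      sc ((- 1) ^ length (filter (\<lambda>j. j \<noteq> i) js)) (lprod E js \<otimes> E i))"
    using Cons by simp
  also have "\<dots> = sc ((- 1) ^ length (filter (\<lambda>j. j \<noteq> i) (j # js))) (lprod E (j # js) \<otimes> E i)"
    using E L by (simp add: sc_right sc_mult m_assoc)
  finally show ?case .
qed

text \<open>Moving the head behind the m remaining letters costs (-1)^m, and these exponents add up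
  to the triangular number.\<close>

lemma lprod_rev:
  assumes "distinct is" "set is \<subseteq> A"
  shows "lprod E (rev is) = sc ((- 1) ^ (length is * (length is - 1) div 2)) (lprod E is)"
  using assms
proof (induction "is")
  case Nil
  show ?case using E by simp
next
  case (Cons j js)
  let ?m = "length js"
  have L: "lprod E js \<in> carrier R" using E by blast
  have f: "filter (\<lambda>k. k \<noteq> j) js = js" using Cons.prems by (induction js) auto
  have "?m * (?m - 1) div 2 + ?m = (?m + 1) * ?m div 2"
    by (cases ?m) (auto simp: algebra_simps)
  then have exp: "(- 1 :: real) ^ (?m * (?m - 1) div 2) * (- 1) ^ ?m = (- 1) ^ ((?m + 1) * ?m div 2)"
    by (subst power_add[symmetric]) (simp only:)
  have "lprod E js \<otimes> E j = sc ((- 1) ^ ?m) (E j \<otimes> lprod E js)"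
    using lprod_commute[of j js] Cons.prems E L by (simp add: f sc_mult)
  then have "lprod E (rev (j # js)) =
      sc ((- 1) ^ (?m * (?m - 1) div 2)) (sc ((- 1) ^ ?m) (E j \<otimes> lprod E js))"
    using E L Cons by (simp add: lprod_append sc_left)
  also have "\<dots> = sc ((- 1) ^ ((?m + 1) * ?m div 2)) (E j \<otimes> lprod E js)"
    by (simp only: sc_mult[OF m_closed[OF E L]] exp)
  finally show ?case by simp
qed

lemma lprod_insort:
  assumes "i \<in> A" "set is \<subseteq> A" "i \<notin> set is"
  shows "\<exists>k. lprod E (insort i is) = sc ((- 1) ^ k) (E i \<otimes> lprod E is)"
  using assms(2,3)
proof (induction "is")
  case Nil
  show ?case using E by (intro exI[of _ 0]) simp
next
  case (Cons j js)
  have L: "lprod E js \<in> carrier R" using E by blast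
  show ?case
  proof (cases "i \<le> j")
    case True
    then show ?thesis using E L by (intro exI[of _ 0]) simp
  next
    case False
    from Cons obtain k where k: "lprod E (insort i js) = sc ((- 1) ^ k) (E i \<otimes> lprod E js)" by auto
    have "E j \<otimes> E i = sc (- 1) (E i \<otimes> E j)"
      using anti[of j i] Cons.prems assms(1) E by (auto simp: sc_m1)
    then have "lprod E (insort i (j # js)) = sc ((- 1) ^ Suc k) (E i \<otimes> lprod E (j # js))"
      using False E L k by (simp add: sc_right sc_left sc_mult flip: m_assoc)
    then show ?thesis by blast
  qed
qed

text \<open>The exponent stays unspecified: the lemma serves to carry the vanishing of a trace from
  the top monomial to a product of two monomials, where the sign is irrelevant.\<close>

lemma lprod_sort:
  assumes "distinct is" "set is \<subseteq> A"
  shows "\<exists>k. lprod E (sort is) = sc ((- 1) ^ k) (lprod E is)"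
  using assms
proof (induction "is")
  case Nil
  show ?case using E by (intro exI[of _ 0]) simp
next
  case (Cons i js)
  have L: "lprod E js \<in> carrier R" using E by blast
  from Cons obtain k where k: "lprod E (sort js) = sc ((- 1) ^ k) (lprod E js)" by auto
  from Cons.prems obtain l where l: "lprod E (insort i (sort js)) = sc ((- 1) ^ l) (E i \<otimes> lprod E (sort js))"
    using lprod_insort[of i "sort js"] by auto
  have "lprod E (sort (i # js)) = sc ((- 1) ^ (l + k)) (lprod E (i # js))"
    using E L k l by (simp add: sc_right sc_mult power_add)
  then show ?case by blast
qed

text \<open>The cross terms cancel by anticommutation. This turns relations between finitely many
  generators into the Clifford relation for every vector, which the universal property asks
  for.\<close>

lemma square_sum:
  assumes "finite B" "B \<subseteq> A" and sq: "\<And>i. i \<in> A \<Longrightarrow> E i \<otimes> E i = sc (q i) \<one>"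
  shows "(\<Oplus>i\<in>B. sc (v i) (E i)) \<otimes> (\<Oplus>i\<in>B. sc (v i) (E i)) = sc (\<Sum>i\<in>B. v i * v i * q i) \<one>"
  using assms(1,2)
proof (induction B rule: finite_induct)
  case empty
  show ?case by simp
next
  case (insert x B)
  let ?S = "\<Oplus>i\<in>B. sc (v i) (E i)"
  have S: "?S \<in> carrier R" using E by (intro finsum_closed) auto
  have ac: "E x \<otimes> E i = \<ominus> (E i \<otimes> E x)" if "i \<in> B" for i
    using that insert by (intro anti) auto
  have "E x \<otimes> ?S = (\<Oplus>i\<in>B. E x \<otimes> sc (v i) (E i))"
    using E insert by (intro finsum_rdistr) auto
  also have "\<dots> = (\<Oplus>i\<in>B. sc (- 1) (sc (v i) (E i) \<otimes> E x))"
    using E by (intro finsum_cong') (auto simp: ac sc_left sc_right sc_mult sc_minus_left sc_minus_right)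
  also have "\<dots> = sc (- 1) (\<Oplus>i\<in>B. sc (v i) (E i) \<otimes> E x)"
    using E insert by (subst sc_finsum) auto
  also have "(\<Oplus>i\<in>B. sc (v i) (E i) \<otimes> E x) = ?S \<otimes> E x"
    using E insert by (intro finsum_ldistr[symmetric]) auto
  finally have comm: "E x \<otimes> ?S = \<ominus> (?S \<otimes> E x)" using E S by (simp add: sc_m1)
  have "(sc (v x) (E x) \<oplus> ?S) \<otimes> (sc (v x) (E x) \<oplus> ?S) =
      sc (v x * v x) (E x \<otimes> E x) \<oplus> (sc (v x) (E x \<otimes> ?S) \<oplus> sc (v x) (?S \<otimes> E x)) \<oplus> ?S \<otimes> ?S"
    using E S by (simp add: l_distr r_distr sc_left sc_right sc_mult sc_add_right a_ac)
  also have "sc (v x) (E x \<otimes> ?S) \<oplus> sc (v x) (?S \<otimes> E x) = \<zero>"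
    using E S by (simp add: comm sc_minus_right l_neg)
  finally show ?case
    using insert E S sq by (simp add: sc_mult sc_add_left Pi_def)
qed

end

end

section \<open>The anti-automorphism \<open>c\<close>\<close>

text \<open>An anti-homomorphism is a homomorphism into the opposite ring, so the universal property
  of the Clifford algebra also produces c.\<close>

definition op_ring :: "('a, 'm) ring_scheme \<Rightarrow> ('a, 'm) ring_scheme" where
  "op_ring R = R\<lparr>mult := \<lambda>x y. y \<otimes>\<^bsub>R\<^esub> x\<rparr>"

lemma op_ring_simps [simp]:
  "carrier (op_ring R) = carrier R" "\<one>\<^bsub>op_ring R\<^esub> = \<one>\<^bsub>R\<^esub>" "\<zero>\<^bsub>op_ring R\<^esub> = \<zero>\<^bsub>R\<^esub>"
  "x \<oplus>\<^bsub>op_ring R\<^esub> y = x \<oplus>\<^bsub>R\<^esub> y" "x \<otimes>\<^bsub>op_ring R\<^esub> y = y \<otimes>\<^bsub>R\<^esub> x"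
  by (simp_all add: op_ring_def)

lemma op_ring_finsum [simp]: "finsum (op_ring R) f A = finsum R f A"
  by (simp add: finsum_def op_ring_def)

lemma op_ring_real_alg:
  assumes "real_alg R sc"
  shows "real_alg (op_ring R) sc"
proof -
  interpret real_alg R sc by fact
  have "ring (op_ring R)"
  proof (rule ringI)
    show "abelian_group (op_ring R)"
      by (rule abelian_groupI) (auto simp: a_ac intro: bexI[of _ "\<ominus>\<^bsub>R\<^esub> _"] l_neg)
    show "Group.monoid (op_ring R)"
      by (rule monoidI) (auto simp: m_assoc)
  qed (auto simp: l_distr r_distr)
  then show ?thesis
    by (intro real_alg.intro real_alg_axioms.intro)
      (auto simp: sc_add_left sc_add_right sc_mult sc_left sc_right)
qed

lemma Cl_vec_closed [simp, intro]: "Cl_vec r s v \<in> carrier (Cl r s)"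
  by (simp add: Cl_vec_def)

lemma Cl_gen_closed [simp, intro]: "Cl_gen r s i \<in> carrier (Cl r s)"
  by (simp add: Cl_gen_def)

lemma Cl_gen_class:
  assumes "i \<in> {1..r + s}"
  shows "Cl_gen r s i = Cl_class r s (Poly_Mapping.single (Word [i]) 1)"
proof -
  have "tensor_vec (r + s) (\<lambda>j. if j = i then 1 else 0) =
      (\<Sum>j=1..r + s. if j = i then Poly_Mapping.single (Word [i]) 1 else 0)"
    unfolding tensor_vec_def by (intro sum.cong) auto
  then show ?thesis using assms by (simp add: Cl_gen_def Cl_vec_def)
qed

text \<open>Uniqueness half of the universal property: a real-linear homomorphism is determined by
  its values on the generators. It gives both the involutivity and the uniqueness of c.\<close>

lemma (in real_alg) Cl_hom_eval:
  assumes f: "f \<in> Ring.ring_hom (Cl r s) R"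
    and scale: "\<And>a x. x \<in> carrier (Cl r s) \<Longrightarrow> f (Cl_scale r s a x) = sc a (f x)"
    and p: "p \<in> tensor_carrier (r + s)"
  shows "f (Cl_class r s p) = eval (\<lambda>i. f (Cl_gen r s i)) p"
proof -
  have gen: "f (Cl_gen r s i) \<in> carrier R" for i
    using ring_hom_closed[OF f] by simp
  show ?thesis
    using p
  proof (induction p rule: tensor_algebra_induct)
    case zero
    show ?case using ring_hom_zero[OF f Cl_ring ring_axioms] gen by simp
  next
    case (single_add w a p)
    interpret T: ring "tensor_algebra (r + s)" by (rule tensor_algebra_ring)
    have word: "f (Cl_class r s (Poly_Mapping.single (Word is) 1)) = lprod (\<lambda>i. f (Cl_gen r s i)) is"
      if "set is \<subseteq> {1..r + s}" for "is"
      using that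
    proof (induction "is")
      case Nil
      show ?case using ring_hom_one[OF f] by (simp flip: zero_word_def)
    next
      case (Cons i js)
      have "Poly_Mapping.single (Word (i # js)) (1 :: real) =
          Poly_Mapping.single (Word [i]) 1 * Poly_Mapping.single (Word js) 1"
        by (simp add: mult_single plus_word_def)
      then show ?case using Cons ring_hom_mult[OF f]
        by (simp add: Cl_class_mult single_carrier Cl_gen_class)
    qed
    have w: "Poly_Mapping.single w b \<in> tensor_carrier (r + s)" for b
      using single_add by (simp add: single_carrier)
    have "Cl_class r s (Poly_Mapping.single w a) =
        Cl_scale r s a (Cl_class r s (Poly_Mapping.single w 1))"
      using Cl_class_scale[OF w[of 1], of a] by (simp add: tensor_scalar_def mult_single plus_word_def)
    then have "f (Cl_class r s (Poly_Mapping.single w a)) =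
        eval (\<lambda>i. f (Cl_gen r s i)) (Poly_Mapping.single w a)"
      using scale word[of "letters w"] single_add w gen by (simp add: eval_single)
    then show ?case using single_add w gen ring_hom_add[OF f]
      by (simp add: Cl_class_add eval_add)
  qed
qed

lemma Cl_eval:
  assumes "p \<in> tensor_carrier (r + s)"
  shows "Cl.eval r s (Cl_gen r s) p = Cl_class r s p"
proof -
  have "(\<lambda>x. x) \<in> Ring.ring_hom (Cl r s) (Cl r s)" by (rule ring_hom_memI) auto
  from Cl.Cl_hom_eval[OF this _ assms] show ?thesis by simp
qed

lemma Cl_vec_sum: "Cl_vec r s v = (\<Oplus>\<^bsub>Cl r s\<^esub>i\<in>{1..r + s}. Cl_scale r s (v i) (Cl_gen r s i))"
  unfolding Cl_vec_def by (subst Cl_eval[symmetric]) (auto simp: Cl.eval_tensor_vec)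

lemma Cl_vec_square:
  "Cl_vec r s v \<otimes>\<^bsub>Cl r s\<^esub> Cl_vec r s v \<oplus>\<^bsub>Cl r s\<^esub> Cl_scale r s (Q_form r s v v) \<one>\<^bsub>Cl r s\<^esub> = \<zero>\<^bsub>Cl r s\<^esub>"
proof -
  interpret T: ring "tensor_algebra (r + s)" by (rule tensor_algebra_ring)
  interpret I: ideal "clifford_ideal r s" "tensor_algebra (r + s)" by (rule clifford_ideal_ideal)
  let ?p = "tensor_vec (r + s) v * tensor_vec (r + s) v + tensor_scalar (Q_form r s v v)"
  have car: "tensor_vec (r + s) w * tensor_vec (r + s) w + tensor_scalar a \<in> tensor_carrier (r + s)"
    "tensor_vec (r + s) w * tensor_vec (r + s) w \<in> tensor_carrier (r + s)" for w a
    using T.a_closed[OF T.m_closed[OF tensor_vec_carrier tensor_vec_carrier] tensor_scalar_carrier]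
      T.m_closed[OF tensor_vec_carrier tensor_vec_carrier] by auto
  have "?p \<in> clifford_ideal r s"
    unfolding clifford_ideal_def using car by (intro subsetD[OF T.genideal_self]) auto
  then have "Cl_class r s ?p = \<zero>\<^bsub>Cl r s\<^esub>"
    using T.a_rcos_zero[OF I.is_ideal] by (simp add: Cl_class_def Cl_def FactRing_def)
  moreover have "Cl_class r s ?p = Cl_vec r s v \<otimes>\<^bsub>Cl r s\<^esub> Cl_vec r s v \<oplus>\<^bsub>Cl r s\<^esub> Cl_class r s (tensor_scalar (Q_form r s v v))"
    using car by (simp add: Cl_class_add Cl_class_mult Cl_vec_def)
  ultimately show ?thesis
    by (simp add: Cl_scale_def)
qed

text \<open>Indicator vectors of one or two indices are the test vectors from which the relations
  between the generators are extracted.\<close>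

lemma Q_form_delta:
  assumes "finite A" "A \<subseteq> {1..r + s}"
  shows "Q_form r s (\<lambda>j. if j \<in> A then 1 else 0) (\<lambda>j. if j \<in> A then 1 else 0) =
    (\<Sum>i\<in>A. if i \<le> r then 1 else - 1)"
proof -
  have "(\<Sum>i=1..r. (if i \<in> A then 1 else 0) * (if i \<in> A then 1 else 0 :: real)) = (\<Sum>i\<in>A. if i \<le> r then 1 else 0)"
    using assms by (intro sum.mono_neutral_cong) auto
  moreover have "(\<Sum>i=r+1..r+s. (if i \<in> A then 1 else 0) * (if i \<in> A then 1 else 0 :: real)) = (\<Sum>i\<in>A. if i \<le> r then 0 else 1)"
    using assms by (intro sum.mono_neutral_cong) auto
  moreover have "(\<Sum>i\<in>A. if i \<le> r then 1 else - 1 :: real) = (\<Sum>i\<in>A. (if i \<le> r then 1 else 0) - (if i \<le> r then 0 else 1))"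
    by (intro sum.cong) auto
  ultimately show ?thesis by (simp add: Q_form_def sum_subtractf)
qed

text \<open>Polarization: the defining relations only speak of squares, so the relation for e_i +
  e_j is compared with those for e_i and e_j.\<close>

lemma Cl_gen_anticommute:
  assumes "i \<in> {1..r + s}" "j \<in> {1..r + s}" "i \<noteq> j"
  shows "Cl_gen r s i \<otimes>\<^bsub>Cl r s\<^esub> Cl_gen r s j = \<ominus>\<^bsub>Cl r s\<^esub> (Cl_gen r s j \<otimes>\<^bsub>Cl r s\<^esub> Cl_gen r s i)"
proof -
  let ?q = "\<lambda>i. if i \<le> r then 1 else - 1 :: real"
  let ?x = "Cl_gen r s i" and ?y = "Cl_gen r s j"
  have sum: "Cl_vec r s (\<lambda>k. if k \<in> A then 1 else 0) = (\<Oplus>\<^bsub>Cl r s\<^esub>i\<in>A. Cl_gen r s i)"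
    if "A \<subseteq> {1..r + s}" for A
    unfolding Cl_vec_sum using that
    by (intro Cl.add.finprod_mono_neutral_cong_right) auto
  have sq: "Cl_gen r s k \<otimes>\<^bsub>Cl r s\<^esub> Cl_gen r s k \<oplus>\<^bsub>Cl r s\<^esub> Cl_scale r s (?q k) \<one>\<^bsub>Cl r s\<^esub> = \<zero>\<^bsub>Cl r s\<^esub>"
    if "k \<in> {1..r + s}" for k
    using Cl_vec_square[of r s "\<lambda>j. if j \<in> {k} then 1 else 0"] sum[of "{k}"] Q_form_delta[of "{k}" r s] that by simp
  have vij: "Cl_vec r s (\<lambda>k. if k \<in> {i, j} then 1 else 0) = ?x \<oplus>\<^bsub>Cl r s\<^esub> ?y"
    using sum[of "{i, j}"] assms by (simp add: Pi_def)
  have "(?x \<oplus>\<^bsub>Cl r s\<^esub> ?y) \<otimes>\<^bsub>Cl r s\<^esub> (?x \<oplus>\<^bsub>Cl r s\<^esub> ?y) \<oplus>\<^bsub>Cl r s\<^esub> Cl_scale r s (?q i + ?q j) \<one>\<^bsub>Cl r s\<^esub> = \<zero>\<^bsub>Cl r s\<^esub>"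
    using Cl_vec_square[of r s "\<lambda>k. if k \<in> {i, j} then 1 else 0"] Q_form_delta[of "{i, j}" r s] assms
    unfolding vij by simp
  also have "(?x \<oplus>\<^bsub>Cl r s\<^esub> ?y) \<otimes>\<^bsub>Cl r s\<^esub> (?x \<oplus>\<^bsub>Cl r s\<^esub> ?y) \<oplus>\<^bsub>Cl r s\<^esub> Cl_scale r s (?q i + ?q j) \<one>\<^bsub>Cl r s\<^esub> =
      (?x \<otimes>\<^bsub>Cl r s\<^esub> ?x \<oplus>\<^bsub>Cl r s\<^esub> Cl_scale r s (?q i) \<one>\<^bsub>Cl r s\<^esub>) \<oplus>\<^bsub>Cl r s\<^esub>
      (?y \<otimes>\<^bsub>Cl r s\<^esub> ?y \<oplus>\<^bsub>Cl r s\<^esub> Cl_scale r s (?q j) \<one>\<^bsub>Cl r s\<^esub>) \<oplus>\<^bsub>Cl r s\<^esub>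
      (?x \<otimes>\<^bsub>Cl r s\<^esub> ?y \<oplus>\<^bsub>Cl r s\<^esub> ?y \<otimes>\<^bsub>Cl r s\<^esub> ?x)"
    by (simp add: Cl.l_distr Cl.r_distr Cl.sc_add_left Cl.a_ac)
  finally show ?thesis
    using sq[of i] sq[of j] assms by (simp add: Cl.minus_equality)
qed

lemma Cl_basis_lprod: "Cl_basis r s I = Cl.lprod r s (Cl_gen r s) (sorted_list_of_set I)"
  by (simp add: Cl_basis_def Cl.lprod_def)

lemma Cl_basis_closed [simp, intro]: "Cl_basis r s I \<in> carrier (Cl r s)"
  by (simp add: Cl_basis_lprod)

text \<open>The restriction makes the map extensional, as the description that defines
  \<open>Cl_c\<close> demands.\<close>

definition Cl_conj :: "nat \<Rightarrow> nat \<Rightarrow> (nat word \<Rightarrow>\<^sub>0 real) set \<Rightarrow> (nat word \<Rightarrow>\<^sub>0 real) set" where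
  "Cl_conj r s = restrict
    (Cl_lift r s (op_ring (Cl r s)) (Cl_scale r s) (\<lambda>i. \<ominus>\<^bsub>Cl r s\<^esub> Cl_gen r s i)) (carrier (Cl r s))"

lemma Cl_anti_automorphism_hom:
  "Cl_anti_automorphism r s f \<Longrightarrow> f \<in> Ring.ring_hom (Cl r s) (op_ring (Cl r s))"
  by (auto simp: Cl_anti_automorphism_def bij_betw_def intro!: ring_hom_memI)

lemma Cl_conj_props:
  shows "Cl_conj r s \<in> extensional (carrier (Cl r s))"
    and "Cl_anti_automorphism r s (Cl_conj r s)"
    and "Cl_conj r s (Cl_vec r s v) = \<ominus>\<^bsub>Cl r s\<^esub> Cl_vec r s v"
proof -
  interpret op: real_alg "op_ring (Cl r s)" "Cl_scale r s"
    by (rule op_ring_real_alg) (rule Cl.real_alg_axioms)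
  let ?E = "\<lambda>i. \<ominus>\<^bsub>Cl r s\<^esub> Cl_gen r s i"
  let ?f = "Cl_lift r s (op_ring (Cl r s)) (Cl_scale r s) ?E"
  have E: "?E i \<in> carrier (op_ring (Cl r s))" for i by simp
  have vec: "(\<Oplus>\<^bsub>Cl r s\<^esub>i\<in>{1..r + s}. Cl_scale r s (v i) (?E i)) = \<ominus>\<^bsub>Cl r s\<^esub> Cl_vec r s v" for v
  proof -
    have "(\<Oplus>\<^bsub>Cl r s\<^esub>i\<in>{1..r + s}. Cl_scale r s (v i) (?E i)) =
        (\<Oplus>\<^bsub>Cl r s\<^esub>i\<in>{1..r + s}. Cl_scale r s (- 1) (Cl_scale r s (v i) (Cl_gen r s i)))"
      by (intro Cl.finsum_cong') (auto simp: Cl.sc_minus_right Cl.sc_m1)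
    also have "\<dots> = Cl_scale r s (- 1) (Cl_vec r s v)"
      unfolding Cl_vec_sum by (intro Cl.sc_finsum[symmetric]) auto
    finally show ?thesis by (simp add: Cl.sc_m1)
  qed
  \<comment> \<open>The elements -e_i satisfy the same relations as the e_i, since the two signs in
    a square cancel.\<close>
  have sq: "(\<Oplus>\<^bsub>op_ring (Cl r s)\<^esub>i\<in>{1..r + s}. Cl_scale r s (v i) (?E i)) \<otimes>\<^bsub>op_ring (Cl r s)\<^esub>
      (\<Oplus>\<^bsub>op_ring (Cl r s)\<^esub>i\<in>{1..r + s}. Cl_scale r s (v i) (?E i)) \<oplus>\<^bsub>op_ring (Cl r s)\<^esub>
      Cl_scale r s (Q_form r s v v) \<one>\<^bsub>op_ring (Cl r s)\<^esub> = \<zero>\<^bsub>op_ring (Cl r s)\<^esub>" for v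
    using Cl_vec_square[of r s v] unfolding op_ring_finsum vec op_ring_simps
    by (simp add: Cl.l_minus Cl.r_minus)
  note lift = op.Cl_lift_ring_hom[OF E sq] and scale = op.Cl_lift_scale[OF E sq]
    and lift_vec = op.Cl_lift_vec[OF E sq, unfolded op_ring_finsum vec]
  have closed: "?f x \<in> carrier (Cl r s)" if "x \<in> carrier (Cl r s)" for x
    using ring_hom_closed[OF lift that] by simp
  have minus: "?f (\<ominus>\<^bsub>Cl r s\<^esub> x) = \<ominus>\<^bsub>Cl r s\<^esub> ?f x" if "x \<in> carrier (Cl r s)" for x
    using scale[OF that, of "- 1"] closed[OF that] that by (simp add: Cl.sc_m1)
  \<comment> \<open>Applied twice, the map is a homomorphism into \<open>Cl r s\<close> itself and
    fixes the generators; it is therefore the identity, and bijectivity follows.\<close>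
  have invol: "?f (?f x) = x" if x: "x \<in> carrier (Cl r s)" for x
  proof -
    obtain p where p: "p \<in> tensor_carrier (r + s)" "x = Cl_class r s p" using x by (auto simp: carrier_Cl)
    have hom: "(\<lambda>x. ?f (?f x)) \<in> Ring.ring_hom (Cl r s) (Cl r s)"
      using ring_hom_mult[OF lift] ring_hom_add[OF lift] ring_hom_one[OF lift] closed
      by (auto intro!: ring_hom_memI)
    have "?f (?f (Cl_class r s p)) = Cl.eval r s (\<lambda>i. ?f (?f (Cl_gen r s i))) p"
      using Cl.Cl_hom_eval[OF hom _ p(1)] scale closed by simp
    also have "(\<lambda>i. ?f (?f (Cl_gen r s i))) = Cl_gen r s"
      using lift_vec minus by (auto simp: Cl_gen_def fun_eq_iff)
    finally show ?thesis using p by (simp add: Cl_eval)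
  qed
  show "Cl_conj r s \<in> extensional (carrier (Cl r s))" by (simp add: Cl_conj_def)
  show "Cl_conj r s (Cl_vec r s v) = \<ominus>\<^bsub>Cl r s\<^esub> Cl_vec r s v"
    using lift_vec by (simp add: Cl_conj_def)
  have "bij_betw ?f (carrier (Cl r s)) (carrier (Cl r s))"
    by (rule bij_betwI[where g = ?f]) (auto simp: closed invol)
  then have "bij_betw (Cl_conj r s) (carrier (Cl r s)) (carrier (Cl r s))"
    unfolding Cl_conj_def by (simp cong: bij_betw_cong)
  then show "Cl_anti_automorphism r s (Cl_conj r s)"
    using ring_hom_mult[OF lift] ring_hom_add[OF lift] ring_hom_one[OF lift] scale
    by (simp add: Cl_anti_automorphism_def Cl_conj_def)
qed

text \<open>Evaluates the definite description: any competitor is a homomorphism into the opposite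
  ring with value -e_i at e_i, hence agrees with \<open>Cl_conj\<close> on the carrier, and
  extensionality settles the rest.\<close>

lemma Cl_c_eq: "Cl_c r s = Cl_conj r s"
  unfolding Cl_c_def
proof (rule the_equality, intro conjI allI)
  fix f
  assume f: "f \<in> extensional (carrier (Cl r s)) \<and> Cl_anti_automorphism r s f \<and>
     (\<forall>v. f (Cl_vec r s v) = \<ominus>\<^bsub>Cl r s\<^esub> Cl_vec r s v)"
  interpret op: real_alg "op_ring (Cl r s)" "Cl_scale r s"
    by (rule op_ring_real_alg) (rule Cl.real_alg_axioms)
  show "f = Cl_conj r s"
  proof (rule extensionalityI)
    fix x assume "x \<in> carrier (Cl r s)"
    then obtain p where p: "p \<in> tensor_carrier (r + s)" "x = Cl_class r s p" by (auto simp: carrier_Cl)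
    have eval: "g x = op.eval (\<lambda>i. \<ominus>\<^bsub>Cl r s\<^esub> Cl_gen r s i) p"
      if "Cl_anti_automorphism r s g" "\<And>v. g (Cl_vec r s v) = \<ominus>\<^bsub>Cl r s\<^esub> Cl_vec r s v" for g
      using op.Cl_hom_eval[OF Cl_anti_automorphism_hom[OF that(1)] _ p(1)] that p(2)
      by (simp add: Cl_gen_def Cl_anti_automorphism_def)
    show "f x = Cl_conj r s x"
      using f eval[of f] eval[of "Cl_conj r s"] Cl_conj_props by simp
  qed (use f Cl_conj_props in auto)
qed (auto simp: Cl_conj_props)

lemma Cl_c_lprod:
  "Cl_c r s (Cl.lprod r s (Cl_gen r s) is) =
    Cl_scale r s ((- 1) ^ length is) (Cl.lprod r s (Cl_gen r s) (rev is))"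
proof (induction "is")
  case Nil
  show ?case using Cl_conj_props(2)[of r s] by (simp add: Cl_c_eq Cl_anti_automorphism_def)
next
  case (Cons i js)
  have "Cl_c r s (Cl_gen r s i) = \<ominus>\<^bsub>Cl r s\<^esub> Cl_gen r s i"
    by (simp add: Cl_c_eq Cl_gen_def Cl_conj_props)
  moreover have "Cl_c r s (Cl_gen r s i \<otimes>\<^bsub>Cl r s\<^esub> Cl.lprod r s (Cl_gen r s) js) =
      Cl_c r s (Cl.lprod r s (Cl_gen r s) js) \<otimes>\<^bsub>Cl r s\<^esub> Cl_c r s (Cl_gen r s i)"
    using Cl_conj_props(2)[of r s] by (simp add: Cl_c_eq Cl_anti_automorphism_def)
  ultimately show ?case using Cons
    by (simp add: Cl.lprod_append Cl.sc_left Cl.sc_right Cl.r_minus Cl.sc_minus_left Cl.sc_minus_right)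
qed

text \<open>The sign by which an involution acts on a product of \<open>m\<close> anticommuting skew elements:
  \<open>(-1)\<^sup>m\<close> from the factors and \<open>(-1)\<^bsup>m(m-1)/2\<^esup>\<close> from reversing their order.\<close>

definition clifford_sign :: "nat \<Rightarrow> real" where
  "clifford_sign m = (- 1) ^ m * (- 1) ^ (m * (m - 1) div 2)"

lemma clifford_sign_eq: "clifford_sign m = (if m mod 4 \<in> {1, 2} then - 1 else 1)"
proof -
  obtain q where q: "m = 4 * q + m mod 4" by (metis mult_div_mod_eq)
  have "m mod 4 < 4" by simp
  then consider "m = 4 * q" | "m = 4 * q + 1" | "m = 4 * q + 2" | "m = 4 * q + 3"
    using q by linarith
  then show ?thesis
  proof cases
    case 1
    have "m * (m - 1) div 2 = 2 * (q * (4 * q - 1))" using 1 by simp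
    with 1 show ?thesis by (simp add: clifford_sign_def)
  next
    case 2
    have "m * (m - 1) div 2 = 2 * (q * (4 * q + 1))" using 2 by simp
    with 2 show ?thesis by (simp add: clifford_sign_def)
  next
    case 3
    have "m * (m - 1) div 2 = (2 * q + 1) * (4 * q + 1)" using 3 by simp
    moreover have "odd ((2 * q + 1) * (4 * q + 1))" by simp
    moreover have "m mod 4 = 2" using 3 by presburger
    ultimately show ?thesis using 3 by (simp add: clifford_sign_def)
  next
    case 4
    have "m * (m - 1) div 2 = (4 * q + 3) * (2 * q + 1)" using 4 by simp
    moreover have "odd ((4 * q + 3) * (2 * q + 1))" by simp
    moreover have "m mod 4 = 3" using 4 by presburger
    ultimately show ?thesis using 4 by (simp add: clifford_sign_def)
  qed
qed

lemma Cl_c_basis: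
  assumes "I \<subseteq> {1..r + s}"
  shows "Cl_c r s (Cl_basis r s I) = Cl_scale r s (clifford_sign (card I)) (Cl_basis r s I)"
proof -
  have fin: "finite I" using assms finite_subset by blast
  let ?L = "sorted_list_of_set I"
  have "Cl.lprod r s (Cl_gen r s) (rev ?L) =
      Cl_scale r s ((- 1) ^ (length ?L * (length ?L - 1) div 2)) (Cl.lprod r s (Cl_gen r s) ?L)"
    using fin assms by (intro Cl.lprod_rev[where A = "{1..r + s}"] Cl_gen_anticommute) auto
  then show ?thesis
    by (simp add: Cl_basis_lprod Cl_c_lprod Cl.sc_mult clifford_sign_def)
qed

text \<open>The sign in \<open>Cl_c_basis\<close> decides membership only if e_I differs from its
  negative; this is where e_I \<noteq> 0 and division by 2 enter.\<close>

lemma Cl_basis_in_G_iff: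
  assumes "I \<subseteq> {1..r + s}" "Cl_basis r s I \<noteq> \<zero>\<^bsub>Cl r s\<^esub>"
  shows "Cl_basis r s I \<in> carrier (G_lie r s) \<longleftrightarrow> card I mod 4 \<in> {1, 2}"
proof -
  let ?e = "Cl_basis r s I"
  have "?e \<noteq> \<ominus>\<^bsub>Cl r s\<^esub> ?e"
  proof
    assume "?e = \<ominus>\<^bsub>Cl r s\<^esub> ?e"
    then have "Cl_scale r s (1 + 1) ?e = \<zero>\<^bsub>Cl r s\<^esub>"
      by (subst Cl.sc_add_left) (simp_all, metis Cl.r_neg Cl_basis_closed)
    then have "Cl_scale r s (1 / 2) (Cl_scale r s (1 + 1) ?e) = \<zero>\<^bsub>Cl r s\<^esub>" by simp
    then show False using assms(2) by (simp add: Cl.sc_mult)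
  qed
  then show ?thesis
    using Cl_c_basis[OF assms(1)]
    by (simp add: G_lie_def Cl_lie_subalgebra_def clifford_sign_eq Cl.sc_m1)
qed

section \<open>Star algebras with skew Clifford generators\<close>

text \<open>For a square matrix A, A A^T = \<kappa> 1 implies A^T A = \<kappa> 1, since a one-sided
  inverse is two-sided. The index sets are abstract because rows are sets of generators and columns
  are matrix coordinates.\<close>

lemma orthogonal_rows_columns:
  fixes a :: "'i \<Rightarrow> 's \<Rightarrow> real"
  assumes "finite T" "finite S" "card S = card T" "\<kappa> \<noteq> 0"
    and rows: "\<And>i j. i \<in> T \<Longrightarrow> j \<in> T \<Longrightarrow> (\<Sum>s\<in>S. a i s * a j s) = (if i = j then \<kappa> else 0)"
    and st: "s \<in> S" "t \<in> S"
  shows "(\<Sum>i\<in>T. a i s * a i t) = (if s = t then \<kappa> else 0)"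
proof -
  let ?d = "card T"
  obtain f where f: "bij_betw f {0..<?d} T"
    using ex_bij_betw_nat_finite[OF \<open>finite T\<close>] by blast
  obtain g where g: "bij_betw g {0..<?d} S"
    using ex_bij_betw_nat_finite[OF \<open>finite S\<close>] \<open>card S = card T\<close> by auto
  define A where "A = mat ?d ?d (\<lambda>(i, j). a (f i) (g j))"
  \<comment> \<open>The transpose of A divided by \<kappa>, a right inverse by the hypothesis on
    rows.\<close>
  define B where "B = mat ?d ?d (\<lambda>(i, j). a (f j) (g i) / \<kappa>)"
  have fT: "f i \<in> T" if "i < ?d" for i using f that by (auto simp: bij_betw_def)
  have finj: "f i = f j \<longleftrightarrow> i = j" if "i < ?d" "j < ?d" for i j
    using f that by (auto simp: bij_betw_def inj_on_def)
  have ginj: "g i = g j \<longleftrightarrow> i = j" if "i < ?d" "j < ?d" for i j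
    using g that by (auto simp: bij_betw_def inj_on_def)
  have "A * B = 1\<^sub>m ?d"
  proof (rule eq_matI)
    fix i j assume ij: "i < dim_row (1\<^sub>m ?d)" "j < dim_col (1\<^sub>m ?d)"
    then have "(A * B) $$ (i, j) = (\<Sum>k\<in>{0..<?d}. a (f i) (g k) * a (f j) (g k)) / \<kappa>"
      by (simp add: A_def B_def scalar_prod_def sum_divide_distrib)
    also have "(\<Sum>k\<in>{0..<?d}. a (f i) (g k) * a (f j) (g k)) = (\<Sum>s\<in>S. a (f i) s * a (f j) s)"
      by (rule sum.reindex_bij_betw[OF g])
    finally show "(A * B) $$ (i, j) = 1\<^sub>m ?d $$ (i, j)"
      using ij rows[of "f i" "f j"] fT finj \<open>\<kappa> \<noteq> 0\<close> by auto
  qed (auto simp: A_def B_def)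
  then have BA: "B * A = 1\<^sub>m ?d"
    by (rule mat_mult_left_right_inverse[rotated 2]) (auto simp: A_def B_def)
  obtain i j where ij: "i < ?d" "j < ?d" "s = g i" "t = g j"
    using g st by (auto simp: bij_betw_def)
  have "(B * A) $$ (i, j) = (\<Sum>k\<in>{0..<?d}. a (f k) s * a (f k) t) / \<kappa>"
    using ij by (simp add: A_def B_def scalar_prod_def sum_divide_distrib)
  also have "(\<Sum>k\<in>{0..<?d}. a (f k) s * a (f k) t) = (\<Sum>i\<in>T. a i s * a i t)"
    by (rule sum.reindex_bij_betw[OF f])
  finally show ?thesis
    using BA ij ginj \<open>\<kappa> \<noteq> 0\<close> by (auto simp: field_simps split: if_splits)
qed

text \<open>Common frame for matrices over R, C, H and for pairs of such matrices. In the real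
  coordinates \<open>co\<close> the trace form is the standard inner product, so orthogonality
  becomes a statement about real vectors.\<close>

locale star_alg = real_alg M sc for M (structure) and sc +
  fixes star :: "'a \<Rightarrow> 'a" and tr :: "'a \<Rightarrow> real" and co :: "'s \<Rightarrow> 'a \<Rightarrow> real" and S :: "'s set"
  assumes star_closed [simp, intro]: "x \<in> carrier M \<Longrightarrow> star x \<in> carrier M"
    and star_add: "x \<in> carrier M \<Longrightarrow> y \<in> carrier M \<Longrightarrow> star (x \<oplus> y) = star x \<oplus> star y"
    and star_mult: "x \<in> carrier M \<Longrightarrow> y \<in> carrier M \<Longrightarrow> star (x \<otimes> y) = star y \<otimes> star x"
    and star_sc: "x \<in> carrier M \<Longrightarrow> star (sc a x) = sc a (star x)"
    and star_star [simp]: "x \<in> carrier M \<Longrightarrow> star (star x) = x"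
    and tr_add: "x \<in> carrier M \<Longrightarrow> y \<in> carrier M \<Longrightarrow> tr (x \<oplus> y) = tr x + tr y"
    and tr_sc: "x \<in> carrier M \<Longrightarrow> tr (sc a x) = a * tr x"
    and tr_comm: "x \<in> carrier M \<Longrightarrow> y \<in> carrier M \<Longrightarrow> tr (x \<otimes> y) = tr (y \<otimes> x)"
    and tr_star: "x \<in> carrier M \<Longrightarrow> tr (star x) = tr x"
    and tr_one: "tr \<one> > 0"
    and finite_S: "finite S"
    and co_add: "s \<in> S \<Longrightarrow> x \<in> carrier M \<Longrightarrow> y \<in> carrier M \<Longrightarrow> co s (x \<oplus> y) = co s x + co s y"
    and co_sc: "s \<in> S \<Longrightarrow> x \<in> carrier M \<Longrightarrow> co s (sc a x) = a * co s x"
    and co_eqI: "x \<in> carrier M \<Longrightarrow> y \<in> carrier M \<Longrightarrow> (\<And>s. s \<in> S \<Longrightarrow> co s x = co s y) \<Longrightarrow> x = y"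
    and tr_co: "x \<in> carrier M \<Longrightarrow> y \<in> carrier M \<Longrightarrow>
      tr (star x \<otimes> y) = (\<Sum>s\<in>S. co s x * co s y)"
begin

lemma star_one [simp]: "star \<one> = \<one>"
  using star_mult[of "star \<one>" \<one>] by simp

lemma star_minus: "x \<in> carrier M \<Longrightarrow> star (\<ominus> x) = \<ominus> star x"
  using star_sc[of x "- 1"] by (simp add: sc_m1)

lemma tr_minus: "x \<in> carrier M \<Longrightarrow> tr (\<ominus> x) = - tr x"
  using tr_sc[of x "- 1"] by (simp add: sc_m1)

lemma star_zero [simp]: "star \<zero> = \<zero>"
  using star_sc[of \<zero> 0] by simp

lemma tr_zero [simp]: "tr \<zero> = 0"
  using tr_sc[of \<zero> 0] by simp

lemma co_zero [simp]: "s \<in> S \<Longrightarrow> co s \<zero> = 0"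
  using co_sc[of s \<zero> 0] by simp

lemma tr_finsum:
  "finite A \<Longrightarrow> f \<in> A \<rightarrow> carrier M \<Longrightarrow> tr (\<Oplus>i\<in>A. f i) = (\<Sum>i\<in>A. tr (f i))"
  by (induction A rule: finite_induct) (auto simp: tr_add Pi_iff)

lemma co_finsum:
  "finite A \<Longrightarrow> s \<in> S \<Longrightarrow> f \<in> A \<rightarrow> carrier M \<Longrightarrow> co s (\<Oplus>i\<in>A. f i) = (\<Sum>i\<in>A. co s (f i))"
  by (induction A rule: finite_induct) (auto simp: co_add Pi_iff)

lemma star_finsum:
  "finite A \<Longrightarrow> f \<in> A \<rightarrow> carrier M \<Longrightarrow> star (\<Oplus>i\<in>A. f i) = (\<Oplus>i\<in>A. star (f i))"
  by (induction A rule: finite_induct) (auto simp: star_add Pi_iff)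

lemma tr_orthogonal_star:
  assumes x: "x \<in> carrier M" "star x = \<ominus> x" and y: "y \<in> carrier M" "star y = y"
  shows "tr (star y \<otimes> x) = 0"
proof -
  have "tr (star y \<otimes> x) = tr (star x \<otimes> y)"
    using tr_star[of "star y \<otimes> x"] x(1) y(1) by (simp add: star_mult)
  also have "\<dots> = - tr (y \<otimes> x)"
    using x y tr_comm[of x y] by (simp add: l_minus tr_minus)
  finally show ?thesis using y by simp
qed

end

text \<open>The assumption on the trace of the top monomial is vacuous unless \<open>n \<equiv> 3\<close> modulo 4:
  for even \<open>n\<close> it is not needed, and for \<open>n \<equiv> 1\<close> the top monomial is skew, hence traceless.\<close>

locale skew_clifford = star_alg M sc star tr co S for M (structure) and sc star tr co S +
  fixes F :: "nat \<Rightarrow> 'a" and n :: nat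
  assumes F_closed [simp, intro]: "F i \<in> carrier M"
    and F_star: "i \<in> {1..n} \<Longrightarrow> star (F i) = \<ominus> F i"
    and F_square: "i \<in> {1..n} \<Longrightarrow> F i \<otimes> F i = \<ominus> \<one>"
    and F_anticommute: "i \<in> {1..n} \<Longrightarrow> j \<in> {1..n} \<Longrightarrow> i \<noteq> j \<Longrightarrow> F i \<otimes> F j = \<ominus> (F j \<otimes> F i)"
    and card_S: "card S = 2 ^ n"
    and tr_top: "n mod 4 = 3 \<Longrightarrow> tr (lprod F [1..<Suc n]) = 0"
begin

definition monomial :: "nat set \<Rightarrow> 'a" where
  "monomial I = lprod F (sorted_list_of_set I)"

text \<open>The Fourier coefficient of x at F_I for the trace form; the monomials are unitary, so
  all have the same norm.\<close>

definition coeff :: "nat set \<Rightarrow> 'a \<Rightarrow> real" where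
  "coeff I x = tr (star (monomial I) \<otimes> x) / tr \<one>"

lemma monomial_closed [simp, intro]: "monomial I \<in> carrier M"
  by (auto simp: monomial_def)

text \<open>On the F_i the involution \<open>star\<close> behaves as c does on the e_i, and so the
  same sign appears.\<close>

lemma star_lprod_F:
  assumes "distinct is" "set is \<subseteq> {1..n}"
  shows "star (lprod F is) = sc (clifford_sign (length is)) (lprod F is)"
proof -
  have "star (lprod F js) = sc ((- 1) ^ length js) (lprod F (rev js))" if "set js \<subseteq> {1..n}" for js
    using that
  proof (induction js)
    case (Cons j js)
    then show ?case using F_star[of j]
      by (simp add: star_mult lprod_append sc_left r_minus sc_minus_left sc_minus_right)
  qed simp
  moreover have "lprod F (rev is) = sc ((- 1) ^ (length is * (length is - 1) div 2)) (lprod F is)"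
    using assms by (intro lprod_rev[where A = "{1..n}"] F_anticommute) auto
  ultimately show ?thesis using assms by (simp add: clifford_sign_def sc_mult)
qed

lemma star_monomial: "I \<subseteq> {1..n} \<Longrightarrow> star (monomial I) = sc (clifford_sign (card I)) (monomial I)"
  using star_lprod_F[of "sorted_list_of_set I"] finite_subset[of I "{1..n}"]
  by (simp add: monomial_def)

lemma lprod_F_unitary: "set is \<subseteq> {1..n} \<Longrightarrow> star (lprod F is) \<otimes> lprod F is = \<one>"
proof (induction "is")
  case (Cons j js)
  have "star (lprod F (j # js)) \<otimes> lprod F (j # js) =
      star (lprod F js) \<otimes> ((star (F j) \<otimes> F j) \<otimes> lprod F js)"
    by (simp add: star_mult m_assoc)
  also have "star (F j) \<otimes> F j = \<one>"
    using Cons.prems F_star[of j] F_square[of j] by (simp add: l_minus)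
  finally show ?case using Cons by simp
qed simp

lemma monomial_unitary: "I \<subseteq> {1..n} \<Longrightarrow> star (monomial I) \<otimes> monomial I = \<one>"
  using lprod_F_unitary[of "sorted_list_of_set I"] finite_subset[of I "{1..n}"]
  by (simp add: monomial_def)

lemma monomial_commute:
  assumes "i \<in> {1..n}" "I \<subseteq> {1..n}"
  shows "F i \<otimes> monomial I = sc ((- 1) ^ card (I - {i})) (monomial I \<otimes> F i)"
proof -
  have fin: "finite I" using assms finite_subset by blast
  let ?L = "sorted_list_of_set I"
  have "length (filter (\<lambda>j. j \<noteq> i) ?L) = card (set (filter (\<lambda>j. j \<noteq> i) ?L))"
    using fin by (intro distinct_card[symmetric]) simp
  also have "set (filter (\<lambda>j. j \<noteq> i) ?L) = I - {i}" using fin by auto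
  finally have "length (filter (\<lambda>j. j \<noteq> i) ?L) = card (I - {i})" .
  moreover have "F i \<otimes> lprod F ?L = sc ((- 1) ^ length (filter (\<lambda>j. j \<noteq> i) ?L)) (lprod F ?L \<otimes> F i)"
    using assms fin by (intro lprod_commute[where A = "{1..n}"] F_anticommute) auto
  ultimately show ?thesis by (simp add: monomial_def)
qed

text \<open>The trace of F_i x F_i is computed in two ways: cyclicity and F_i F_i = -1 give -tr x,
  anticommutation gives tr x.\<close>

lemma tr_zero_if_anticommute:
  assumes i: "i \<in> {1..n}" and x: "x \<in> carrier M" and anti: "F i \<otimes> x = \<ominus> (x \<otimes> F i)"
  shows "tr x = 0"
proof -
  have "tr (F i \<otimes> (x \<otimes> F i)) = tr ((x \<otimes> F i) \<otimes> F i)"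
    using x by (intro tr_comm) auto
  also have "\<dots> = - tr x"
    using x i F_square[of i] by (simp add: m_assoc r_minus tr_minus)
  finally have "tr (F i \<otimes> (x \<otimes> F i)) = - tr x" .
  moreover have "F i \<otimes> (x \<otimes> F i) = \<ominus> (x \<otimes> (F i \<otimes> F i))"
    using x by (simp add: m_assoc[symmetric] anti l_minus)
  then have "F i \<otimes> (x \<otimes> F i) = x"
    using x i F_square[of i] by (simp add: r_minus)
  ultimately show ?thesis by simp
qed

lemma tr_odd_top:
  assumes "odd n"
  shows "tr (monomial {1..n}) = 0"
proof -
  have L: "sorted_list_of_set {1..n} = [1..<Suc n]"
    by (metis atLeastLessThanSuc_atLeastAtMost sorted_list_of_set_range)
  have "n mod 4 = 1 \<or> n mod 4 = 3" using assms by presburger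
  then show ?thesis
  proof
    assume "n mod 4 = 1"
    then have "star (monomial {1..n}) = \<ominus> monomial {1..n}"
      using star_monomial[of "{1..n}"] by (simp add: clifford_sign_eq sc_m1)
    then show ?thesis
      using tr_star[of "monomial {1..n}"] by (simp add: tr_minus)
  next
    assume "n mod 4 = 3"
    then show ?thesis using tr_top unfolding monomial_def L by simp
  qed
qed

text \<open>For I \<noteq> J some F_i anticommutes with F_I F_J, unless n is odd and J is the
  complement of I; then F_I F_J is the top monomial up to sign, which is traceless.\<close>

lemma tr_star_monomial:
  assumes I: "I \<subseteq> {1..n}" and J: "J \<subseteq> {1..n}"
  shows "tr (star (monomial I) \<otimes> monomial J) = (if I = J then tr \<one> else 0)"
proof (cases "I = J")
  case True
  then show ?thesis using I monomial_unitary by simp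
next
  case False
  have fin: "finite I" "finite J" using I J finite_subset by auto
  have prod: "tr (monomial I \<otimes> monomial J) = 0"
  proof (cases "\<exists>i\<in>{1..n}. odd (card (I - {i}) + card (J - {i}))")
    case True
    then obtain i where i: "i \<in> {1..n}" "odd (card (I - {i}) + card (J - {i}))" by blast
    have "F i \<otimes> (monomial I \<otimes> monomial J) =
        sc ((- 1) ^ card (I - {i}) * (- 1) ^ card (J - {i})) ((monomial I \<otimes> monomial J) \<otimes> F i)"
      using monomial_commute[OF i(1) I] monomial_commute[OF i(1) J]
      by (simp add: m_assoc[symmetric] sc_left) (simp add: m_assoc sc_right sc_mult)
    also have "(- 1 :: real) ^ card (I - {i}) * (- 1) ^ card (J - {i}) = - 1"
      using i(2) by (simp flip: power_add)
    finally show ?thesis using i(1) by (intro tr_zero_if_anticommute) (auto simp: sc_m1)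
  next
    \<comment> \<open>If F_i commutes with F_I F_J for every i, then whether i belongs to exactly
      one of I and J does not depend on i. It holds for one index because I \<noteq> J, hence for
      all, so J is the complement of I.\<close>
    case all: False
    obtain i where i: "i \<in> (I - J) \<union> (J - I)" using False by blast
    have par: "odd (card (A - {j})) \<longleftrightarrow> (odd (card A) \<noteq> (j \<in> A))" if "finite A" for A and j :: nat
      using that card_Suc_Diff1[of A j] by (cases "j \<in> A") (auto simp del: card_Diff_insert simp flip: card_Suc_Diff1)
    have all': "(odd (card I) \<noteq> (j \<in> I)) \<longleftrightarrow> (odd (card J) \<noteq> (j \<in> J))" if "j \<in> {1..n}" for j
      using all that unfolding par[OF fin(1), symmetric] par[OF fin(2), symmetric] by auto
    have "i \<in> {1..n}" using i I J by blast
    then have "odd (card I + card J)" using all'[of i] i by auto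
    moreover from this have "j \<in> I \<longleftrightarrow> j \<notin> J" if "j \<in> {1..n}" for j
      using all'[OF that] by auto
    ultimately have compl: "J = {1..n} - I" using I J by blast
    then have "odd n"
      using \<open>odd (card I + card J)\<close> I fin card_Diff_subset[of I "{1..n}"] card_mono[of "{1..n}" I] by auto
    let ?L = "sorted_list_of_set I @ sorted_list_of_set J"
    have L: "distinct ?L" "set ?L = {1..n}" using compl I fin by auto
    then have "sort ?L = sorted_list_of_set {1..n}"
      using sorted_list_of_set_sort_remdups[of ?L] by (simp add: distinct_remdups_id)
    moreover have "\<exists>k. lprod F (sort ?L) = sc ((- 1) ^ k) (lprod F ?L)"
      using L by (intro lprod_sort[where A = "{1..n}"] F_anticommute) auto
    ultimately obtain k where "monomial {1..n} = sc ((- 1) ^ k) (monomial I \<otimes> monomial J)"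
      by (auto simp: monomial_def lprod_append)
    then show ?thesis using tr_odd_top[OF \<open>odd n\<close>] by (simp add: tr_sc)
  qed
  then show ?thesis using False star_monomial[OF I] by (simp add: sc_left tr_sc)
qed

lemma coeff_finsum:
  assumes "finite A" "A \<subseteq> Pow {1..n}" "J \<subseteq> {1..n}"
  shows "coeff J (\<Oplus>I\<in>A. sc (c I) (monomial I)) = (if J \<in> A then c J else 0)"
proof -
  have sub: "I \<in> A \<Longrightarrow> I \<subseteq> {1..n}" for I using assms by blast
  have "tr (star (monomial J) \<otimes> (\<Oplus>I\<in>A. sc (c I) (monomial I))) =
      tr (\<Oplus>I\<in>A. star (monomial J) \<otimes> sc (c I) (monomial I))"
    using assms by (subst finsum_rdistr) auto
  also have "\<dots> = (\<Sum>I\<in>A. tr (star (monomial J) \<otimes> sc (c I) (monomial I)))"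
    using assms by (intro tr_finsum) auto
  also have "\<dots> = (\<Sum>I\<in>A. if J = I then c J * tr \<one> else 0)"
    using assms by (intro sum.cong) (auto simp: sc_right tr_sc tr_star_monomial[OF assms(3) sub] simp del: One_nat_def)
  finally show ?thesis using assms tr_one by (simp add: coeff_def)
qed

text \<open>The \<open>2\<^sup>n\<close> monomials are orthogonal in a coordinate space of dimension \<open>2\<^sup>n\<close>, so
  their coordinates form a square matrix; orthogonality of its columns is completeness.\<close>

lemma monomial_expansion:
  assumes x: "x \<in> carrier M"
  shows "x = (\<Oplus>I\<in>Pow {1..n}. sc (coeff I x) (monomial I))"
proof (rule co_eqI)
  let ?T = "Pow {1..n}"
  fix t assume t: "t \<in> S"
  have complete: "(\<Sum>I\<in>?T. co s (monomial I) * co t (monomial I)) = (if s = t then tr \<one> else 0)"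
    if "s \<in> S" for s
    using that t tr_one
    by (intro orthogonal_rows_columns[OF _ finite_S])
      (auto simp: card_S card_Pow tr_star_monomial simp flip: tr_co)
  have "co t (\<Oplus>I\<in>?T. sc (coeff I x) (monomial I)) = (\<Sum>I\<in>?T. coeff I x * co t (monomial I))"
    using t by (subst co_finsum) (auto simp: co_sc)
  also have "\<dots> = (\<Sum>I\<in>?T. (\<Sum>s\<in>S. co s x * (co s (monomial I) * co t (monomial I))) / tr \<one>)"
    using x by (intro sum.cong) (auto simp: coeff_def tr_co sum_distrib_right sum_distrib_left ac_simps)
  also have "\<dots> = (\<Sum>s\<in>S. co s x * (\<Sum>I\<in>?T. co s (monomial I) * co t (monomial I))) / tr \<one>"
    unfolding sum_divide_distrib[symmetric] sum_distrib_left by (subst sum.swap) simp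
  also have "\<dots> = (\<Sum>s\<in>S. if s = t then co s x * tr \<one> else 0) / tr \<one>"
    by (intro arg_cong[where f = "\<lambda>z. z / tr \<one>"] sum.cong) (auto simp: complete simp del: One_nat_def)
  also have "\<dots> = co t x" using t finite_S tr_one by simp
  finally show "co t x = co t (\<Oplus>I\<in>?T. sc (coeff I x) (monomial I))" ..
qed (use x in auto)

section \<open>Skew elements as real combinations of monomials\<close>

definition lie_index :: "nat set set" where
  "lie_index = {I. I \<subseteq> {1..n} \<and> card I mod 4 \<in> {1, 2} \<and> \<not> (n mod 4 = 1 \<and> I = {1..n})}"

definition lie_carrier :: "'a set" where
  "lie_carrier = {x \<in> carrier M. star x = \<ominus> x \<and> (n mod 4 = 1 \<longrightarrow> coeff {1..n} x = 0)}"

lemma lie_index_finite [simp]: "finite lie_index"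
  by (rule finite_subset[of _ "Pow {1..n}"]) (auto simp: lie_index_def)

lemma lie_index_subset: "I \<in> lie_index \<Longrightarrow> I \<subseteq> {1..n}"
  by (simp add: lie_index_def)

definition combination :: "(nat set \<Rightarrow> real) \<Rightarrow> 'a" where
  "combination c = (\<Oplus>I\<in>lie_index. sc (c I) (monomial I))"

lemma combination_closed [simp, intro]: "combination c \<in> carrier M"
  by (auto simp: combination_def)

lemma coeff_combination: "I \<in> lie_index \<Longrightarrow> coeff I (combination c) = c I"
  using lie_index_subset unfolding combination_def by (subst coeff_finsum) auto

lemma combination_lie_carrier: "combination c \<in> lie_carrier"
proof -
  have "star (combination c) = (\<Oplus>I\<in>lie_index. star (sc (c I) (monomial I)))"
    unfolding combination_def by (intro star_finsum) auto
  also have "\<dots> = (\<Oplus>I\<in>lie_index. sc (- 1) (sc (c I) (monomial I)))"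
    by (intro finsum_cong')
      (auto simp: star_sc star_monomial clifford_sign_eq sc_mult lie_index_def)
  also have "\<dots> = \<ominus> combination c"
    unfolding combination_def by (subst sc_finsum[symmetric]) (auto simp: sc_m1)
  finally have "star (combination c) = \<ominus> combination c" .
  moreover have "coeff {1..n} (combination c) = 0" if "n mod 4 = 1"
    unfolding combination_def using that by (subst coeff_finsum) (auto simp: lie_index_def)
  ultimately show ?thesis by (simp add: lie_carrier_def)
qed

text \<open>Monomials with |I| congruent to 0 or 3 modulo 4 are symmetric, hence orthogonal to the
  skew element x, so their coefficients vanish.\<close>

lemma lie_carrier_combination:
  assumes "x \<in> lie_carrier"
  shows "x = combination (\<lambda>I. coeff I x)"
proof -
  have x: "x \<in> carrier M" "star x = \<ominus> x" using assms by (auto simp: lie_carrier_def)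
  have "coeff I x = 0" if I: "I \<subseteq> {1..n}" "I \<notin> lie_index" for I
  proof (cases "card I mod 4 \<in> {1, 2}")
    case True
    then show ?thesis using I assms by (auto simp: lie_index_def lie_carrier_def)
  next
    case False
    then have "star (monomial I) = monomial I"
      using star_monomial[OF I(1)] by (simp add: clifford_sign_eq)
    then show ?thesis
      using tr_orthogonal_star[OF x, of "monomial I"] by (simp add: coeff_def)
  qed
  then have "(\<Oplus>I\<in>Pow {1..n}. sc (coeff I x) (monomial I)) = combination (\<lambda>I. coeff I x)"
    unfolding combination_def using lie_index_subset
    by (intro add.finprod_mono_neutral_cong_right) auto
  then show ?thesis using monomial_expansion[OF x(1)] by simp
qed

lemma combination_cong: "(\<And>I. I \<in> lie_index \<Longrightarrow> c I = d I) \<Longrightarrow> combination c = combination d"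
  unfolding combination_def by (intro finsum_cong') auto

lemma combination_add: "combination c \<oplus> combination d = combination (\<lambda>I. c I + d I)"
  unfolding combination_def by (subst finsum_addf[symmetric]) (auto simp: sc_add_left)

lemma combination_minus: "\<ominus> combination c = combination (\<lambda>I. - c I)"
  unfolding combination_def sc_m1[symmetric, OF combination_closed[unfolded combination_def]]
  by (subst sc_finsum) (auto simp: sc_mult)

end

section \<open>The complexified representation\<close>

text \<open>The pair (a, b) stands for a + ib, in accordance with
  \<open>complexification\<close>.\<close>

definition cx_ring :: "('a, 'm) ring_scheme \<Rightarrow> ('a \<times> 'a) ring" where
  "cx_ring R =
    \<lparr> carrier = carrier R \<times> carrier R,
      monoid.mult = (\<lambda>(a, b) (c, d). (a \<otimes>\<^bsub>R\<^esub> c \<ominus>\<^bsub>R\<^esub> b \<otimes>\<^bsub>R\<^esub> d, a \<otimes>\<^bsub>R\<^esub> d \<oplus>\<^bsub>R\<^esub> b \<otimes>\<^bsub>R\<^esub> c)),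
      one = (\<one>\<^bsub>R\<^esub>, \<zero>\<^bsub>R\<^esub>),
      zero = (\<zero>\<^bsub>R\<^esub>, \<zero>\<^bsub>R\<^esub>),
      add = (\<lambda>(a, b) (c, d). (a \<oplus>\<^bsub>R\<^esub> c, b \<oplus>\<^bsub>R\<^esub> d)) \<rparr>"

lemma cx_ring_simps [simp]:
  "carrier (cx_ring R) = carrier R \<times> carrier R"
  "(a, b) \<otimes>\<^bsub>cx_ring R\<^esub> (c, d) = (a \<otimes>\<^bsub>R\<^esub> c \<ominus>\<^bsub>R\<^esub> b \<otimes>\<^bsub>R\<^esub> d, a \<otimes>\<^bsub>R\<^esub> d \<oplus>\<^bsub>R\<^esub> b \<otimes>\<^bsub>R\<^esub> c)"
  "(a, b) \<oplus>\<^bsub>cx_ring R\<^esub> (c, d) = (a \<oplus>\<^bsub>R\<^esub> c, b \<oplus>\<^bsub>R\<^esub> d)"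
  "\<one>\<^bsub>cx_ring R\<^esub> = (\<one>\<^bsub>R\<^esub>, \<zero>\<^bsub>R\<^esub>)"
  "\<zero>\<^bsub>cx_ring R\<^esub> = (\<zero>\<^bsub>R\<^esub>, \<zero>\<^bsub>R\<^esub>)"
  by (simp_all add: cx_ring_def)

lemma cx_ring_fst_snd:
  "fst (x \<oplus>\<^bsub>cx_ring R\<^esub> y) = fst x \<oplus>\<^bsub>R\<^esub> fst y"
  "snd (x \<oplus>\<^bsub>cx_ring R\<^esub> y) = snd x \<oplus>\<^bsub>R\<^esub> snd y"
  "fst (x \<otimes>\<^bsub>cx_ring R\<^esub> y) = fst x \<otimes>\<^bsub>R\<^esub> fst y \<ominus>\<^bsub>R\<^esub> snd x \<otimes>\<^bsub>R\<^esub> snd y"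
  "snd (x \<otimes>\<^bsub>cx_ring R\<^esub> y) = fst x \<otimes>\<^bsub>R\<^esub> snd y \<oplus>\<^bsub>R\<^esub> snd x \<otimes>\<^bsub>R\<^esub> fst y"
  by (cases x; cases y; simp)+

definition cx_scale :: "(real \<Rightarrow> 'a \<Rightarrow> 'a) \<Rightarrow> real \<Rightarrow> 'a \<times> 'a \<Rightarrow> 'a \<times> 'a" where
  "cx_scale sc a = map_prod (sc a) (sc a)"

lemma cx_scale_Pair [simp]: "cx_scale sc a (x, y) = (sc a x, sc a y)"
  by (simp add: cx_scale_def)

context real_alg
begin

lemma cx_ring_ring: "ring (cx_ring R)"
proof (rule ringI)
  show "abelian_group (cx_ring R)"
  proof (rule abelian_groupI)
    fix x assume "x \<in> carrier (cx_ring R)"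
    then show "\<exists>y\<in>carrier (cx_ring R). y \<oplus>\<^bsub>cx_ring R\<^esub> x = \<zero>\<^bsub>cx_ring R\<^esub>"
      by (intro bexI[of _ "(\<ominus> fst x, \<ominus> snd x)"]) (auto simp: l_neg)
  qed (auto simp: a_ac)
  show "Group.monoid (cx_ring R)"
    by (rule monoidI) (auto simp: m_assoc l_distr r_distr minus_eq minus_add l_minus r_minus a_ac)
qed (auto simp: l_distr r_distr minus_eq minus_add a_ac)

lemma cx_real_alg: "real_alg (cx_ring R) (cx_scale sc)"
  by (intro real_alg.intro cx_ring_ring real_alg_axioms.intro)
    (auto simp: sc_add_left sc_add_right sc_mult sc_left sc_right minus_eq sc_minus_right)

lemma cx_ring_finsum:
  assumes "finite A" "f \<in> A \<rightarrow> carrier R" "g \<in> A \<rightarrow> carrier R"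
  shows "(\<Oplus>\<^bsub>cx_ring R\<^esub>i\<in>A. (f i, g i)) = (\<Oplus>i\<in>A. f i, \<Oplus>i\<in>A. g i)"
proof -
  interpret cx: ring "cx_ring R" by (rule cx_ring_ring)
  show ?thesis
    using assms by (induction A rule: finite_induct) (auto simp: Pi_iff)
qed

lemma cx_ring_minus:
  assumes "x \<in> carrier R" "y \<in> carrier R"
  shows "\<ominus>\<^bsub>cx_ring R\<^esub> (x, y) = (\<ominus> x, \<ominus> y)"
proof -
  interpret cx: ring "cx_ring R" by (rule cx_ring_ring)
  show ?thesis using assms by (intro cx.minus_equality) (auto simp: l_neg)
qed

end

context skew_clifford
begin

context
  fixes r s :: nat
  assumes rs: "r + s = n"
begin

interpretation cx: real_alg "cx_ring M" "cx_scale sc"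
  by (rule cx_real_alg)

text \<open>For \<open>i > r\<close> the generator acts as \<open>\<i> F\<^sub>i\<close>, which makes its square positive.\<close>

definition cx_gen :: "nat \<Rightarrow> 'a \<times> 'a" where
  "cx_gen i = (if i \<le> r then (F i, \<zero>) else (\<zero>, F i))"

lemma cx_gen_closed: "cx_gen i \<in> carrier (cx_ring M)"
  by (auto simp: cx_gen_def)

lemma cx_gen_square_sum:
  "(\<Oplus>\<^bsub>cx_ring M\<^esub>i\<in>{1..r + s}. cx_scale sc (v i) (cx_gen i)) \<otimes>\<^bsub>cx_ring M\<^esub>
   (\<Oplus>\<^bsub>cx_ring M\<^esub>i\<in>{1..r + s}. cx_scale sc (v i) (cx_gen i)) \<oplus>\<^bsub>cx_ring M\<^esub>
   cx_scale sc (Q_form r s v v) \<one>\<^bsub>cx_ring M\<^esub> = \<zero>\<^bsub>cx_ring M\<^esub>"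
proof -
  \<comment> \<open>The square of \<open>cx_gen i\<close>. These are the negatives of the values
    Q(e_i,e_i), as the convention v v = -Q(v,v) 1 demands.\<close>
  let ?q = "\<lambda>i. if i \<le> r then - 1 else 1 :: real"
  have anti: "cx_gen i \<otimes>\<^bsub>cx_ring M\<^esub> cx_gen j = \<ominus>\<^bsub>cx_ring M\<^esub> (cx_gen j \<otimes>\<^bsub>cx_ring M\<^esub> cx_gen i)"
    if "i \<in> {1..r + s}" "j \<in> {1..r + s}" "i \<noteq> j" for i j
  proof -
    have "F i \<otimes> F j = \<ominus> (F j \<otimes> F i)" using F_anticommute that rs by blast
    then show ?thesis
      by (simp add: cx_gen_def cx_ring_minus minus_eq)
  qed
  have square: "cx_gen i \<otimes>\<^bsub>cx_ring M\<^esub> cx_gen i = cx_scale sc (?q i) \<one>\<^bsub>cx_ring M\<^esub>"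
    if "i \<in> {1..r + s}" for i
    using F_square[of i] that rs by (simp add: cx_gen_def minus_eq sc_m1)
  have "(\<Oplus>\<^bsub>cx_ring M\<^esub>i\<in>{1..r + s}. cx_scale sc (v i) (cx_gen i)) \<otimes>\<^bsub>cx_ring M\<^esub>
    (\<Oplus>\<^bsub>cx_ring M\<^esub>i\<in>{1..r + s}. cx_scale sc (v i) (cx_gen i)) =
    cx_scale sc (\<Sum>i\<in>{1..r + s}. v i * v i * ?q i) \<one>\<^bsub>cx_ring M\<^esub>"
    by (rule cx.square_sum[where A = "{1..r + s}", OF cx_gen_closed anti _ _ square]) auto
  also have "(\<Sum>i\<in>{1..r + s}. v i * v i * ?q i) = - Q_form r s v v"
  proof -
    have "{1..r + s} = {1..r} \<union> {r + 1..r + s}" by auto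
    then have "(\<Sum>i\<in>{1..r + s}. v i * v i * ?q i) =
        (\<Sum>i\<in>{1..r}. v i * v i * ?q i) + (\<Sum>i\<in>{r + 1..r + s}. v i * v i * ?q i)"
      by (simp only:, subst sum.union_disjoint) auto
    then show ?thesis by (simp add: Q_form_def sum_negf)
  qed
  finally show ?thesis
    by (simp add: sc_minus_left l_neg)
qed

definition rep :: "(nat word \<Rightarrow>\<^sub>0 real) set \<Rightarrow> 'a \<times> 'a" where
  "rep = Cl_lift r s (cx_ring M) (cx_scale sc) cx_gen"

lemma rep_hom: "rep \<in> Ring.ring_hom (Cl r s) (cx_ring M)"
  unfolding rep_def by (rule cx.Cl_lift_ring_hom[OF cx_gen_closed cx_gen_square_sum])

lemma rep_scale:
  "x \<in> carrier (Cl r s) \<Longrightarrow> rep (Cl_scale r s a x) = cx_scale sc a (rep x)"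
  unfolding rep_def by (rule cx.Cl_lift_scale[OF cx_gen_closed cx_gen_square_sum])

lemma rep_gen:
  assumes "i \<in> {1..n}"
  shows "rep (Cl_gen r s i) = cx_gen i"
proof -
  have "rep (Cl_gen r s i) =
      (\<Oplus>\<^bsub>cx_ring M\<^esub>j\<in>{1..r + s}. cx_scale sc (if j = i then 1 else 0) (cx_gen j))"
    unfolding rep_def Cl_gen_def by (rule cx.Cl_lift_vec[OF cx_gen_closed cx_gen_square_sum])
  also have "\<dots> = (\<Oplus>\<^bsub>cx_ring M\<^esub>j\<in>{i}. cx_gen j)"
    using assms rs cx_gen_closed
    by (intro cx.add.finprod_mono_neutral_cong_right) (auto simp: cx_gen_def)
  finally show ?thesis using cx_gen_closed[of i] by (simp add: Pi_def)
qed

lemma rep_closed [simp, intro]: "x \<in> carrier (Cl r s) \<Longrightarrow> rep x \<in> carrier M \<times> carrier M"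
  using ring_hom_closed[OF rep_hom] by simp

lemma rep_components [simp, intro]:
  assumes "x \<in> carrier (Cl r s)"
  shows "fst (rep x) \<in> carrier M" "snd (rep x) \<in> carrier M"
  using rep_closed[OF assms] by auto

text \<open>The number z is a power of i that counts the letters above r; all that matters later is
  that it is nonzero.\<close>

lemma rep_lprod:
  assumes "set is \<subseteq> {1..n}"
  shows "\<exists>z. z \<noteq> 0 \<and> rep (Cl.lprod r s (Cl_gen r s) is) =
    (sc (Re z) (lprod F is), sc (Im z) (lprod F is))"
  using assms
proof (induction "is")
  case Nil
  show ?case using ring_hom_one[OF rep_hom] by (intro exI[of _ 1]) simp
next
  case (Cons j js)
  then obtain z where z: "z \<noteq> 0" "rep (Cl.lprod r s (Cl_gen r s) js) =
      (sc (Re z) (lprod F js), sc (Im z) (lprod F js))" by auto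
  have "rep (Cl.lprod r s (Cl_gen r s) (j # js)) =
      cx_gen j \<otimes>\<^bsub>cx_ring M\<^esub> (sc (Re z) (lprod F js), sc (Im z) (lprod F js))"
    using ring_hom_mult[OF rep_hom] Cons.prems z(2) by (simp add: rep_gen)
  then show ?case using z(1)
    by (intro exI[of _ "(if j \<le> r then 1 else \<i>) * z"])
      (simp add: cx_gen_def sc_right minus_eq sc_minus_left sc_minus_right)
qed

lemma rep_basis:
  obtains \<zeta> where "\<And>I. I \<subseteq> {1..n} \<Longrightarrow> \<zeta> I \<noteq> 0"
    and "\<And>I. I \<subseteq> {1..n} \<Longrightarrow>
      rep (Cl_basis r s I) = (sc (Re (\<zeta> I)) (monomial I), sc (Im (\<zeta> I)) (monomial I))"
proof -
  have "\<exists>z. I \<subseteq> {1..n} \<longrightarrow> z \<noteq> 0 \<and>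
      rep (Cl_basis r s I) = (sc (Re z) (monomial I), sc (Im z) (monomial I))" for I
    using rep_lprod[of "sorted_list_of_set I"] finite_subset[of I "{1..n}"]
    by (auto simp: Cl_basis_lprod monomial_def)
  then show ?thesis using that by metis
qed

text \<open>The image in the matrix algebra is a nonzero complex multiple of F_I, and F_I is nonzero
  because its norm in the trace form is positive.\<close>

lemma Cl_basis_nonzero:
  assumes I: "I \<subseteq> {1..n}"
  shows "Cl_basis r s I \<noteq> \<zero>\<^bsub>Cl r s\<^esub>"
proof
  assume zero: "Cl_basis r s I = \<zero>\<^bsub>Cl r s\<^esub>"
  obtain \<zeta> where \<zeta>: "\<zeta> I \<noteq> (0 :: complex)"
    "rep (Cl_basis r s I) = (sc (Re (\<zeta> I)) (monomial I), sc (Im (\<zeta> I)) (monomial I))"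
    using rep_basis I by metis
  have "rep (Cl_basis r s I) = (\<zero>, \<zero>)"
    using ring_hom_zero[OF rep_hom Cl_ring cx_ring_ring] zero by simp
  moreover have nz: "monomial I = \<zero>" if "sc a (monomial I) = \<zero>" "a \<noteq> 0" for a
  proof -
    have "sc (1 / a) (sc a (monomial I)) = \<zero>" using that(1) by simp
    then show ?thesis using that(2) by (simp add: sc_mult)
  qed
  ultimately have "monomial I = \<zero>"
    using \<zeta> by (auto simp: complex_eq_iff)
  then show False using tr_star_monomial[OF I I] tr_one by simp
qed

text \<open>Turns the membership condition in the Clifford algebra into one on cardinalities. The
  empty set drops out by itself, 0 being neither 1 nor 2 modulo 4.\<close>

lemma H_index_eq: "H_index r s = lie_index"
  using Cl_basis_in_G_iff Cl_basis_nonzero rs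
  by (auto simp: H_index_def lie_index_def)

lemma carrier_H_lie:
  "carrier (H_lie r s) =
    {(\<Oplus>\<^bsub>Cl r s\<^esub> I \<in> lie_index. Cl_scale r s (a I) (Cl_basis r s I)) | a. True}"
  by (simp add: H_lie_def Cl_lie_subalgebra_def H_index_eq)

definition H_elem :: "(nat set \<Rightarrow> real) \<Rightarrow> (nat word \<Rightarrow>\<^sub>0 real) set" where
  "H_elem a = (\<Oplus>\<^bsub>Cl r s\<^esub> I \<in> lie_index. Cl_scale r s (a I) (Cl_basis r s I))"

lemma H_elem_closed [simp, intro]: "H_elem a \<in> carrier (Cl r s)"
  unfolding H_elem_def by (intro Cl.finsum_closed) auto

lemma H_elem_cong: "(\<And>I. I \<in> lie_index \<Longrightarrow> a I = b I) \<Longrightarrow> H_elem a = H_elem b"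
  unfolding H_elem_def by (intro Cl.finsum_cong') auto

lemma carrier_H_lie_elem: "carrier (H_lie r s) = range H_elem"
  by (auto simp: carrier_H_lie H_elem_def)

lemma rep_H_elem:
  assumes \<zeta>: "\<And>I. I \<subseteq> {1..n} \<Longrightarrow>
      rep (Cl_basis r s I) = (sc (Re (\<zeta> I)) (monomial I), sc (Im (\<zeta> I)) (monomial I))"
  shows "rep (H_elem a) = (combination (\<lambda>I. a I * Re (\<zeta> I)), combination (\<lambda>I. a I * Im (\<zeta> I)))"
proof -
  have sum: "rep (\<Oplus>\<^bsub>Cl r s\<^esub> I \<in> A. Cl_scale r s (a I) (Cl_basis r s I)) =
      (\<Oplus>\<^bsub>cx_ring M\<^esub> I \<in> A. rep (Cl_scale r s (a I) (Cl_basis r s I)))" if "finite A" for A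
    using that
  proof (induction A rule: finite_induct)
    case empty
    show ?case using ring_hom_zero[OF rep_hom Cl_ring cx_ring_ring] by simp
  next
    case (insert I A)
    have "rep (Cl_scale r s (a J) (Cl_basis r s J)) \<in> carrier (cx_ring M)" for J
      using rep_closed[of "Cl_scale r s (a J) (Cl_basis r s J)"] by simp
    then show ?case using insert ring_hom_add[OF rep_hom] by (simp add: Pi_def)
  qed
  have "rep (H_elem a) = (\<Oplus>\<^bsub>cx_ring M\<^esub> I \<in> lie_index. rep (Cl_scale r s (a I) (Cl_basis r s I)))"
    unfolding H_elem_def by (rule sum) simp
  also have "\<dots> = (\<Oplus>\<^bsub>cx_ring M\<^esub> I \<in> lie_index.
      (sc (a I * Re (\<zeta> I)) (monomial I), sc (a I * Im (\<zeta> I)) (monomial I)))"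
    by (intro cx.finsum_cong') (auto simp: rep_scale \<zeta>[OF lie_index_subset] sc_mult)
  finally show ?thesis
    unfolding combination_def by (subst (asm) cx_ring_finsum) auto
qed

text \<open>The complex linear extension of \<open>rep\<close>: x + iy goes to rep x + i rep
  y.\<close>

definition cx_rep :: "(nat word \<Rightarrow>\<^sub>0 real) set \<times> (nat word \<Rightarrow>\<^sub>0 real) set \<Rightarrow> 'a \<times> 'a" where
  "cx_rep = (\<lambda>(x, y). (fst (rep x) \<ominus> snd (rep y), snd (rep x) \<oplus> fst (rep y)))"

lemma cx_rep_H_elem:
  assumes \<zeta>: "\<And>I. I \<subseteq> {1..n} \<Longrightarrow>
      rep (Cl_basis r s I) = (sc (Re (\<zeta> I)) (monomial I), sc (Im (\<zeta> I)) (monomial I))"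
  shows "cx_rep (H_elem a, H_elem b) =
    (combination (\<lambda>I. Re (Complex (a I) (b I) * \<zeta> I)), combination (\<lambda>I. Im (Complex (a I) (b I) * \<zeta> I)))"
proof -
  have "rep (H_elem a) = (combination (\<lambda>I. a I * Re (\<zeta> I)), combination (\<lambda>I. a I * Im (\<zeta> I)))" for a
    by (rule rep_H_elem) (rule \<zeta>)
  then show ?thesis
    by (simp add: cx_rep_def minus_eq combination_minus combination_add)
qed

text \<open>In coordinates the map multiplies the complex coefficient at I by \<zeta> I. For
  injectivity no independence of the e_I has to be known: the image determines the coefficients, and
  these determine the element.\<close>

lemma cx_rep_bij:
  "bij_betw cx_rep (carrier (H_lie r s) \<times> carrier (H_lie r s)) (lie_carrier \<times> lie_carrier)"
proof -
  obtain \<zeta> where \<zeta>: "\<And>I. I \<subseteq> {1..n} \<Longrightarrow> \<zeta> I \<noteq> 0" "\<And>I. I \<subseteq> {1..n} \<Longrightarrow>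
      rep (Cl_basis r s I) = (sc (Re (\<zeta> I)) (monomial I), sc (Im (\<zeta> I)) (monomial I))"
    using rep_basis by blast
  have eq: "cx_rep (H_elem a, H_elem b) = (combination (\<lambda>I. Re (Complex (a I) (b I) * \<zeta> I)),
      combination (\<lambda>I. Im (Complex (a I) (b I) * \<zeta> I)))" for a b
    by (rule cx_rep_H_elem) (rule \<zeta>(2))
  show ?thesis
    unfolding bij_betw_def
  proof
    show "inj_on cx_rep (carrier (H_lie r s) \<times> carrier (H_lie r s))"
    proof (rule inj_onI, clarify)
      fix x y x' y'
      assume "x \<in> carrier (H_lie r s)" "y \<in> carrier (H_lie r s)"
        "x' \<in> carrier (H_lie r s)" "y' \<in> carrier (H_lie r s)"
      then obtain a b a' b' where ab: "x = H_elem a" "y = H_elem b" "x' = H_elem a'" "y' = H_elem b'"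
        by (auto simp: carrier_H_lie_elem)
      assume "cx_rep (x, y) = cx_rep (x', y')"
      then have c: "coeff I (combination (\<lambda>I. Re (Complex (a I) (b I) * \<zeta> I))) =
          coeff I (combination (\<lambda>I. Re (Complex (a' I) (b' I) * \<zeta> I)))"
        "coeff I (combination (\<lambda>I. Im (Complex (a I) (b I) * \<zeta> I))) =
          coeff I (combination (\<lambda>I. Im (Complex (a' I) (b' I) * \<zeta> I)))" for I
        unfolding ab eq by simp_all
      have "a I = a' I \<and> b I = b' I" if I: "I \<in> lie_index" for I
      proof -
        have "Complex (a I) (b I) * \<zeta> I = Complex (a' I) (b' I) * \<zeta> I"
          using c[of I] unfolding coeff_combination[OF I] by (intro complex_eqI)
        then show ?thesis using \<zeta>(1)[OF lie_index_subset[OF I]] by simp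
      qed
      then show "x = x' \<and> y = y'" unfolding ab by (intro conjI H_elem_cong) auto
    qed
    show "cx_rep ` (carrier (H_lie r s) \<times> carrier (H_lie r s)) = lie_carrier \<times> lie_carrier"
    proof (intro equalityI subsetI)
      fix w assume "w \<in> cx_rep ` (carrier (H_lie r s) \<times> carrier (H_lie r s))"
      then show "w \<in> lie_carrier \<times> lie_carrier"
        by (auto simp: carrier_H_lie_elem eq combination_lie_carrier)
    next
      fix w assume "w \<in> lie_carrier \<times> lie_carrier"
      then obtain u v where w: "w = (u, v)" "u \<in> lie_carrier" "v \<in> lie_carrier" by auto
      \<comment> \<open>Complex coefficients of the preimage, obtained by undoing the multiplication
        by \<open>\<zeta> I\<close>.\<close>
      define c where "c I = Complex (coeff I u) (coeff I v) / \<zeta> I" for I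
      have "cx_rep (H_elem (\<lambda>I. Re (c I)), H_elem (\<lambda>I. Im (c I))) =
          (combination (\<lambda>I. coeff I u), combination (\<lambda>I. coeff I v))"
        unfolding eq using \<zeta>(1)[OF lie_index_subset]
        by (auto simp: c_def intro!: combination_cong)
      also have "\<dots> = w"
        using lie_carrier_combination w by auto
      finally show "w \<in> cx_rep ` (carrier (H_lie r s) \<times> carrier (H_lie r s))"
        by (auto simp: carrier_H_lie_elem intro!: image_eqI)
    qed
  qed
qed

end

text \<open>\<open>L\<close> enters only through its carrier and its operations, so that Lie
  algebras of matrices and of pairs of matrices are both covered.\<close>

theorem complexification_H_lie:
  fixes L :: "(real, 'a) lie_algebra"
  assumes rs: "r + s = n"
    and L_carrier: "carrier L = lie_carrier"
    and L_add: "\<And>x y. x \<in> carrier M \<Longrightarrow> y \<in> carrier M \<Longrightarrow> lie_add L x y = x \<oplus> y"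
    and L_scale: "\<And>a x. x \<in> carrier M \<Longrightarrow> lie_scale L a x = sc a x"
    and L_bracket: "\<And>x y. x \<in> carrier M \<Longrightarrow> y \<in> carrier M \<Longrightarrow> lie_bracket L x y = x \<otimes> y \<ominus> y \<otimes> x"
  shows "complexification (H_lie r s) \<cong>\<^sub>L complexification L"
proof -
  note hom = rep_hom[OF rs] and scale = rep_scale[OF rs] and closed = rep_components[OF rs]
  have H: "x \<in> carrier (Cl r s)" if "x \<in> carrier (H_lie r s)" for x
    using that by (auto simp: carrier_H_lie_elem[OF rs] H_elem_closed[OF rs])
  have Hadd: "lie_add (H_lie r s) x y = x \<oplus>\<^bsub>Cl r s\<^esub> y"
    and Hscale: "lie_scale (H_lie r s) a x = Cl_scale r s a x"
    and Hbracket: "lie_bracket (H_lie r s) x y = (x \<otimes>\<^bsub>Cl r s\<^esub> y) \<ominus>\<^bsub>Cl r s\<^esub> (y \<otimes>\<^bsub>Cl r s\<^esub> x)" for x y a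
    by (simp_all add: H_lie_def Cl_lie_subalgebra_def)
  have add: "fst (rep r s (x \<oplus>\<^bsub>Cl r s\<^esub> y)) = fst (rep r s x) \<oplus> fst (rep r s y)"
    "snd (rep r s (x \<oplus>\<^bsub>Cl r s\<^esub> y)) = snd (rep r s x) \<oplus> snd (rep r s y)"
    if "x \<in> carrier (Cl r s)" "y \<in> carrier (Cl r s)" for x y
    using ring_hom_add[OF hom that] by (simp_all add: cx_ring_fst_snd)
  have mult: "fst (rep r s (x \<otimes>\<^bsub>Cl r s\<^esub> y)) = fst (rep r s x) \<otimes> fst (rep r s y) \<ominus> snd (rep r s x) \<otimes> snd (rep r s y)"
    "snd (rep r s (x \<otimes>\<^bsub>Cl r s\<^esub> y)) = fst (rep r s x) \<otimes> snd (rep r s y) \<oplus> snd (rep r s x) \<otimes> fst (rep r s y)"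
    if "x \<in> carrier (Cl r s)" "y \<in> carrier (Cl r s)" for x y
    using ring_hom_mult[OF hom that] by (simp_all add: cx_ring_fst_snd)
  have sca: "fst (rep r s (Cl_scale r s a x)) = sc a (fst (rep r s x))"
    "snd (rep r s (Cl_scale r s a x)) = sc a (snd (rep r s x))"
    if "x \<in> carrier (Cl r s)" for x a
    using scale[OF that] by (simp_all add: cx_scale_def)
  have neg: "fst (rep r s (\<ominus>\<^bsub>Cl r s\<^esub> x)) = \<ominus> fst (rep r s x)"
    "snd (rep r s (\<ominus>\<^bsub>Cl r s\<^esub> x)) = \<ominus> snd (rep r s x)"
    if "x \<in> carrier (Cl r s)" for x
    using sca[OF that, of "- 1"] that closed by (simp_all add: sc_m1 Cl.sc_m1)
  note simps = cx_rep_def[OF rs] add mult sca neg closed L_add L_scale L_bracket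
    Hadd Hscale Hbracket Cl.minus_eq
  have "cx_rep r s \<in> lie_iso (complexification (H_lie r s)) (complexification L)"
    unfolding lie_iso_def
  proof (intro CollectI conjI ballI allI)
    show "bij_betw (cx_rep r s) (carrier (complexification (H_lie r s))) (carrier (complexification L))"
      using cx_rep_bij[OF rs] by (simp add: complexification_def L_carrier)
  next
    fix X Y
    assume "X \<in> carrier (complexification (H_lie r s))" "Y \<in> carrier (complexification (H_lie r s))"
    then obtain x y x' y' where XY: "X = (x, y)" "Y = (x', y')"
      and xy: "x \<in> carrier (Cl r s)" "y \<in> carrier (Cl r s)" "x' \<in> carrier (Cl r s)" "y' \<in> carrier (Cl r s)"
      using H by (auto simp: complexification_def)
    show "cx_rep r s (lie_add (complexification (H_lie r s)) X Y) =
        lie_add (complexification L) (cx_rep r s X) (cx_rep r s Y)"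
      using xy by (simp add: XY complexification_def simps minus_eq minus_add a_ac)
    show "cx_rep r s (lie_bracket (complexification (H_lie r s)) X Y) =
        lie_bracket (complexification L) (cx_rep r s X) (cx_rep r s Y)"
      using xy
      by (simp add: XY complexification_def simps minus_eq minus_add l_distr r_distr l_minus r_minus
        sc_m1 a_ac)
  next
    fix z X
    assume "X \<in> carrier (complexification (H_lie r s))"
    then obtain x y where X: "X = (x, y)" and xy: "x \<in> carrier (Cl r s)" "y \<in> carrier (Cl r s)"
      using H by (auto simp: complexification_def)
    show "cx_rep r s (lie_scale (complexification (H_lie r s)) z X) =
        lie_scale (complexification L) z (cx_rep r s X)"
      using xy by (simp add: X complexification_def simps minus_eq minus_add sc_add_right
        sc_minus_left sc_minus_right a_ac)
  qed
  then show ?thesis unfolding lie_isomorphic_def by blast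
qed

end

section \<open>Matrix algebras\<close>

lemma ring_mat_ring: "ring (ring_mat TYPE('a :: ring_1) N b)"
  by (unfold_locales, insert add_inv_exists_mat, auto simp: ring_mat_def algebra_simps Units_def)

lemma ring_mat_minus:
  assumes "A \<in> carrier_mat N N"
  shows "\<ominus>\<^bsub>ring_mat TYPE('a :: ring_1) N b\<^esub> A = - A"
proof -
  interpret ring "ring_mat TYPE('a) N b" by (rule ring_mat_ring)
  show ?thesis using assms
    by (intro minus_equality) (auto simp: ring_mat_simps)
qed

lemma mult_mat_index:
  assumes "A \<in> carrier_mat m n" "B \<in> carrier_mat n p" "i < m" "j < p"
  shows "(A * B) $$ (i, j) = (\<Sum>k<n. A $$ (i, k) * B $$ (k, j))"
  using assms by (auto simp: scalar_prod_def atLeast0LessThan intro!: sum.cong)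

text \<open>One form for the real transpose, the complex adjoint and the quaternionic conjugate
  transpose.\<close>

definition conj_transpose :: "('a \<Rightarrow> 'a) \<Rightarrow> 'a mat \<Rightarrow> 'a mat" where
  "conj_transpose cj A = map_mat cj (transpose_mat A)"

lemma conj_transpose_carrier [simp, intro]:
  "A \<in> carrier_mat m n \<Longrightarrow> conj_transpose cj A \<in> carrier_mat n m"
  by (simp add: conj_transpose_def)

lemma conj_transpose_index [simp]:
  "A \<in> carrier_mat m n \<Longrightarrow> i < n \<Longrightarrow> j < m \<Longrightarrow> conj_transpose cj A $$ (i, j) = cj (A $$ (j, i))"
  by (auto simp: conj_transpose_def)

abbreviation mat_scale :: "real \<Rightarrow> 'a::real_algebra_1 mat \<Rightarrow> 'a mat" where
  "mat_scale \<equiv> \<lambda>a A. of_real a \<cdot>\<^sub>m A"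

text \<open>What R, C and H have in common. \<open>cj_mult\<close> reverses factors because of H,
  and \<open>re_comm\<close> is the only commutativity that all three share.\<close>

locale scalar_star =
  fixes cj :: "'a::real_algebra_1 \<Rightarrow> 'a" and re :: "'a \<Rightarrow> real"
    and cs :: "'b \<Rightarrow> 'a \<Rightarrow> real" and B :: "'b set"
  assumes cj_add: "cj (x + y) = cj x + cj y"
    and cj_mult: "cj (x * y) = cj y * cj x"
    and cj_scaleR: "cj (a *\<^sub>R x) = a *\<^sub>R cj x"
    and cj_cj: "cj (cj x) = x"
    and re_add: "re (x + y) = re x + re y"
    and re_scaleR: "re (a *\<^sub>R x) = a * re x"
    and re_comm: "re (x * y) = re (y * x)"
    and re_cj: "re (cj x) = re x"
    and re_one: "re 1 > 0"
    and finite_B: "finite B"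
    and cs_add: "b \<in> B \<Longrightarrow> cs b (x + y) = cs b x + cs b y"
    and cs_scaleR: "b \<in> B \<Longrightarrow> cs b (a *\<^sub>R x) = a * cs b x"
    and cs_eqI: "(\<And>b. b \<in> B \<Longrightarrow> cs b x = cs b y) \<Longrightarrow> x = y"
    and re_cs: "re (cj x * y) = (\<Sum>b\<in>B. cs b x * cs b y)"
begin

lemma cj_zero: "cj 0 = 0" using cj_scaleR[of 0 0] by simp
lemma re_zero: "re 0 = 0" using re_scaleR[of 0 0] by simp
lemma cj_one: "cj 1 = 1" using cj_mult[of "cj 1" 1] by (simp add: cj_cj)

lemma cj_sum: "cj (\<Sum>i\<in>A. f i) = (\<Sum>i\<in>A. cj (f i))"
  by (induction A rule: infinite_finite_induct) (auto simp: cj_add cj_zero)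

lemma re_sum: "re (\<Sum>i\<in>A. f i) = (\<Sum>i\<in>A. re (f i))"
  by (induction A rule: infinite_finite_induct) (auto simp: re_add re_zero)

definition mat_tr :: "nat \<Rightarrow> 'a mat \<Rightarrow> real" where
  "mat_tr N A = (\<Sum>i<N. re (A $$ (i, i)))"

definition mat_co :: "nat \<times> nat \<times> 'b \<Rightarrow> 'a mat \<Rightarrow> real" where
  "mat_co = (\<lambda>(i, j, b) A. cs b (A $$ (i, j)))"

definition mat_basis :: "nat \<Rightarrow> (nat \<times> nat \<times> 'b) set" where
  "mat_basis N = {..<N} \<times> {..<N} \<times> B"

lemma mat_tr_mult:
  assumes "A \<in> carrier_mat N N" "C \<in> carrier_mat N N"
  shows "mat_tr N (A * C) = (\<Sum>i<N. \<Sum>k<N. re (A $$ (i, k) * C $$ (k, i)))"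
  using assms by (simp add: mat_tr_def mult_mat_index[of A N N C N] re_sum del: index_mult_mat)

text \<open>\<open>mat_tr\<close> is the real part of the matrix trace. Over the quaternions the
  trace itself is not cyclic, but its real part is.\<close>

lemma star_alg_mat:
  assumes "N > 0"
  shows "star_alg (ring_mat TYPE('a) N ()) mat_scale (conj_transpose cj) (mat_tr N) mat_co (mat_basis N)"
proof (intro star_alg.intro real_alg.intro ring_mat_ring real_alg_axioms.intro star_alg_axioms.intro,
    unfold ring_mat_simps)
  fix A C :: "'a mat" and a b :: real
  assume A: "A \<in> carrier_mat N N"
  show "mat_scale a A \<in> carrier_mat N N" using A by simp
  show "mat_scale (a + b) A = mat_scale a A + mat_scale b A"
    using A by (intro eq_matI) (auto simp: distrib_right)
  show "mat_scale a (mat_scale b A) = mat_scale (a * b) A"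
    using A by (intro eq_matI) (auto simp: mult.assoc)
  show "mat_scale 1 A = A"
    using A by (intro eq_matI) auto
  show "conj_transpose cj A \<in> carrier_mat N N" using A by simp
  show "conj_transpose cj (mat_scale a A) = mat_scale a (conj_transpose cj A)"
    using A by (intro eq_matI) (auto simp: conj_transpose_def cj_scaleR simp flip: scaleR_conv_of_real)
  show "conj_transpose cj (conj_transpose cj A) = A"
    using A by (intro eq_matI) (auto simp: conj_transpose_def cj_cj)
  show "mat_tr N (mat_scale a A) = a * mat_tr N A"
    using A by (auto simp: mat_tr_def re_scaleR sum_distrib_left simp flip: scaleR_conv_of_real)
  show "mat_tr N (conj_transpose cj A) = mat_tr N A"
    using A by (auto simp: mat_tr_def conj_transpose_def re_cj)
  show "mat_co s (mat_scale a A) = a * mat_co s A" if "s \<in> mat_basis N" for s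
    using that A by (auto simp: mat_basis_def mat_co_def cs_scaleR simp flip: scaleR_conv_of_real)
  assume C: "C \<in> carrier_mat N N"
  show "mat_scale a (A + C) = mat_scale a A + mat_scale a C"
    using A C by (intro eq_matI) (auto simp: distrib_left)
  show "mat_scale a A * C = mat_scale a (A * C)"
    using A C by (intro eq_matI)
      (auto simp: mult_mat_index[of _ N N C N] sum_distrib_left mult.assoc simp del: index_mult_mat(1))
  show "A * mat_scale a C = mat_scale a (A * C)"
    using A C
  proof (intro eq_matI)
    fix i j assume "i < dim_row (mat_scale a (A * C))" "j < dim_col (mat_scale a (A * C))"
    then show "(A * mat_scale a C) $$ (i, j) = mat_scale a (A * C) $$ (i, j)"
      using A C by (auto simp: mult_mat_index[of A N N _ N] scaleR_sum_right
          simp del: index_mult_mat(1) simp flip: scaleR_conv_of_real)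
  qed auto
  show "conj_transpose cj (A + C) = conj_transpose cj A + conj_transpose cj C"
    using A C by (intro eq_matI) (auto simp: conj_transpose_def cj_add)
  show "conj_transpose cj (A * C) = conj_transpose cj C * conj_transpose cj A"
  proof (intro eq_matI)
    fix i j
    assume "i < dim_row (conj_transpose cj C * conj_transpose cj A)"
      "j < dim_col (conj_transpose cj C * conj_transpose cj A)"
    then have ij: "i < N" "j < N" using A C by (auto simp: conj_transpose_def)
    have "conj_transpose cj (A * C) $$ (i, j) = cj ((A * C) $$ (j, i))"
      using A C ij by (intro conj_transpose_index) auto
    also have "\<dots> = (\<Sum>k<N. cj (C $$ (k, i)) * cj (A $$ (j, k)))"
      using A C ij by (simp add: mult_mat_index[of A N N C N] cj_sum cj_mult del: index_mult_mat(1))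
    also have "\<dots> = (conj_transpose cj C * conj_transpose cj A) $$ (i, j)"
      using A C ij by (subst mult_mat_index[of _ N N _ N]) auto
    finally show "conj_transpose cj (A * C) $$ (i, j) = (conj_transpose cj C * conj_transpose cj A) $$ (i, j)" .
  qed (use A C in \<open>auto simp: conj_transpose_def\<close>)
  show "mat_tr N (A + C) = mat_tr N A + mat_tr N C"
    using A C by (simp add: mat_tr_def re_add sum.distrib)
  show "mat_tr N (A * C) = mat_tr N (C * A)"
    unfolding mat_tr_mult[OF A C] mat_tr_mult[OF C A] by (subst sum.swap) (simp add: re_comm)
  show "mat_co s (A + C) = mat_co s A + mat_co s C" if "s \<in> mat_basis N" for s
    using that A C by (auto simp: mat_basis_def mat_co_def cs_add)
  show "A = C" if eq: "\<And>s. s \<in> mat_basis N \<Longrightarrow> mat_co s A = mat_co s C"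
  proof (intro eq_matI cs_eqI)
    fix i j b assume "i < dim_row C" "j < dim_col C" "b \<in> B"
    then show "cs b (A $$ (i, j)) = cs b (C $$ (i, j))"
      using C eq[of "(i, j, b)"] by (auto simp: mat_basis_def mat_co_def)
  qed (use A C in auto)
  have "mat_tr N (conj_transpose cj A * C) =
      (\<Sum>i<N. \<Sum>k<N. \<Sum>b\<in>B. cs b (A $$ (k, i)) * cs b (C $$ (k, i)))"
    using A C by (subst mat_tr_mult) (auto simp: re_cs)
  also have "\<dots> = (\<Sum>k<N. \<Sum>i<N. \<Sum>b\<in>B. cs b (A $$ (k, i)) * cs b (C $$ (k, i)))"
    by (rule sum.swap)
  also have "\<dots> = (\<Sum>s\<in>mat_basis N. mat_co s A * mat_co s C)"
    by (simp add: mat_basis_def mat_co_def sum.cartesian_product split_def)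
  finally show "mat_tr N (conj_transpose cj A * C) = (\<Sum>s\<in>mat_basis N. mat_co s A * mat_co s C)" .
next
  show "mat_tr N (1\<^sub>m N) > 0" using assms re_one by (simp add: mat_tr_def)
  show "finite (mat_basis N)" using finite_B by (simp add: mat_basis_def)
qed

end

section \<open>Anticommuting skew matrices and Kronecker products\<close>

definition skew_generators :: "('a::real_algebra_1 \<Rightarrow> 'a) \<Rightarrow> nat \<Rightarrow> nat \<Rightarrow> (nat \<Rightarrow> 'a mat) \<Rightarrow> bool" where
  "skew_generators cj N n F \<longleftrightarrow> (\<forall>i. F i \<in> carrier_mat N N) \<and>
    (\<forall>i\<in>{1..n}. conj_transpose cj (F i) = - F i \<and> F i * F i = - 1\<^sub>m N \<and>
      (\<forall>j\<in>{1..n}. i \<noteq> j \<longrightarrow> F i * F j = - (F j * F i)))"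

text \<open>Residue 3 is left to pairs of matrices: there the top monomial is central and symmetric
  and may be a nonzero scalar, as the quaternion identity ijk = -1 illustrates, so its trace need
  not vanish.\<close>

lemma (in scalar_star) skew_clifford_mat:
  assumes "N > 0" "skew_generators cj N n F" "N * N * card B = 2 ^ n" "n mod 4 \<noteq> 3"
  shows "skew_clifford (ring_mat TYPE('a) N ()) mat_scale (conj_transpose cj) (mat_tr N) mat_co
    (mat_basis N) F n"
proof (intro skew_clifford.intro star_alg_mat[OF assms(1)] skew_clifford_axioms.intro, unfold ring_mat_simps)
  have F: "F i \<in> carrier_mat N N" for i using assms(2) by (simp add: skew_generators_def)
  note minus = ring_mat_minus[where N = N and b = "()" and 'a = 'a]
  fix i
  show "F i \<in> carrier_mat N N" by (rule F)
  assume i: "i \<in> {1..n}"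
  then show "conj_transpose cj (F i) = \<ominus>\<^bsub>ring_mat TYPE('a) N ()\<^esub> F i"
    "F i * F i = \<ominus>\<^bsub>ring_mat TYPE('a) N ()\<^esub> 1\<^sub>m N"
    using assms(2) F by (simp_all add: skew_generators_def minus)
  fix j assume "j \<in> {1..n}" "i \<noteq> j"
  then have "F i * F j = - (F j * F i)" using assms(2) i unfolding skew_generators_def by blast
  then show "F i * F j = \<ominus>\<^bsub>ring_mat TYPE('a) N ()\<^esub> (F j * F i)"
    using F by (simp add: minus[OF mult_carrier_mat[OF F F]])
next
  show "card (mat_basis N) = 2 ^ n"
    using assms(3) by (simp add: mat_basis_def card_cartesian_product ac_simps)
qed (use assms(4) in simp)

text \<open>The second factor is real, so its entries commute with those of the first; this keeps
  the mixed product rule valid over the quaternions.\<close>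

definition kron :: "'a::real_algebra_1 mat \<Rightarrow> real mat \<Rightarrow> 'a mat" where
  "kron A P = mat (dim_row A * dim_row P) (dim_col A * dim_col P)
    (\<lambda>(i, j). P $$ (i mod dim_row P, j mod dim_col P) *\<^sub>R
      A $$ (i div dim_row P, j div dim_col P))"

lemma kron_carrier [simp, intro]:
  "A \<in> carrier_mat m n \<Longrightarrow> P \<in> carrier_mat p q \<Longrightarrow> kron A P \<in> carrier_mat (m * p) (n * q)"
  by (auto simp: kron_def)

lemma kron_index:
  assumes "A \<in> carrier_mat m n" "P \<in> carrier_mat p q" "i < m * p" "j < n * q"
  shows "kron A P $$ (i, j) = P $$ (i mod p, j mod q) *\<^sub>R A $$ (i div p, j div q)"
  using assms by (auto simp: kron_def)

lemma div_mod_less: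
  fixes i m p :: nat
  assumes "i < m * p"
  shows "i div p < m" "i mod p < p"
  using assms by (auto simp: less_mult_imp_div_less intro!: mod_less_divisor) (cases p; auto)

lemma sum_div_mod:
  fixes f :: "nat \<Rightarrow> nat \<Rightarrow> 'a::comm_monoid_add"
  shows "(\<Sum>k<m * p. f (k div p) (k mod p)) = (\<Sum>i<m. \<Sum>j<p. f i j)"
proof -
  have "(\<Sum>i<m. \<Sum>j<p. f i j) = (\<Sum>(i, j)\<in>{..<m} \<times> {..<p}. f i j)"
    by (simp add: sum.cartesian_product)
  also have "\<dots> = (\<Sum>k<m * p. f (k div p) (k mod p))"
  proof (rule sum.reindex_bij_witness[of _ "\<lambda>k. (k div p, k mod p)" "\<lambda>(i, j). i * p + j"]; clarsimp)
    fix i j assume "i < m" "j < p"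
    then have "i * p + j < Suc i * p" by simp
    also have "\<dots> \<le> m * p" using \<open>i < m\<close> by (intro mult_right_mono) auto
    finally show "i * p + j < m * p" .
  qed (auto simp: div_mod_less)
  finally show ?thesis ..
qed

lemma kron_mult:
  assumes A: "A \<in> carrier_mat m n" and A': "A' \<in> carrier_mat n l"
    and P: "P \<in> carrier_mat p q" and P': "P' \<in> carrier_mat q t"
  shows "kron A P * kron A' P' = kron (A * A') (P * P')"
proof (rule eq_matI)
  fix i j assume "i < dim_row (kron (A * A') (P * P'))" "j < dim_col (kron (A * A') (P * P'))"
  then have ij: "i < m * p" "j < l * t" using assms by (auto simp: kron_def)
  note d = div_mod_less[OF ij(1)] div_mod_less[OF ij(2)]
  have "(kron A P * kron A' P') $$ (i, j) = (\<Sum>k<n * q. kron A P $$ (i, k) * kron A' P' $$ (k, j))"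
    using assms ij by (intro mult_mat_index) auto
  also have "\<dots> = (\<Sum>k<n * q. (P $$ (i mod p, k mod q) * P' $$ (k mod q, j mod t)) *\<^sub>R
      (A $$ (i div p, k div q) * A' $$ (k div q, j div t)))"
    using assms ij by (intro sum.cong refl)
      (simp add: kron_index[of A m n P p q] kron_index[of A' n l P' q t])
  also have "\<dots> = (\<Sum>k<n. \<Sum>k'<q. (P $$ (i mod p, k') * P' $$ (k', j mod t)) *\<^sub>R
      (A $$ (i div p, k) * A' $$ (k, j div t)))"
    by (rule sum_div_mod[of "\<lambda>k k'. (P $$ (i mod p, k') * P' $$ (k', j mod t)) *\<^sub>R
      (A $$ (i div p, k) * A' $$ (k, j div t))"])
  also have "\<dots> = (P * P') $$ (i mod p, j mod t) *\<^sub>R (A * A') $$ (i div p, j div t)"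
    unfolding mult_mat_index[OF A A' d(1,3)] mult_mat_index[OF P P' d(2,4)] scaleR_sum_right
    by (simp only: scaleR_sum_left)
  also have "\<dots> = kron (A * A') (P * P') $$ (i, j)"
    using assms ij by (intro kron_index[symmetric]) auto
  finally show "(kron A P * kron A' P') $$ (i, j) = kron (A * A') (P * P') $$ (i, j)" .
qed (use assms in \<open>auto simp: kron_def\<close>)

lemma kron_one: "kron (1\<^sub>m m) (1\<^sub>m p) = 1\<^sub>m (m * p)"
proof (rule eq_matI)
  fix i j assume "i < dim_row (1\<^sub>m (m * p))" "j < dim_col (1\<^sub>m (m * p))"
  then have ij: "i < m * p" "j < m * p" by auto
  have "i = j" if "i div p = j div p" "i mod p = j mod p"
    using that by (metis div_mult_mod_eq)
  then show "kron (1\<^sub>m m) (1\<^sub>m p) $$ (i, j) = 1\<^sub>m (m * p) $$ (i, j)"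
    using ij div_mod_less[OF ij(1)] div_mod_less[OF ij(2)]
    by (subst kron_index[of _ m m _ p p]) auto
qed (auto simp: kron_def)

lemma kron_scale:
  assumes "A \<in> carrier_mat m n" "P \<in> carrier_mat p q"
  shows "kron (mat_scale a A) (b \<cdot>\<^sub>m P) = mat_scale (a * b) (kron A P)"
proof (rule eq_matI)
  fix i j assume "i < dim_row (mat_scale (a * b) (kron A P))" "j < dim_col (mat_scale (a * b) (kron A P))"
  then have ij: "i < m * p" "j < n * q" using assms by (auto simp: kron_def)
  have "kron (mat_scale a A) (b \<cdot>\<^sub>m P) $$ (i, j) =
      (b \<cdot>\<^sub>m P) $$ (i mod p, j mod q) *\<^sub>R mat_scale a A $$ (i div p, j div q)"
    using assms ij by (intro kron_index) auto
  also have "\<dots> = (a * b) *\<^sub>R kron A P $$ (i, j)"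
    using assms ij div_mod_less[OF ij(1)] div_mod_less[OF ij(2)]
    by (simp add: kron_index[of A m n P p q] scaleR_conv_of_real[symmetric] ac_simps)
  also have "\<dots> = mat_scale (a * b) (kron A P) $$ (i, j)"
    using \<open>i < dim_row _\<close> \<open>j < dim_col _\<close> by (simp add: scaleR_conv_of_real)
  finally show "kron (mat_scale a A) (b \<cdot>\<^sub>m P) $$ (i, j) = mat_scale (a * b) (kron A P) $$ (i, j)" .
qed (use assms in \<open>auto simp: kron_def\<close>)

lemma (in scalar_star) conj_transpose_kron:
  assumes "A \<in> carrier_mat m n" "P \<in> carrier_mat p q"
  shows "conj_transpose cj (kron A P) = kron (conj_transpose cj A) (transpose_mat P)"
proof (rule eq_matI)
  fix i j assume "i < dim_row (kron (conj_transpose cj A) (transpose_mat P))"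
    "j < dim_col (kron (conj_transpose cj A) (transpose_mat P))"
  then have ij: "i < n * q" "j < m * p" using assms by (auto simp: kron_def conj_transpose_def)
  note d = div_mod_less[OF ij(1)] div_mod_less[OF ij(2)]
  have "conj_transpose cj (kron A P) $$ (i, j) = cj (kron A P $$ (j, i))"
    using assms ij by (intro conj_transpose_index) auto
  also have "\<dots> = P $$ (j mod p, i mod q) *\<^sub>R cj (A $$ (j div p, i div q))"
    using assms ij by (simp add: kron_index[of A m n P p q] cj_scaleR)
  also have "\<dots> = kron (conj_transpose cj A) (transpose_mat P) $$ (i, j)"
    using assms ij d by (subst kron_index[of _ n m _ q p]) auto
  finally show "conj_transpose cj (kron A P) $$ (i, j) =
      kron (conj_transpose cj A) (transpose_mat P) $$ (i, j)" .
qed (use assms in \<open>auto simp: kron_def conj_transpose_def\<close>)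

section \<open>One generator more: pairs and central elements\<close>

lemma RDirProd_simps [simp]:
  "carrier (RDirProd R S) = carrier R \<times> carrier S"
  "(a, b) \<oplus>\<^bsub>RDirProd R S\<^esub> (c, d) = (a \<oplus>\<^bsub>R\<^esub> c, b \<oplus>\<^bsub>S\<^esub> d)"
  "(a, b) \<otimes>\<^bsub>RDirProd R S\<^esub> (c, d) = (a \<otimes>\<^bsub>R\<^esub> c, b \<otimes>\<^bsub>S\<^esub> d)"
  "\<one>\<^bsub>RDirProd R S\<^esub> = (\<one>\<^bsub>R\<^esub>, \<one>\<^bsub>S\<^esub>)"
  "\<zero>\<^bsub>RDirProd R S\<^esub> = (\<zero>\<^bsub>R\<^esub>, \<zero>\<^bsub>S\<^esub>)"
  by (simp_all add: RDirProd_def DirProd_def monoid.defs)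

lemma RDirProd_minus:
  assumes "ring R" "ring S" "x \<in> carrier R" "y \<in> carrier S"
  shows "\<ominus>\<^bsub>RDirProd R S\<^esub> (x, y) = (\<ominus>\<^bsub>R\<^esub> x, \<ominus>\<^bsub>S\<^esub> y)"
proof -
  interpret R: ring R by fact
  interpret S: ring S by fact
  interpret P: ring "RDirProd R S" using assms by (intro RDirProd_ring)
  show ?thesis using assms by (intro P.minus_equality) (auto simp: R.l_neg S.l_neg)
qed

text \<open>The Boolean in a coordinate index selects the component of the pair, so the number of
  coordinates doubles, as it must for one more generator.\<close>

lemma (in star_alg) star_alg_prod:
  "star_alg (RDirProd M M) (\<lambda>a. map_prod (sc a) (sc a)) (map_prod star star)
    (\<lambda>(x, y). tr x + tr y) (\<lambda>(b, s) (x, y). if b then co s x else co s y) (UNIV \<times> S)"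
proof (intro star_alg.intro real_alg.intro real_alg_axioms.intro star_alg_axioms.intro
    RDirProd_ring ring_axioms, unfold RDirProd_simps)
  fix u v :: "'a \<times> 'a"
  assume uv: "u \<in> carrier M \<times> carrier M" "v \<in> carrier M \<times> carrier M"
  obtain x y x' y' where u: "u = (x, y)" "v = (x', y')"
    and car: "x \<in> carrier M" "y \<in> carrier M" "x' \<in> carrier M" "y' \<in> carrier M"
    using uv by (cases u; cases v) auto
  show "u = v"
    if "\<And>s. s \<in> UNIV \<times> S \<Longrightarrow> (\<lambda>(b, s) (x, y). if b then co s x else co s y) s u =
      (\<lambda>(b, s) (x, y). if b then co s x else co s y) s v"
  proof -
    have "x = x'" using that[of "(True, _)"] by (intro co_eqI car) (auto simp: u)
    moreover have "y = y'" using that[of "(False, _)"] by (intro co_eqI car) (auto simp: u)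
    ultimately show ?thesis by (simp add: u)
  qed
  have split: "(\<Sum>s\<in>UNIV \<times> S. f s) = (\<Sum>s\<in>S. f (True, s)) + (\<Sum>s\<in>S. f (False, s))"
    for f :: "bool \<times> 's \<Rightarrow> real"
    using sum.cartesian_product[of "\<lambda>b s. f (b, s)" S UNIV] by (simp add: UNIV_bool)
  show "(\<lambda>(x, y). tr x + tr y) (map_prod star star u \<otimes>\<^bsub>RDirProd M M\<^esub> v) =
    (\<Sum>s\<in>UNIV \<times> S. (\<lambda>(b, s) (x, y). if b then co s x else co s y) s u *
      (\<lambda>(b, s) (x, y). if b then co s x else co s y) s v)"
    using car by (simp add: u split tr_co)
  show "(\<lambda>(x, y). tr x + tr y) (u \<otimes>\<^bsub>RDirProd M M\<^esub> v) = (\<lambda>(x, y). tr x + tr y) (v \<otimes>\<^bsub>RDirProd M M\<^esub> u)"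
    using car tr_comm[of x x'] tr_comm[of y y'] by (simp add: u)
qed (use finite_S tr_one in \<open>auto simp: sc_add_left sc_add_right sc_mult sc_left sc_right star_add
    star_mult star_sc tr_add tr_sc tr_star co_add co_sc distrib_left\<close>)

text \<open>The product \<open>\<omega>\<close> of all generators anticommutes with each of them because \<open>n\<close> is even, and it
  is skew of square \<open>-1\<close> because \<open>n \<equiv> 2\<close> modulo 4; the two signs of \<open>\<omega>\<close> make the top monomial
  of the product algebra traceless.\<close>

lemma (in skew_clifford) skew_clifford_prod:
  assumes n: "n mod 4 = 2"
  shows "skew_clifford (RDirProd M M) (\<lambda>a. map_prod (sc a) (sc a)) (map_prod star star)
    (\<lambda>(x, y). tr x + tr y) (\<lambda>(b, s) (x, y). if b then co s x else co s y) (UNIV \<times> S)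
    (\<lambda>i. if i \<le> n then (F i, F i) else (monomial {1..n}, \<ominus> monomial {1..n})) (Suc n)"
proof -
  let ?\<omega> = "monomial {1..n}"
  let ?F = "\<lambda>i. if i \<le> n then (F i, F i) else (?\<omega>, \<ominus> ?\<omega>)"
  interpret P: star_alg "RDirProd M M" "\<lambda>a. map_prod (sc a) (sc a)" "map_prod star star"
    "\<lambda>(x, y). tr x + tr y" "\<lambda>(b, s) (x, y). if b then co s x else co s y" "UNIV \<times> S"
    by (rule star_alg_prod)
  note minus = RDirProd_minus[OF ring_axioms ring_axioms]
  have star: "star ?\<omega> = \<ominus> ?\<omega>"
    using star_monomial[of "{1..n}"] n by (simp add: clifford_sign_eq sc_m1)
  then have sq: "?\<omega> \<otimes> ?\<omega> = \<ominus> \<one>"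
    using monomial_unitary[of "{1..n}"] by (simp add: l_minus) (metis m_closed minus_minus monomial_closed)
  have anti: "F i \<otimes> ?\<omega> = \<ominus> (?\<omega> \<otimes> F i)" if "i \<in> {1..n}" for i
  proof -
    have "odd (card ({1..n} - {i}))" using that n by simp presburger
    then show ?thesis using monomial_commute[OF that, of "{1..n}"] by (simp add: sc_m1)
  qed
  have Fclosed: "?F i \<in> carrier (RDirProd M M)" for i by auto
  have lprod: "P.lprod ?F is = (lprod F is, lprod F is)" if "set is \<subseteq> {..n}" for "is"
    using that by (induction "is") auto
  show ?thesis
  proof (intro skew_clifford.intro P.star_alg_axioms skew_clifford_axioms.intro)
    fix i
    show "?F i \<in> carrier (RDirProd M M)" by (rule Fclosed)
    assume i: "i \<in> {1..Suc n}"
    have i': "i \<in> {1..n}" if "i \<le> n" using i that by auto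
    show "map_prod star star (?F i) = \<ominus>\<^bsub>RDirProd M M\<^esub> ?F i"
      using F_star[of i] i' star by (auto simp: minus star_minus)
    show "?F i \<otimes>\<^bsub>RDirProd M M\<^esub> ?F i = \<ominus>\<^bsub>RDirProd M M\<^esub> \<one>\<^bsub>RDirProd M M\<^esub>"
      using F_square[of i] i' sq by (auto simp: minus l_minus r_minus)
    fix j assume j: "j \<in> {1..Suc n}" "i \<noteq> j"
    have j': "j \<in> {1..n}" if "j \<le> n" using j that by auto
    show "?F i \<otimes>\<^bsub>RDirProd M M\<^esub> ?F j = \<ominus>\<^bsub>RDirProd M M\<^esub> (?F j \<otimes>\<^bsub>RDirProd M M\<^esub> ?F i)"
    proof (cases "i \<le> n"; cases "j \<le> n")
      assume "i \<le> n" "j \<le> n"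
      then show ?thesis using F_anticommute[OF i' j' j(2)] by (simp add: minus)
    next
      assume "i \<le> n" "\<not> j \<le> n"
      then show ?thesis using anti[OF i'] by (simp add: minus l_minus r_minus)
    next
      assume "\<not> i \<le> n" "j \<le> n"
      then show ?thesis using anti[OF j'] by (simp add: minus l_minus r_minus)
    qed (use i j in auto)
  next
    show "card ((UNIV :: bool set) \<times> S) = 2 ^ Suc n"
      by (simp add: card_cartesian_product card_S)
    have L: "[1..<Suc n] = sorted_list_of_set {1..n}"
      by (metis atLeastLessThanSuc_atLeastAtMost sorted_list_of_set_range)
    \<comment> \<open>The top monomial is (\<omega>, \<omega>) times (\<omega>, -\<omega>), that is
      (-1, 1), whose two traces cancel.\<close>
    have "P.lprod ?F [1..<Suc (Suc n)] = P.lprod ?F ([1..<Suc n] @ [Suc n])" by simp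
    also have "\<dots> = P.lprod ?F [1..<Suc n] \<otimes>\<^bsub>RDirProd M M\<^esub> P.lprod ?F [Suc n]"
      by (rule P.lprod_append) (rule Fclosed)
    also have "P.lprod ?F [1..<Suc n] = (?\<omega>, ?\<omega>)"
      by (subst lprod) (auto simp: monomial_def L[symmetric] simp del: upt_Suc One_nat_def)
    finally show "(\<lambda>(x, y). tr x + tr y) (P.lprod ?F [1..<Suc (Suc n)]) = 0"
      using sq by (simp add: r_minus tr_minus del: upt_Suc)
  qed
qed

text \<open>J is orthogonal to every other monomial. If |I| is 0 or 3 modulo 4, then F_I is
  symmetric and J skew. Otherwise some F_i anticommutes with F_I, hence with F_I J: an index outside
  I if |I| is 1 modulo 4, one inside I if it is 2.\<close>

lemma (in skew_clifford) central_skew_top: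
  assumes n: "n mod 4 = 1" and J: "J \<in> carrier M" "star J = \<ominus> J" "J \<noteq> \<zero>"
    and central: "\<And>i. i \<in> {1..n} \<Longrightarrow> F i \<otimes> J = J \<otimes> F i"
  obtains c where "c \<noteq> 0" "J = sc c (monomial {1..n})"
proof -
  have "coeff I J = 0" if I: "I \<subseteq> {1..n}" "I \<noteq> {1..n}" for I
  proof (cases "card I mod 4 \<in> {1, 2}")
    case False
    then have "star (monomial I) = monomial I"
      using star_monomial[OF I(1)] by (simp add: clifford_sign_eq)
    then show ?thesis
      using tr_orthogonal_star[OF J(1,2), of "monomial I"] by (simp add: coeff_def)
  next
    case True
    have fin: "finite I" using I(1) finite_subset by blast
    have "\<exists>i\<in>{1..n}. odd (card (I - {i}))"
    proof (cases "card I mod 4 = 1")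
      case True
      obtain i where "i \<in> {1..n}" "i \<notin> I" using I by blast
      then show ?thesis using True by (intro bexI[of _ i]) (auto, presburger)
    next
      case False
      with \<open>card I mod 4 \<in> {1, 2}\<close> have c: "card I mod 4 = 2" by simp
      then obtain i where i: "i \<in> I" by fastforce
      then have "card (I - {i}) = card I - 1" using fin by simp
      then have "odd (card (I - {i}))" using c by presburger
      then show ?thesis using i I by blast
    qed
    then obtain i where i: "i \<in> {1..n}" "odd (card (I - {i}))" by blast
    have "F i \<otimes> (monomial I \<otimes> J) = \<ominus> ((monomial I \<otimes> J) \<otimes> F i)"
      using monomial_commute[OF i(1) I(1)] i J(1)
      by (simp add: m_assoc[symmetric] sc_m1 l_minus) (simp add: m_assoc central)
    then have "tr (monomial I \<otimes> J) = 0"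
      using i(1) J(1) by (intro tr_zero_if_anticommute) auto
    then show ?thesis
      using star_monomial[OF I(1)] J(1) by (simp add: coeff_def sc_left tr_sc)
  qed
  then have "(\<Oplus>I\<in>Pow {1..n}. sc (coeff I J) (monomial I)) =
      (\<Oplus>I\<in>{{1..n}}. sc (coeff I J) (monomial I))"
    by (intro add.finprod_mono_neutral_cong_right) auto
  then have *: "J = sc (coeff {1..n} J) (monomial {1..n})"
    using monomial_expansion[OF J(1)] by simp
  moreover have "coeff {1..n} J \<noteq> 0"
  proof
    assume "coeff {1..n} J = 0"
    then show False using * J(3) by simp
  qed
  ultimately show ?thesis using that by blast
qed

text \<open>Spares the computation of the top monomial as a matrix: any nonzero central skew element
  is proportional to it and can take its place in the side condition.\<close>

lemma (in skew_clifford) lie_carrier_central: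
  assumes n: "n mod 4 = 1" and J: "J \<in> carrier M" "star J = \<ominus> J" "J \<noteq> \<zero>"
    and central: "\<And>i. i \<in> {1..n} \<Longrightarrow> F i \<otimes> J = J \<otimes> F i"
  shows "lie_carrier = {x \<in> carrier M. star x = \<ominus> x \<and> tr (J \<otimes> x) = 0}"
proof -
  obtain c where c: "c \<noteq> 0" "J = sc c (monomial {1..n})"
    using central_skew_top[OF assms] by blast
  have "coeff {1..n} x = 0 \<longleftrightarrow> tr (J \<otimes> x) = 0" if "x \<in> carrier M" for x
    using star_monomial[of "{1..n}"] that c n tr_one
    by (simp add: coeff_def sc_left tr_sc clifford_sign_eq)
  then show ?thesis using n by (auto simp: lie_carrier_def)
qed

section \<open>Generators from tensor products of \<open>2 \<times> 2\<close> matrices\<close>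

text \<open>Identity, Pauli X, Pauli Z, and E = ZX, which is i times Pauli Y. All four are real, so
  their tensor products are available over R, C and H.\<close>

datatype pauli = PI | PX | PZ | PE

fun pauli_entry :: "pauli \<Rightarrow> nat \<Rightarrow> nat \<Rightarrow> real" where
  "pauli_entry PI i j = (if i = j then 1 else 0)"
| "pauli_entry PX i j = (if i = j then 0 else 1)"
| "pauli_entry PZ i j = (if i = j then if i = 0 then 1 else - 1 else 0)"
| "pauli_entry PE i j = (if i = j then 0 else if i = 0 then 1 else - 1)"

definition pauli_mat :: "pauli \<Rightarrow> real mat" where
  "pauli_mat p = mat 2 2 (\<lambda>(i, j). pauli_entry p i j)"

definition pauli_comm :: "pauli \<Rightarrow> pauli \<Rightarrow> real" where
  "pauli_comm p q = (if p = PI \<or> q = PI \<or> p = q then 1 else - 1)"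

text \<open>One sign gives both the square and the behaviour under transposition, because the four
  matrices are orthogonal.\<close>

definition pauli_sign :: "pauli \<Rightarrow> real" where
  "pauli_sign p = (if p = PE then - 1 else 1)"

lemma pauli_mat_carrier [simp, intro]: "pauli_mat p \<in> carrier_mat 2 2"
  by (simp add: pauli_mat_def)

lemma pauli_mat_dim [simp]: "dim_row (pauli_mat p) = 2" "dim_col (pauli_mat p) = 2"
  by (simp_all add: pauli_mat_def)

lemma pauli_mat_mult_index:
  assumes "i < 2" "j < 2"
  shows "(pauli_mat p * pauli_mat q) $$ (i, j) =
    pauli_entry p i 0 * pauli_entry q 0 j + pauli_entry p i 1 * pauli_entry q 1 j"
  using assms by (subst mult_mat_index[of _ 2 2 _ 2]) (auto simp: pauli_mat_def numeral_2_eq_2)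

lemma pauli_mat_commute:
  "pauli_mat p * pauli_mat q = pauli_comm p q \<cdot>\<^sub>m (pauli_mat q * pauli_mat p)"
proof (rule eq_matI)
  fix i j assume "i < dim_row (pauli_comm p q \<cdot>\<^sub>m (pauli_mat q * pauli_mat p))"
    "j < dim_col (pauli_comm p q \<cdot>\<^sub>m (pauli_mat q * pauli_mat p))"
  then have ij: "i < 2" "j < 2" by auto
  then have "i = 0 \<or> i = 1" "j = 0 \<or> j = 1" by auto
  then have "pauli_entry p i 0 * pauli_entry q 0 j + pauli_entry p i 1 * pauli_entry q 1 j =
      pauli_comm p q * (pauli_entry q i 0 * pauli_entry p 0 j + pauli_entry q i 1 * pauli_entry p 1 j)"
    by (elim disjE; cases p; cases q; simp add: pauli_comm_def)
  moreover have "(pauli_comm p q \<cdot>\<^sub>m (pauli_mat q * pauli_mat p)) $$ (i, j) =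
      pauli_comm p q * (pauli_mat q * pauli_mat p) $$ (i, j)"
    using ij by (intro index_smult_mat(1)) auto
  ultimately show "(pauli_mat p * pauli_mat q) $$ (i, j) =
      (pauli_comm p q \<cdot>\<^sub>m (pauli_mat q * pauli_mat p)) $$ (i, j)"
    unfolding pauli_mat_mult_index[OF ij] by simp
qed auto

lemma pauli_mat_square: "pauli_mat p * pauli_mat p = pauli_sign p \<cdot>\<^sub>m 1\<^sub>m 2"
proof (rule eq_matI)
  fix i j assume "i < dim_row (pauli_sign p \<cdot>\<^sub>m 1\<^sub>m 2 :: real mat)" "j < dim_col (pauli_sign p \<cdot>\<^sub>m 1\<^sub>m 2 :: real mat)"
  then have ij: "i < 2" "j < 2" by auto
  then have "i = 0 \<or> i = 1" "j = 0 \<or> j = 1" by auto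
  then show "(pauli_mat p * pauli_mat p) $$ (i, j) = (pauli_sign p \<cdot>\<^sub>m 1\<^sub>m 2) $$ (i, j)"
    unfolding pauli_mat_mult_index[OF ij]
    by (elim disjE; cases p; simp add: pauli_sign_def)
qed auto

lemma pauli_mat_transpose: "transpose_mat (pauli_mat p) = pauli_sign p \<cdot>\<^sub>m pauli_mat p"
proof (rule eq_matI)
  fix i j assume "i < dim_row (pauli_sign p \<cdot>\<^sub>m pauli_mat p)" "j < dim_col (pauli_sign p \<cdot>\<^sub>m pauli_mat p)"
  then have ij: "i < 2" "j < 2" by auto
  then have "i = 0 \<or> i = 1" "j = 0 \<or> j = 1" by auto
  then show "transpose_mat (pauli_mat p) $$ (i, j) = (pauli_sign p \<cdot>\<^sub>m pauli_mat p) $$ (i, j)"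
    by (elim disjE; cases p; simp add: pauli_sign_def pauli_mat_def)
qed auto

text \<open>The scalar \<open>u\<close> carries everything that is not real. The head of the list is
  the last Kronecker factor.\<close>

fun pauli_tensor :: "'a::real_algebra_1 \<Rightarrow> pauli list \<Rightarrow> 'a mat" where
  "pauli_tensor u [] = mat 1 1 (\<lambda>_. u)"
| "pauli_tensor u (p # ps) = kron (pauli_tensor u ps) (pauli_mat p)"

lemma pauli_tensor_carrier [simp, intro]:
  "pauli_tensor u ps \<in> carrier_mat (2 ^ length ps) (2 ^ length ps)"
proof (induction ps)
  case (Cons p ps)
  then show ?case
    using kron_carrier[OF Cons pauli_mat_carrier] by (simp add: mult.commute)
qed auto

lemma pauli_tensor_commute:
  assumes "u * v = c *\<^sub>R (v * u)" "length ps = length qs"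
  shows "pauli_tensor u ps * pauli_tensor v qs =
    mat_scale (c * (\<Prod>(p, q)\<leftarrow>zip ps qs. pauli_comm p q)) (pauli_tensor v qs * pauli_tensor u ps)"
  using assms(2)
proof (induction ps qs rule: list_induct2)
  case Nil
  show ?case using assms(1)
    by (intro eq_matI) (auto simp: scalar_prod_def scaleR_conv_of_real)
next
  case (Cons p ps q qs)
  let ?A = "pauli_tensor u ps" and ?C = "pauli_tensor v qs"
  let ?d = "c * (\<Prod>(p, q)\<leftarrow>zip ps qs. pauli_comm p q)"
  have A: "?A \<in> carrier_mat (2 ^ length qs) (2 ^ length qs)" using Cons(1) by (metis pauli_tensor_carrier)
  have C: "?C \<in> carrier_mat (2 ^ length qs) (2 ^ length qs)" by blast
  have "kron ?A (pauli_mat p) * kron ?C (pauli_mat q) = kron (?A * ?C) (pauli_mat p * pauli_mat q)"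
    by (rule kron_mult[OF A C pauli_mat_carrier pauli_mat_carrier])
  also have "\<dots> = kron (mat_scale ?d (?C * ?A)) (pauli_comm p q \<cdot>\<^sub>m (pauli_mat q * pauli_mat p))"
    unfolding Cons pauli_mat_commute[of p q] ..
  also have "\<dots> = mat_scale (?d * pauli_comm p q) (kron (?C * ?A) (pauli_mat q * pauli_mat p))"
    by (rule kron_scale[OF mult_carrier_mat[OF C A] mult_carrier_mat[OF pauli_mat_carrier pauli_mat_carrier]])
  also have "kron (?C * ?A) (pauli_mat q * pauli_mat p) = kron ?C (pauli_mat q) * kron ?A (pauli_mat p)"
    by (rule kron_mult[OF C A pauli_mat_carrier pauli_mat_carrier, symmetric])
  finally show ?case by (simp add: ac_simps)
qed

lemma pauli_tensor_square:
  assumes "u * u = c *\<^sub>R 1"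
  shows "pauli_tensor u ps * pauli_tensor u ps =
    mat_scale (c * (\<Prod>p\<leftarrow>ps. pauli_sign p)) (1\<^sub>m (2 ^ length ps))"
proof (induction ps)
  case Nil
  show ?case using assms
    by (intro eq_matI) (auto simp: scalar_prod_def scaleR_conv_of_real)
next
  case (Cons p ps)
  let ?A = "pauli_tensor u ps"
  have "kron ?A (pauli_mat p) * kron ?A (pauli_mat p) = kron (?A * ?A) (pauli_mat p * pauli_mat p)"
    by (rule kron_mult[OF pauli_tensor_carrier pauli_tensor_carrier pauli_mat_carrier pauli_mat_carrier])
  also have "\<dots> = mat_scale (c * (\<Prod>p\<leftarrow>ps. pauli_sign p) * pauli_sign p) (1\<^sub>m (2 ^ length ps * 2))"
    unfolding Cons pauli_mat_square kron_one[symmetric]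
    by (rule kron_scale[OF one_carrier_mat one_carrier_mat])
  finally show ?case by (simp add: ac_simps)
qed

lemma (in scalar_star) pauli_tensor_star:
  assumes "cj u = c *\<^sub>R u"
  shows "conj_transpose cj (pauli_tensor u ps) =
    mat_scale (c * (\<Prod>p\<leftarrow>ps. pauli_sign p)) (pauli_tensor u ps)"
proof (induction ps)
  case Nil
  show ?case using assms
    by (intro eq_matI) (auto simp: conj_transpose_def scaleR_conv_of_real)
next
  case (Cons p ps)
  let ?A = "pauli_tensor u ps"
  have "conj_transpose cj (kron ?A (pauli_mat p)) = kron (conj_transpose cj ?A) (transpose_mat (pauli_mat p))"
    by (rule conj_transpose_kron[OF pauli_tensor_carrier pauli_mat_carrier])
  also have "\<dots> = mat_scale (c * (\<Prod>p\<leftarrow>ps. pauli_sign p) * pauli_sign p) (kron ?A (pauli_mat p))"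
    unfolding Cons pauli_mat_transpose
    by (rule kron_scale[OF pauli_tensor_carrier pauli_mat_carrier])
  finally show ?case by (simp add: ac_simps)
qed

lemma mat_scale_m1: "A \<in> carrier_mat m n \<Longrightarrow> mat_scale (- 1) A = - A"
  by (intro eq_matI) auto

text \<open>The real tensor has square and transpose sign d, and d d = 1; the scalar must contribute
  -d to both for the product to be skew with square -1.\<close>

definition skew_pauli :: "('a::real_algebra_1 \<Rightarrow> 'a) \<Rightarrow> 'a \<times> pauli list \<Rightarrow> bool" where
  "skew_pauli cj = (\<lambda>(u, ps). let d = (\<Prod>p\<leftarrow>ps. pauli_sign p) in
    cj u = (- d) *\<^sub>R u \<and> u * u = (- d) *\<^sub>R 1)"

text \<open>Two real tensors commute up to a sign, and the scalars must supply the opposite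
  one.\<close>

definition anti_pauli :: "'a::real_algebra_1 \<times> pauli list \<Rightarrow> 'a \<times> pauli list \<Rightarrow> bool" where
  "anti_pauli = (\<lambda>(u, ps) (v, qs).
    u * v = (- (\<Prod>(p, q)\<leftarrow>zip ps qs. pauli_comm p q)) *\<^sub>R (v * u))"

lemma pauli_sign_list_square: "(\<Prod>p\<leftarrow>ps. pauli_sign p) * (\<Prod>p\<leftarrow>ps. pauli_sign p) = 1"
  by (induction ps) (auto simp: pauli_sign_def)

lemma pauli_comm_list_square:
  "(\<Prod>(p, q)\<leftarrow>zs. pauli_comm p q) * (\<Prod>(p, q)\<leftarrow>zs. pauli_comm p q) = 1"
  by (induction zs) (auto simp: pauli_comm_def)

text \<open>Reduces the existence of generators to finitely many sign checks on a list. Each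
  unordered pair is checked once; the opposite order follows by negation.\<close>

lemma (in scalar_star) skew_generators_pauli:
  assumes skew: "\<And>g. g \<in> set gs \<Longrightarrow> skew_pauli cj g \<and> length (snd g) = m"
    and anti: "sorted_wrt anti_pauli gs"
  shows "\<exists>F. skew_generators cj (2 ^ m) (length gs) F"
proof -
  let ?F = "\<lambda>g. pauli_tensor (fst g) (snd g)"
  have car: "?F g \<in> carrier_mat (2 ^ m) (2 ^ m)" if "g \<in> set gs" for g
    using skew[OF that] by (metis pauli_tensor_carrier)
  let ?d = "\<lambda>g. \<Prod>p\<leftarrow>snd g. pauli_sign p"
  have star: "conj_transpose cj (?F g) = - ?F g" if g: "g \<in> set gs" for g
  proof -
    have "cj (fst g) = (- ?d g) *\<^sub>R fst g"
      using skew[OF g] by (simp add: skew_pauli_def split_def Let_def)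
    then have "conj_transpose cj (?F g) = mat_scale (- ?d g * ?d g) (?F g)"
      by (rule pauli_tensor_star)
    also have "- ?d g * ?d g = - 1" by (simp add: pauli_sign_list_square)
    finally show ?thesis using mat_scale_m1[OF car[OF g]] by simp
  qed
  have sq: "?F g * ?F g = - 1\<^sub>m (2 ^ m)" if g: "g \<in> set gs" for g
  proof -
    have "fst g * fst g = (- ?d g) *\<^sub>R 1"
      using skew[OF g] by (simp add: skew_pauli_def split_def Let_def)
    then have "?F g * ?F g = mat_scale (- ?d g * ?d g) (1\<^sub>m (2 ^ length (snd g)))"
      by (rule pauli_tensor_square)
    also have "- ?d g * ?d g = - 1" by (simp add: pauli_sign_list_square)
    finally show ?thesis
      using mat_scale_m1[OF one_carrier_mat, of "2 ^ m"] skew[OF g] by simp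
  qed
  have comm: "?F g * ?F h = - (?F h * ?F g)"
    if g: "g \<in> set gs" and h: "h \<in> set gs" and gh: "anti_pauli g h" for g h
  proof -
    let ?e = "\<Prod>(p, q)\<leftarrow>zip (snd g) (snd h). pauli_comm p q"
    have "fst g * fst h = (- ?e) *\<^sub>R (fst h * fst g)"
      using gh by (simp add: anti_pauli_def split_def)
    then have "?F g * ?F h = mat_scale (- ?e * ?e) (?F h * ?F g)"
      using skew[OF g] skew[OF h] by (intro pauli_tensor_commute) auto
    also have "- ?e * ?e = - 1" by (simp add: pauli_comm_list_square)
    finally show ?thesis using mat_scale_m1[OF mult_carrier_mat[OF car[OF h] car[OF g]]] by simp
  qed
  have neg: "A = - C \<Longrightarrow> C = - A" if "C \<in> carrier_mat (2 ^ m) (2 ^ m)" for A C :: "'a mat"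
    using that by (auto intro!: eq_matI)
  have anti': "?F (gs ! i) * ?F (gs ! j) = - (?F (gs ! j) * ?F (gs ! i))"
    if ij: "i < length gs" "j < length gs" "i \<noteq> j" for i j
  proof (cases "i < j")
    case True
    then show ?thesis using anti ij by (intro comm) (auto simp: sorted_wrt_iff_nth_less)
  next
    case False
    then have "?F (gs ! j) * ?F (gs ! i) = - (?F (gs ! i) * ?F (gs ! j))"
      using anti ij by (intro comm) (auto simp: sorted_wrt_iff_nth_less)
    from neg[OF mult_carrier_mat[OF car[OF nth_mem] car[OF nth_mem]] this] ij
    show ?thesis by blast
  qed
  \<comment> \<open>Generators are numbered from 1 and lists from 0. The zero matrix is a filler
    that keeps all values in the carrier.\<close>
  define G where "G i = (if i \<in> {1..length gs} then case_prod pauli_tensor (gs ! (i - 1))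
    else 0\<^sub>m (2 ^ m) (2 ^ m))" for i
  have nth: "i - 1 < length gs" "gs ! (i - 1) \<in> set gs" "G i = ?F (gs ! (i - 1))"
    if "i \<in> {1..length gs}" for i
    using that by (auto simp: G_def split_def)
  have "skew_generators cj (2 ^ m) (length gs) G"
    unfolding skew_generators_def
  proof (intro conjI allI ballI impI)
    fix i
    show "G i \<in> carrier_mat (2 ^ m) (2 ^ m)"
      using car[OF nth(2)] nth(3)[of i] by (cases "i \<in> {1..length gs}") (auto simp: G_def)
    assume i: "i \<in> {1..length gs}"
    show "conj_transpose cj (G i) = - G i" "G i * G i = - 1\<^sub>m (2 ^ m)"
      by (simp_all only: nth(3)[OF i] star[OF nth(2)[OF i]] sq[OF nth(2)[OF i]])
    fix j assume j: "j \<in> {1..length gs}" "i \<noteq> j"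
    then have "i - 1 \<noteq> j - 1" using i by auto
    then show "G i * G j = - (G j * G i)"
      unfolding nth(3)[OF i] nth(3)[OF j(1)] by (rule anti'[OF nth(1)[OF i] nth(1)[OF j(1)]])
  qed
  then show ?thesis by blast
qed

section \<open>The classical Lie algebras\<close>

interpretation real_star: scalar_star "\<lambda>x :: real. x" "\<lambda>x. x" "\<lambda>_ x. x" "{()}"
proof
  fix x y :: real
  show "x = y" if "\<And>b. b \<in> {()} \<Longrightarrow> x = y" using that by blast
qed (simp_all add: algebra_simps)

interpretation complex_star: scalar_star cnj Re "\<lambda>b. if b then Re else Im" "{True, False}"
proof
  fix x y :: complex and a :: real and b :: bool
  show "x = y" if "\<And>b. b \<in> {True, False} \<Longrightarrow> (if b then Re else Im) x = (if b then Re else Im) y"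
    using that[of True] that[of False] by (simp add: complex_eq_iff)
  show "cnj (x + y) = cnj x + cnj y" by simp
  show "cnj (x * y) = cnj y * cnj x" by (simp add: mult.commute)
  show "cnj (a *\<^sub>R x) = a *\<^sub>R cnj x" by simp
  show "Re (x * y) = Re (y * x)" by (simp add: mult.commute)
  show "Re (cnj x * y) = (\<Sum>b\<in>{True, False}. (if b then Re else Im) x * (if b then Re else Im) y)" by simp
  show "(if b then Re else Im) (x + y) = (if b then Re else Im) x + (if b then Re else Im) y" by simp
  show "(if b then Re else Im) (a *\<^sub>R x) = a * (if b then Re else Im) x" by simp
qed simp_all

lemma lessThan_4: "{..<4} = {0, 1, 2, 3 :: nat}" by auto

interpretation quat_star: scalar_star qcnj qRe
  "\<lambda>b. if b = 0 then qRe else if b = 1 then qI else if b = 2 then qJ else qK" "{..<4 :: nat}"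
proof
  fix x y :: quat
  show "x = y" if "\<And>b. b \<in> {..<4 :: nat} \<Longrightarrow>
    (if b = 0 then qRe else if b = 1 then qI else if b = 2 then qJ else qK) x =
    (if b = 0 then qRe else if b = 1 then qI else if b = 2 then qJ else qK) y"
    using that[of 0] that[of 1] that[of 2] that[of 3] by (simp add: quat_eq_iff)
  fix a :: real and b :: nat
  show "qcnj (x * y) = qcnj y * qcnj x" by (simp add: qcnj_def quat_defs quat_eq_iff algebra_simps)
  show "qRe (x * y) = qRe (y * x)" by (simp add: quat_defs algebra_simps)
qed (simp_all add: qcnj_def quat_defs quat_eq_iff lessThan_4 distrib_left)

lemma conj_transpose_id: "conj_transpose (\<lambda>x. x) A = transpose_mat A"
  by (intro eq_matI) (auto simp: conj_transpose_def)

section \<open>Periodicity modulo 8\<close>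

lemma kron_minus:
  assumes "A \<in> carrier_mat m n" "P \<in> carrier_mat p q"
  shows "kron (- A) P = - kron A P" "kron A (- P) = - kron A P"
proof -
  have one: "mat_scale 1 X = X" if "X \<in> carrier_mat k l" for X :: "'b::real_algebra_1 mat" and k l
    by (intro eq_matI) auto
  have m1: "(- 1) \<cdot>\<^sub>m P = - P" "1 \<cdot>\<^sub>m P = P"
    using mat_scale_m1[OF assms(2)] one[OF assms(2)] by simp_all
  note k = mat_scale_m1[OF kron_carrier[OF assms]]
  show "kron (- A) P = - kron A P"
    using kron_scale[OF assms, of "- 1" 1] unfolding mat_scale_m1[OF assms(1)] m1
    using k by simp
  show "kron A (- P) = - kron A P"
    using kron_scale[OF assms, of 1 "- 1"] unfolding one[OF assms(1)] m1
    using k by simp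
qed

text \<open>The six generators of size 8 and their companion EEE are seven anticommuting skew
  matrices. Tensoring them with the symmetric X leaves room for an eighth, 1 tensored with E, since
  E and X anticommute.\<close>

lemma skew_generators_real_8: "\<exists>F. skew_generators (\<lambda>x :: real. x) 16 8 F"
proof -
  let ?gs = "[(1, [PE, PX, PI, PX]), (1, [PE, PZ, PI, PX]), (1, [PX, PI, PE, PX]),
    (1, [PZ, PI, PE, PX]), (1, [PI, PE, PX, PX]), (1, [PI, PE, PZ, PX]),
    (1, [PE, PE, PE, PX]), (1 :: real, [PI, PI, PI, PE])]"
  have "\<exists>F. skew_generators (\<lambda>x :: real. x) (2 ^ 4) (length ?gs) F"
    by (rule real_star.skew_generators_pauli)
      (auto simp: skew_pauli_def anti_pauli_def pauli_sign_def pauli_comm_def)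
  moreover have "length ?gs = 8" by simp
  ultimately show ?thesis by (simp del: list.size)
qed

text \<open>The new generators are \<open>F\<^sub>i \<otimes> \<omega>\<close> and \<open>1 \<otimes> G\<^sub>j\<close>, where the \<open>G\<^sub>j\<close> are the eight real ones and
  \<open>\<omega>\<close> is their product, which is symmetric of square 1.\<close>

lemma (in scalar_star) skew_generators_add_8:
  assumes F: "skew_generators cj N n F"
  shows "\<exists>F. skew_generators cj (N * 16) (n + 8) F"
proof -
  obtain G where G: "skew_generators (\<lambda>x :: real. x) 16 8 G"
    using skew_generators_real_8 by blast
  \<comment> \<open>The count is 16 * 16 * 1 = 2^8. It makes the sign and unitarity facts about the
    product of the eight generators available.\<close>
  interpret R: skew_clifford "ring_mat TYPE(real) 16 ()" mat_scale "conj_transpose (\<lambda>x. x)"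
    "real_star.mat_tr 16" real_star.mat_co "real_star.mat_basis 16" G 8
    by (rule real_star.skew_clifford_mat[OF _ G]) auto
  define \<omega> where "\<omega> = R.monomial {1..8}"
  have \<omega>: "\<omega> \<in> carrier_mat 16 16"
    using R.monomial_closed[of "{1..8}"] by (simp only: \<omega>_def ring_mat_simps)
  have star_\<omega>: "conj_transpose (\<lambda>x. x) \<omega> = \<omega>"
    using R.star_monomial[of "{1..8}"] R.sc_one[OF R.monomial_closed]
    by (simp add: \<omega>_def clifford_sign_eq)
  then have tr_\<omega>: "transpose_mat \<omega> = \<omega>" by (simp only: conj_transpose_id)
  have sq_\<omega>: "\<omega> * \<omega> = 1\<^sub>m 16"
    using R.monomial_unitary[of "{1..8}"] star_\<omega> by (simp add: \<omega>_def ring_mat_simps)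
  have Gc: "G i \<in> carrier_mat 16 16" for i using G by (simp add: skew_generators_def)
  have Fc: "F i \<in> carrier_mat N N" for i using F by (simp add: skew_generators_def)
  have comm_\<omega>: "G j * \<omega> = - (\<omega> * G j)" if "j \<in> {1..8}" for j
  proof -
    \<comment> \<open>\<open>G j\<close> commutes with its own copy inside \<omega> and anticommutes
      with the seven others.\<close>
    have "card ({1..8} - {j}) = 7" using that by simp
    then have "G j * \<omega> = mat_scale (- 1) (\<omega> * G j)"
      using R.monomial_commute[OF that, of "{1..8}"] by (simp add: \<omega>_def ring_mat_simps)
    then show ?thesis using mat_scale_m1[OF mult_carrier_mat[OF \<omega> Gc]] by simp
  qed
  \<comment> \<open>Old and new generators anticommute because \<omega> anticommutes with each of
    the eight; this is why the old ones are tensored with \<omega> and not with 1.\<close>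
  define F' where "F' i = (if i \<le> n then kron (F i) \<omega> else kron (1\<^sub>m N) (G (i - n)))" for i
  note one = one_carrier_mat[of N, where 'a = 'a]
  have one_mult: "1\<^sub>m N * F i = F i" "F i * 1\<^sub>m N = F i" "1\<^sub>m N * 1\<^sub>m N = (1\<^sub>m N :: 'a mat)" for i
    using Fc[of i] by auto
  have star_one: "conj_transpose cj (1\<^sub>m N) = 1\<^sub>m N"
    by (intro eq_matI) (auto simp: conj_transpose_def cj_one cj_zero)
  have "skew_generators cj (N * 16) (n + 8) F'"
    unfolding skew_generators_def
  proof (intro conjI allI ballI impI)
    fix i
    show "F' i \<in> carrier_mat (N * 16) (N * 16)"
      using kron_carrier[OF Fc \<omega>] kron_carrier[OF one Gc] by (simp add: F'_def)
    assume i: "i \<in> {1..n + 8}"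
    have cases: "i \<in> {1..n}" if "i \<le> n" using i that by auto
    have cases': "i - n \<in> {1..8}" if "\<not> i \<le> n" using i that by auto
    show "conj_transpose cj (F' i) = - F' i"
    proof (cases "i \<le> n")
      case True
      have "conj_transpose cj (F i) = - F i" using F cases[OF True] by (simp add: skew_generators_def)
      then show ?thesis using True
        by (simp add: F'_def conj_transpose_kron[OF Fc \<omega>] tr_\<omega> kron_minus[OF Fc \<omega>])
    next
      case False
      have "transpose_mat (G (i - n)) = - G (i - n)"
        using G cases'[OF False] by (simp add: skew_generators_def conj_transpose_id)
      then show ?thesis using False
        by (simp add: F'_def conj_transpose_kron[OF one Gc] star_one kron_minus[OF one Gc])
    qed
    show "F' i * F' i = - 1\<^sub>m (N * 16)"
    proof (cases "i \<le> n")
      case True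
      have "F i * F i = - 1\<^sub>m N" using F cases[OF True] by (simp add: skew_generators_def)
      then show ?thesis using True
        by (simp add: F'_def kron_mult[OF Fc Fc \<omega> \<omega>] sq_\<omega> kron_minus[OF one one_carrier_mat] kron_one)
    next
      case False
      have "G (i - n) * G (i - n) = - 1\<^sub>m 16"
        using G cases'[OF False] by (simp add: skew_generators_def)
      then show ?thesis using False
        by (simp add: F'_def kron_mult[OF one one Gc Gc] one_mult kron_minus[OF one one_carrier_mat] kron_one
            del: left_mult_one_mat right_mult_one_mat)
    qed
    fix j assume j: "j \<in> {1..n + 8}" "i \<noteq> j"
    have jcases: "j \<in> {1..n}" if "j \<le> n" using j that by auto
    have jcases': "j - n \<in> {1..8}" if "\<not> j \<le> n" using j that by auto
    consider "i \<le> n" "j \<le> n" | "i \<le> n" "\<not> j \<le> n" | "\<not> i \<le> n" "j \<le> n" | "\<not> i \<le> n" "\<not> j \<le> n"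
      by blast
    then show "F' i * F' j = - (F' j * F' i)"
    proof cases
      case 1
      have "F i * F j = - (F j * F i)"
        using F cases[OF 1(1)] jcases[OF 1(2)] j(2) unfolding skew_generators_def by blast
      then show ?thesis using 1
        by (simp add: F'_def kron_mult[OF Fc Fc \<omega> \<omega>] kron_minus[OF mult_carrier_mat[OF Fc Fc] mult_carrier_mat[OF \<omega> \<omega>]])
    next
      case 2
      then show ?thesis
        by (simp add: F'_def kron_mult[OF Fc one \<omega> Gc] kron_mult[OF one Fc Gc \<omega>] one_mult
            comm_\<omega>[OF jcases'] kron_minus[OF Fc mult_carrier_mat[OF \<omega> Gc]]
            del: left_mult_one_mat right_mult_one_mat)
    next
      case 3
      then show ?thesis
        by (simp add: F'_def kron_mult[OF Fc one \<omega> Gc] kron_mult[OF one Fc Gc \<omega>] one_mult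
            comm_\<omega>[OF cases'] kron_minus[OF Fc mult_carrier_mat[OF \<omega> Gc]]
            del: left_mult_one_mat right_mult_one_mat)
    next
      case 4
      have "i - n \<noteq> j - n" using 4 j(2) by auto
      then have "G (i - n) * G (j - n) = - (G (j - n) * G (i - n))"
        using G cases'[OF 4(1)] jcases'[OF 4(2)] unfolding skew_generators_def by blast
      then show ?thesis using 4
        by (simp add: F'_def kron_mult[OF one one Gc Gc]
            one_mult kron_minus[OF one mult_carrier_mat[OF Gc Gc]]
            del: left_mult_one_mat right_mult_one_mat)
    qed
  qed
  then show ?thesis by blast
qed

lemma (in scalar_star) skew_generators_add_8k:
  assumes "\<exists>F. skew_generators cj (2 ^ m) n F"
  shows "\<exists>F. skew_generators cj (2 ^ (4 * k + m)) (8 * k + n) F"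
proof (induction k)
  case (Suc k)
  then obtain F where "skew_generators cj (2 ^ (4 * k + m)) (8 * k + n) F" by blast
  from skew_generators_add_8[OF this] show ?case
    by (simp add: power_add ac_simps)
qed (use assms in simp)

section \<open>Identification with so, sp and su\<close>

definition skew_lie_algebra :: "('a::real_algebra_1 \<Rightarrow> 'a) \<Rightarrow> nat \<Rightarrow> (real, 'a mat) lie_algebra" where
  "skew_lie_algebra cj N = matrix_lie_algebra {A \<in> carrier_mat N N. conj_transpose cj A = - A}"

lemma so_eq: "so N = skew_lie_algebra (\<lambda>x. x) N"
  by (simp add: so_def skew_lie_algebra_def conj_transpose_id)

lemma sp_eq: "sp N = skew_lie_algebra qcnj N"
  by (simp add: sp_def skew_lie_algebra_def conj_transpose_def)

lemma ring_mat_a_minus: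
  assumes "A \<in> carrier_mat N N" "C \<in> carrier_mat N N"
  shows "A \<ominus>\<^bsub>ring_mat TYPE('a :: ring_1) N b\<^esub> C = A - C"
  using assms by (auto simp: a_minus_def ring_mat_minus ring_mat_simps intro!: eq_matI)

text \<open>For even n the condition on the top coefficient is void, and \<open>lie_carrier\<close>
  consists of all skew matrices.\<close>

lemma (in scalar_star) complexification_H_lie_skew:
  assumes N: "N > 0" "skew_generators cj N n F" "N * N * card B = 2 ^ n"
    and n: "even n" and rs: "r + s = n"
  shows "complexification (H_lie r s) \<cong>\<^sub>L complexification (skew_lie_algebra cj N)"
proof -
  have n4: "n mod 4 \<noteq> 3" "n mod 4 \<noteq> 1" using n by presburger+
  interpret C: skew_clifford "ring_mat TYPE('a) N ()" mat_scale "conj_transpose cj" "mat_tr N" mat_co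
    "mat_basis N" F n
    by (rule skew_clifford_mat[OF N n4(1)])
  show ?thesis
  proof (rule C.complexification_H_lie[OF rs], unfold ring_mat_simps)
    show "carrier (skew_lie_algebra cj N) = C.lie_carrier"
      using n4 by (auto simp: skew_lie_algebra_def matrix_lie_algebra_def C.lie_carrier_def
          ring_mat_simps ring_mat_minus)
  qed (auto simp: skew_lie_algebra_def matrix_lie_algebra_def ring_mat_a_minus)
qed

text \<open>Here n + 1 is 3 modulo 4, so again no top coefficient is constrained; a pair is skew
  exactly when both components are, which gives the product Lie algebra.\<close>

lemma (in scalar_star) complexification_H_lie_skew_prod:
  assumes N: "N > 0" "skew_generators cj N n F" "N * N * card B = 2 ^ n"
    and n: "n mod 4 = 2" and rs: "r + s = Suc n"
  shows "complexification (H_lie r s) \<cong>\<^sub>L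
    complexification (skew_lie_algebra cj N \<times>\<^sub>L skew_lie_algebra cj N)"
proof -
  let ?M = "ring_mat TYPE('a) N ()"
  interpret D: skew_clifford ?M mat_scale "conj_transpose cj" "mat_tr N" mat_co "mat_basis N" F n
    by (rule skew_clifford_mat[OF N]) (use n in simp)
  interpret C: skew_clifford "RDirProd ?M ?M" "\<lambda>a. map_prod (mat_scale a) (mat_scale a)"
    "map_prod (conj_transpose cj) (conj_transpose cj)" "\<lambda>(x, y). mat_tr N x + mat_tr N y"
    "\<lambda>(b, s) (x, y). if b then mat_co s x else mat_co s y" "UNIV \<times> mat_basis N"
    "\<lambda>i. if i \<le> n then (F i, F i) else (D.monomial {1..n}, \<ominus>\<^bsub>?M\<^esub> D.monomial {1..n})" "Suc n"
    by (rule D.skew_clifford_prod[OF n])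
  have n4: "Suc n mod 4 \<noteq> 1" using n by presburger
  note minus = RDirProd_minus[OF ring_mat_ring ring_mat_ring]
  let ?L = "skew_lie_algebra cj N"
  show ?thesis
  proof (rule C.complexification_H_lie[OF rs])
    show "carrier (?L \<times>\<^sub>L ?L) = C.lie_carrier"
      using n4 by (auto simp: skew_lie_algebra_def matrix_lie_algebra_def C.lie_carrier_def lie_product_def
          ring_mat_simps ring_mat_minus minus)
  qed (auto simp: skew_lie_algebra_def matrix_lie_algebra_def lie_product_def ring_mat_a_minus
      ring_mat_simps a_minus_def[of "RDirProd ?M ?M"] minus ring_mat_minus intro!: eq_matI)
qed

lemma mat_adjoint_eq: "mat_adjoint A = conj_transpose cnj (A :: complex mat)"
  by (intro eq_matI) (auto simp: mat_adjoint_def conj_transpose_def mat_of_rows_def)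

lemma complexification_H_lie_su:
  assumes N: "N > 0" "skew_generators cnj N n F" "N * N * 2 = 2 ^ n"
    and n: "n mod 4 = 1" and rs: "r + s = n"
  shows "complexification (H_lie r s) \<cong>\<^sub>L complexification (su N)"
proof -
  have N': "N * N * card {True, False} = 2 ^ n" using N(3) by simp
  interpret C: skew_clifford "ring_mat TYPE(complex) N ()" mat_scale "conj_transpose cnj"
    "complex_star.mat_tr N" complex_star.mat_co "complex_star.mat_basis N" F n
    by (rule complex_star.skew_clifford_mat[OF N(1,2) N']) (use n in simp)
  \<comment> \<open>Scalar matrices are central, and the factor \<i> makes this one skew; hence it
    is a real multiple of the top monomial.\<close>
  let ?J = "\<i> \<cdot>\<^sub>m 1\<^sub>m N :: complex mat"
  have Fc: "F i \<in> carrier_mat N N" for i using N(2) by (simp add: skew_generators_def)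
  have J: "?J \<in> carrier_mat N N" by simp
  have "C.lie_carrier = {x \<in> carrier_mat N N. conj_transpose cnj x = - x \<and> complex_star.mat_tr N (?J * x) = 0}"
  proof -
    have "C.lie_carrier = {x \<in> carrier (ring_mat TYPE(complex) N ()).
        conj_transpose cnj x = \<ominus>\<^bsub>ring_mat TYPE(complex) N ()\<^esub> x \<and>
        complex_star.mat_tr N (?J \<otimes>\<^bsub>ring_mat TYPE(complex) N ()\<^esub> x) = 0}"
    proof (rule C.lie_carrier_central[OF n], unfold ring_mat_simps)
      show "conj_transpose cnj ?J = \<ominus>\<^bsub>ring_mat TYPE(complex) N ()\<^esub> ?J"
        unfolding ring_mat_minus[OF J] by (intro eq_matI) (auto simp: conj_transpose_def)
      have "?J $$ (0, 0) \<noteq> 0\<^sub>m N N $$ (0, 0)" using N(1) by simp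
      then show "?J \<noteq> 0\<^sub>m N N" by metis
      show "F i * ?J = ?J * F i" for i
        using Fc[of i] mult_smult_distrib[OF Fc one_carrier_mat] mult_smult_assoc_mat[OF one_carrier_mat Fc]
        by simp
    qed simp
    also have "\<dots> = {x \<in> carrier_mat N N. conj_transpose cnj x = - x \<and> complex_star.mat_tr N (?J * x) = 0}"
      unfolding ring_mat_simps by (intro Collect_cong conj_cong refl) (simp only: ring_mat_minus)
    finally show ?thesis .
  qed
  also have "\<dots> = {x \<in> carrier_mat N N. mat_adjoint x = - x \<and> (\<Sum>i<N. x $$ (i, i)) = 0}"
  proof -
    \<comment> \<open>The real part of the trace of \<i> x is -Im (tr x). The diagonal of a
      skew-Hermitian x is imaginary, so nothing of the trace is lost.\<close>
    have "complex_star.mat_tr N (?J * x) = 0 \<longleftrightarrow> (\<Sum>i<N. x $$ (i, i)) = 0"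
      if x: "x \<in> carrier_mat N N" "conj_transpose cnj x = - x" for x
    proof -
      have "?J * x = \<i> \<cdot>\<^sub>m x" using x(1) mult_smult_assoc_mat[OF one_carrier_mat x(1)] by simp
      then have "complex_star.mat_tr N (?J * x) = - Im (\<Sum>i<N. x $$ (i, i))"
        using x(1) by (simp add: complex_star.mat_tr_def sum_negf)
      moreover have "Re (x $$ (i, i)) = 0" if "i < N" for i
      proof -
        have "conj_transpose cnj x $$ (i, i) = - x $$ (i, i)" using x that by simp
        then show ?thesis using conj_transpose_index[OF x(1) that that, of cnj] by (simp add: complex_eq_iff)
      qed
      ultimately show ?thesis by (simp add: complex_eq_iff)
    qed
    then show ?thesis by (auto simp: mat_adjoint_eq)
  qed
  finally have carrier: "carrier (su N) = C.lie_carrier"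
    by (simp add: su_def matrix_lie_algebra_def)
  show ?thesis
    by (rule C.complexification_H_lie[OF rs carrier], unfold ring_mat_simps)
      (auto simp: su_def matrix_lie_algebra_def ring_mat_a_minus)
qed

section \<open>Generators in the base dimensions\<close>

lemma skew_generators_real_0: "\<exists>F. skew_generators (\<lambda>x :: real. x) (2 ^ 0) 0 F"
  using real_star.skew_generators_pauli[of "[]" 0] by simp

lemma skew_generators_complex_1: "\<exists>F. skew_generators cnj (2 ^ 0) 1 F"
  using complex_star.skew_generators_pauli[of "[(\<i>, [])]" 0] by (simp add: skew_pauli_def)

lemma skew_generators_quat_2: "\<exists>F. skew_generators qcnj (2 ^ 0) 2 F"
proof -
  let ?gs = "[(Quat 0 1 0 0, []), (Quat 0 0 1 0, [] :: pauli list)]"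
  have "\<exists>F. skew_generators qcnj (2 ^ 0) (length ?gs) F"
    by (rule quat_star.skew_generators_pauli)
      (auto simp: skew_pauli_def anti_pauli_def qcnj_def quat_defs)
  moreover have "length ?gs = 2" by simp
  ultimately show ?thesis by (simp del: list.size)
qed

text \<open>The quaternion k anticommutes with i and j, and the two matrices that share the scalar k
  are separated by X and Z.\<close>

lemma skew_generators_quat_4: "\<exists>F. skew_generators qcnj (2 ^ 1) 4 F"
proof -
  let ?gs = "[(Quat 0 1 0 0, [PI]), (Quat 0 0 1 0, [PI]), (Quat 0 0 0 1, [PX]), (Quat 0 0 0 1, [PZ])]"
  have "\<exists>F. skew_generators qcnj (2 ^ 1) (length ?gs) F"
    by (rule quat_star.skew_generators_pauli)
      (auto simp: skew_pauli_def anti_pauli_def qcnj_def quat_defs pauli_sign_def pauli_comm_def)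
  moreover have "length ?gs = 4" by simp
  ultimately show ?thesis by (simp del: list.size)
qed

text \<open>X, Z and E anticommute pairwise in the first slot; E is used three times, and the second
  slot separates these by X, Z, E again. The scalar \<i> is inserted where the real tensor is
  symmetric.\<close>

lemma skew_generators_complex_5: "\<exists>F. skew_generators cnj (2 ^ 2) 5 F"
proof -
  let ?gs = "[(\<i>, [PX, PI]), (\<i>, [PZ, PI]), (1, [PE, PX]), (1, [PE, PZ]), (\<i>, [PE, PE])]"
  have "\<exists>F. skew_generators cnj (2 ^ 2) (length ?gs) F"
    by (rule complex_star.skew_generators_pauli)
      (auto simp: skew_pauli_def anti_pauli_def pauli_sign_def pauli_comm_def)
  moreover have "length ?gs = 5" by simp
  ultimately show ?thesis by (simp del: list.size)
qed

text \<open>The cyclic shifts of E, X, I and of E, Z, I. Tensors from different shifts clash in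
  exactly one slot, where E meets X or Z, and meet the identity in the others; within a shift X
  meets Z.\<close>

lemma skew_generators_real_6: "\<exists>F. skew_generators (\<lambda>x :: real. x) (2 ^ 3) 6 F"
proof -
  let ?gs = "[(1, [PE, PX, PI]), (1, [PE, PZ, PI]), (1, [PX, PI, PE]), (1, [PZ, PI, PE]),
    (1, [PI, PE, PX]), (1 :: real, [PI, PE, PZ])]"
  have "\<exists>F. skew_generators (\<lambda>x :: real. x) (2 ^ 3) (length ?gs) F"
    by (rule real_star.skew_generators_pauli)
      (auto simp: skew_pauli_def anti_pauli_def pauli_sign_def pauli_comm_def)
  moreover have "length ?gs = 6" by simp
  ultimately show ?thesis by (simp del: list.size)
qed

theorem corollary5p5:
  fixes r s k :: nat
  assumes "r + s > 0"
  shows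
    "(r + s = 8 * k \<longrightarrow>
       complexification (H_lie r s) \<cong>\<^sub>L complexification (so (2 ^ (4 * k)))) \<and>
     (r + s = 8 * k + 1 \<longrightarrow>
       complexification (H_lie r s) \<cong>\<^sub>L complexification (su (2 ^ (4 * k)))) \<and>
     (r + s = 8 * k + 2 \<longrightarrow>
       complexification (H_lie r s) \<cong>\<^sub>L complexification (sp (2 ^ (4 * k)))) \<and>
     (r + s = 8 * k + 3 \<longrightarrow>
       complexification (H_lie r s) \<cong>\<^sub>L
         complexification (sp (2 ^ (4 * k)) \<times>\<^sub>L sp (2 ^ (4 * k)))) \<and>
     (r + s = 8 * k + 4 \<longrightarrow>
       complexification (H_lie r s) \<cong>\<^sub>L complexification (sp (2 ^ (4 * k + 1)))) \<and>
     (r + s = 8 * k + 5 \<longrightarrow>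
       complexification (H_lie r s) \<cong>\<^sub>L complexification (su (2 ^ (4 * k + 2)))) \<and>
     (r + s = 8 * k + 6 \<longrightarrow>
       complexification (H_lie r s) \<cong>\<^sub>L complexification (so (2 ^ (4 * k + 3)))) \<and>
     (r + s = 8 * k + 7 \<longrightarrow>
       complexification (H_lie r s) \<cong>\<^sub>L
         complexification (so (2 ^ (4 * k + 3)) \<times>\<^sub>L so (2 ^ (4 * k + 3))))"
proof -
  \<comment> \<open>The count N^2 dim K = 2^n for N = 2^a and dim K = 2^b.\<close>
  have sq: "2 ^ a * 2 ^ a * 2 ^ b = (2 :: nat) ^ (2 * a + b)" for a b
    by (simp add: power_add[symmetric] mult_2)
  have pos: "(0 :: nat) < 2 ^ a" for a by simp
  have card: "card {()} = 2 ^ 0" "card {..<4 :: nat} = 2 ^ 2" by simp_all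
  show ?thesis
  proof (intro conjI impI)
    assume n: "r + s = 8 * k"
    obtain F where F: "skew_generators (\<lambda>x :: real. x) (2 ^ (4 * k + 0)) (8 * k + 0) F"
      using real_star.skew_generators_add_8k[OF skew_generators_real_0] by blast
    have "2 ^ (4 * k + 0) * 2 ^ (4 * k + 0) * card {()} = (2 :: nat) ^ (8 * k + 0)"
      unfolding card sq by (simp add: power_add)
    from real_star.complexification_H_lie_skew[OF pos F this] n
    show "complexification (H_lie r s) \<cong>\<^sub>L complexification (so (2 ^ (4 * k)))"
      by (simp add: so_eq)
  next
    assume n: "r + s = 8 * k + 1"
    obtain F where F: "skew_generators cnj (2 ^ (4 * k + 0)) (8 * k + 1) F"
      using complex_star.skew_generators_add_8k[OF skew_generators_complex_1] by blast
    have "2 ^ (4 * k + 0) * 2 ^ (4 * k + 0) * 2 = (2 :: nat) ^ (8 * k + 1)"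
      using sq[of "4 * k" 1] by simp
    moreover have "(8 * k + 1) mod 4 = 1" by presburger
    ultimately show "complexification (H_lie r s) \<cong>\<^sub>L complexification (su (2 ^ (4 * k)))"
      using complexification_H_lie_su[OF pos F _ _ n] by simp
  next
    assume n: "r + s = 8 * k + 2"
    obtain F where F: "skew_generators qcnj (2 ^ (4 * k + 0)) (8 * k + 2) F"
      using quat_star.skew_generators_add_8k[OF skew_generators_quat_2] by blast
    have "2 ^ (4 * k + 0) * 2 ^ (4 * k + 0) * card {..<4 :: nat} = (2 :: nat) ^ (8 * k + 2)"
      unfolding card sq by (simp add: power_add)
    from quat_star.complexification_H_lie_skew[OF pos F this _ n]
    show "complexification (H_lie r s) \<cong>\<^sub>L complexification (sp (2 ^ (4 * k)))"
      by (simp add: sp_eq)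
  next
    assume n: "r + s = 8 * k + 3"
    \<comment> \<open>One generator fewer than r + s: the remaining one is the pair (\<omega>,
      -\<omega>) built from the product of these.\<close>
    obtain F where F: "skew_generators qcnj (2 ^ (4 * k + 0)) (8 * k + 2) F"
      using quat_star.skew_generators_add_8k[OF skew_generators_quat_2] by blast
    have dim: "2 ^ (4 * k + 0) * 2 ^ (4 * k + 0) * card {..<4 :: nat} = (2 :: nat) ^ (8 * k + 2)"
      unfolding card sq by (simp add: power_add)
    have "(8 * k + 2) mod 4 = 2" by presburger
    from quat_star.complexification_H_lie_skew_prod[OF pos F dim this, of r s] n
    show "complexification (H_lie r s) \<cong>\<^sub>L complexification (sp (2 ^ (4 * k)) \<times>\<^sub>L sp (2 ^ (4 * k)))"
      by (simp add: sp_eq)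
  next
    assume n: "r + s = 8 * k + 4"
    obtain F where F: "skew_generators qcnj (2 ^ (4 * k + 1)) (8 * k + 4) F"
      using quat_star.skew_generators_add_8k[OF skew_generators_quat_4] by blast
    have "2 ^ (4 * k + 1) * 2 ^ (4 * k + 1) * card {..<4 :: nat} = (2 :: nat) ^ (8 * k + 4)"
      unfolding card sq by (simp add: power_add)
    from quat_star.complexification_H_lie_skew[OF pos F this _ n]
    show "complexification (H_lie r s) \<cong>\<^sub>L complexification (sp (2 ^ (4 * k + 1)))"
      by (simp add: sp_eq)
  next
    assume n: "r + s = 8 * k + 5"
    obtain F where F: "skew_generators cnj (2 ^ (4 * k + 2)) (8 * k + 5) F"
      using complex_star.skew_generators_add_8k[OF skew_generators_complex_5] by blast
    have "2 ^ (4 * k + 2) * 2 ^ (4 * k + 2) * 2 = (2 :: nat) ^ (8 * k + 5)"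
      using sq[of "4 * k + 2" 1] by (simp add: power_add)
    moreover have "(8 * k + 5) mod 4 = 1" by presburger
    ultimately show "complexification (H_lie r s) \<cong>\<^sub>L complexification (su (2 ^ (4 * k + 2)))"
      by (rule complexification_H_lie_su[OF pos F _ _ n])
  next
    assume n: "r + s = 8 * k + 6"
    obtain F where F: "skew_generators (\<lambda>x :: real. x) (2 ^ (4 * k + 3)) (8 * k + 6) F"
      using real_star.skew_generators_add_8k[OF skew_generators_real_6] by blast
    have "2 ^ (4 * k + 3) * 2 ^ (4 * k + 3) * card {()} = (2 :: nat) ^ (8 * k + 6)"
      unfolding card sq by (simp add: power_add)
    from real_star.complexification_H_lie_skew[OF pos F this _ n]
    show "complexification (H_lie r s) \<cong>\<^sub>L complexification (so (2 ^ (4 * k + 3)))"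
      by (simp add: so_eq)
  next
    assume n: "r + s = 8 * k + 7"
    \<comment> \<open>Again the generators of the preceding residue class, completed by the pair
      (\<omega>, -\<omega>).\<close>
    obtain F where F: "skew_generators (\<lambda>x :: real. x) (2 ^ (4 * k + 3)) (8 * k + 6) F"
      using real_star.skew_generators_add_8k[OF skew_generators_real_6] by blast
    have dim: "2 ^ (4 * k + 3) * 2 ^ (4 * k + 3) * card {()} = (2 :: nat) ^ (8 * k + 6)"
      unfolding card sq by (simp add: power_add)
    have "(8 * k + 6) mod 4 = 2" by presburger
    from real_star.complexification_H_lie_skew_prod[OF pos F dim this, of r s] n
    show "complexification (H_lie r s) \<cong>\<^sub>L
        complexification (so (2 ^ (4 * k + 3)) \<times>\<^sub>L so (2 ^ (4 * k + 3)))"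
      by (simp add: so_eq)
  qed
qed

end
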